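(* Let $f:\mathbb D\to\mathbb D$ be analytic with factorization $f=EBS_\nu$, where $E$ is outer, $B$ is a Blaschke product and $S_\nu$ is the singular inner function associated to the positive singular measure $\nu$ on $\partial\mathbb D$ (unimodular constants absorbed). Define the positive measure on $\overline{\mathbb D}$ $$\mu=\sum_{z\in\mathbb D: f(z)=0}(1-|z|^2)\delta_z+2\nu+2\log|f|^{-1}\,dm,$$ (zeros counted with multiplicity, $|f|$ on $\partial\mathbb D$ denoting the modulus of the radial boundary values), and $$P[\mu](z)=\int_{\overline{\mathbb D}}\frac{1-|z|^2}{|1-\overline w z|^2}\,d\mu(w),\qquad z\in\mathbb D.$$ The following are equivalent: (a) $f$ is contractive. (b) There is a constant $C>0$ such that for every Carleson box $Q$ with $P[\mu](z_Q)\le C$ one has $\dfrac{\mu(\overline Q)}{l(Q)}\ge C\,P[\mu](z_Q)$.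
   Context: $\mathbb D$ is the open unit disc, $m$ normalized Lebesgue measure on $\partial\mathbb D$, $|I|=m(I)$ for arcs $I$. The Carleson box of an arc $I$ is $Q=Q(I)=\{z\in\mathbb D:1-|z|\le|I|,\ z/|z|\in I\}$, with $l(Q)=|I|$; $\overline Q$ is its closure in $\overline{\mathbb D}$; $\xi_Q$ is the center of the arc $\overline Q\cap\partial\mathbb D$ and $z_Q=(1-l(Q))\xi_Q$. For analytic $f:\mathbb D\to\mathbb D$, $D_h(f)(z)=\frac{(1-|z|^2)|f'(z)|}{1-|f(z)|^2}$, and $f$ is contractive if $\sup_{z\in\mathbb D}D_h(f)(z)<1$. *)

theory Defs
  imports "HOL-Analysis.Analysis" "HOL-Complex_Analysis.Complex_Analysis"
begin

definition circle_m :: "complex measure" where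
  "circle_m = distr (density lborel (\<lambda>t::real. ennreal (indicator {0..2*pi} t / (2*pi))))
                    (restrict_space borel (sphere (0::complex) 1)) cis"

text \<open>Closed arc of the unit circle with center cis theta and normalized length l (0 < l <= 1).\<close>
definition arc :: "real \<Rightarrow> real \<Rightarrow> complex set" where
  "arc \<theta> l = cis ` {\<theta> - pi * l .. \<theta> + pi * l}"

definition carleson_box :: "real \<Rightarrow> real \<Rightarrow> complex set" where
  "carleson_box \<theta> l = {z. cmod z < 1 \<and> 1 - cmod z \<le> l \<and> z / complex_of_real (cmod z) \<in> arc \<theta> l}"

definition zQ :: "real \<Rightarrow> real \<Rightarrow> complex" where
  "zQ \<theta> l = complex_of_real (1 - l) * cis \<theta>"

definition hyp_deriv :: "(complex \<Rightarrow> complex) \<Rightarrow> complex \<Rightarrow> real" where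
  "hyp_deriv f z = (1 - (cmod z)^2) * cmod (deriv f z) / (1 - (cmod (f z))^2)"

definition contractive :: "(complex \<Rightarrow> complex) \<Rightarrow> bool" where
  "contractive f \<longleftrightarrow> (\<exists>c<1. \<forall>z\<in>ball 0 1. hyp_deriv f z \<le> c)"

definition blaschke_factor :: "complex \<Rightarrow> complex \<Rightarrow> complex" where
  "blaschke_factor a z = (complex_of_real (cmod a) / a) * (a - z) / (1 - cnj a * z)"

text \<open>Blaschke product (finite or infinite; zeros listed with multiplicity, index set I).\<close>
definition is_blaschke :: "(complex \<Rightarrow> complex) \<Rightarrow> bool" where
  "is_blaschke B \<longleftrightarrow> (\<exists>(k::nat) (a::nat \<Rightarrow> complex) (I::nat set).
      (\<forall>n\<in>I. a n \<in> ball 0 1 - {0}) \<and>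
      summable (\<lambda>n. if n \<in> I then 1 - cmod (a n) else 0) \<and>
      (\<forall>z\<in>ball 0 1. B z = z ^ k * (\<Prod>n. if n \<in> I then blaschke_factor (a n) z else 1)))"

text \<open>Outer function (a unimodular constant is absorbed here).\<close>
definition is_outer :: "(complex \<Rightarrow> complex) \<Rightarrow> bool" where
  "is_outer E \<longleftrightarrow> (\<exists>(h::complex \<Rightarrow> real) (c::complex). integrable circle_m h \<and> cmod c = 1 \<and>
      (\<forall>z\<in>ball 0 1. E z = c * exp (integral\<^sup>L circle_m
            (\<lambda>\<zeta>. (\<zeta> + z) / (\<zeta> - z) * complex_of_real (h \<zeta>)))))"

definition pos_singular_measure :: "complex measure \<Rightarrow> bool" where
  "pos_singular_measure \<nu> \<longleftrightarrow> sets \<nu> = sets (restrict_space borel (sphere (0::complex) 1)) \<and>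
      emeasure \<nu> (sphere 0 1) < \<infinity> \<and>
      (\<exists>N\<in>sets \<nu>. emeasure circle_m N = 0 \<and> emeasure \<nu> (sphere 0 1 - N) = 0)"

definition singular_inner :: "complex measure \<Rightarrow> complex \<Rightarrow> complex" where
  "singular_inner \<nu> z = exp (- integral\<^sup>L \<nu> (\<lambda>\<zeta>. (\<zeta> + z) / (\<zeta> - z)))"

definition radial_lim :: "(complex \<Rightarrow> complex) \<Rightarrow> complex \<Rightarrow> complex" where
  "radial_lim f \<zeta> = Lim (at_left 1) (\<lambda>r::real. f (complex_of_real r * \<zeta>))"

definition zeros_in_disc :: "(complex \<Rightarrow> complex) \<Rightarrow> complex set" where
  "zeros_in_disc f = {z \<in> ball 0 1. f z = 0}"

definition pkernel :: "complex \<Rightarrow> complex \<Rightarrow> real" where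
  "pkernel z w = (1 - (cmod z)^2) / (cmod (1 - cnj w * z))^2"

definition mu_meas :: "(complex \<Rightarrow> complex) \<Rightarrow> complex measure \<Rightarrow> complex set \<Rightarrow> ennreal" where
  "mu_meas f \<nu> A =
     (\<Sum>\<^sub>\<infinity>a\<in>zeros_in_disc f \<inter> A. ennreal (of_int (zorder f a) * (1 - (cmod a)^2)))
     + 2 * emeasure \<nu> (A \<inter> sphere 0 1)
     + 2 * (\<integral>\<^sup>+\<zeta>. ennreal (- ln (cmod (radial_lim f \<zeta>))) * indicator A \<zeta> \<partial>circle_m)"

definition poisson_mu :: "(complex \<Rightarrow> complex) \<Rightarrow> complex measure \<Rightarrow> complex \<Rightarrow> ennreal" where
  "poisson_mu f \<nu> z =
     (\<Sum>\<^sub>\<infinity>a\<in>zeros_in_disc f. ennreal (of_int (zorder f a) * (1 - (cmod a)^2) * pkernel z a))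
     + 2 * (\<integral>\<^sup>+\<zeta>. ennreal (pkernel z \<zeta>) \<partial>\<nu>)
     + 2 * (\<integral>\<^sup>+\<zeta>. ennreal (pkernel z \<zeta> * - ln (cmod (radial_lim f \<zeta>))) \<partial>circle_m)"

end

theory Submission
  imports Defs
begin

text \<open>
  Write \<open>P\<close> for the Poisson integral of \<open>\<mu>\<close>. Since a Blaschke factor satisfies
  \<open>|b\<^sub>a(z)|\<^sup>2 = 1 - (1 - |a|\<^sup>2) pkernel z a\<close>, one has \<open>|f|\<^sup>2 \<le> exp (- P)\<close> everywhere and
  \<open>|f|\<^sup>2 \<ge> exp (- 2 P)\<close> where \<open>P \<le> 1/2\<close>; in the region where \<open>P\<close> is small,
  \<open>1 - |f|\<^sup>2\<close> and \<open>P\<close> are comparable.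

  If the hyperbolic derivative is at most \<open>c < 1\<close>, then \<open>1 - |f|\<^sup>2\<close> decays along a radius at most
  like \<open>(1 - |z|)\<^sup>c\<close>, whereas the part of \<open>P\<close> coming from the mass outside \<open>Q\<close> decays like
  \<open>1 - |z|\<close>. Moving from \<open>z\<^sub>Q\<close> down to a fixed small proportion of \<open>l(Q)\<close> therefore
  forces mass into \<open>Q\<close>.

  Conversely, if the hyperbolic derivative is close to 1 at \<open>z\<^sub>0\<close>, then on a large hyperbolic disc around
  \<open>z\<^sub>0\<close> the function \<open>1 - |f|\<^sup>2\<close> is comparable to \<open>(1 - |a|\<^sup>2) pkernel z a\<close> for a single
  point \<open>a\<close>. One of two well separated small boxes near \<open>z\<^sub>0\<close> is far from \<open>a\<close>; on it
  \<open>P\<close> is small and proportional to the distance to the circle, so the box carries too little mass.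

  The density of \<open>\<mu>\<close> on the circle is identified by Fatou's theorem: along a radius the Poisson integral of
  \<open>log |E|\<close> tends to its boundary value almost everywhere, while the contribution of the zeros and of \<open>\<nu>\<close> has
  lower limit 0.
\<close>

section \<open>The Poisson kernel and Carleson boxes\<close>

text \<open>Both implications are proved for an abstract functional \<open>L\<close>, tested only on
  Poisson kernels and indicators; the factorization enters through the two-sided comparison of
  \<open>|f|^2\<close> with \<open>P\<close>. In the first implication, descending by the proportion
  \<open>t\<close> shrinks the outside contribution by a multiple of \<open>t\<close>, but
  \<open>1 - |f|^2\<close> only by about \<open>t^c\<close>; since \<open>c < 1\<close>, a small
  \<open>t\<close> absorbs every constant. In the converse, a box of size \<open>l\<close> is cut
  into \<open>N\<close> boxes of relative size \<open>t = 1/N\<close>. Each has size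
  \<open>t l\<close> and a Poisson value of order \<open>t P\<close>, so the total mass is of order
  \<open>N (t l) (t P) = t l P\<close>, too small once \<open>N\<close> is large against
  \<open>1/C\<close>. How close to 1 the hyperbolic derivative has to be thus depends on
  \<open>C\<close>. A further obstacle: \<open>is_outer\<close> supplies only some function
  \<open>h\<close>, while \<open>mu_meas\<close> speaks of radial limits of \<open>f\<close>.
  Controlling the lower limit of the singular part along one sequence of radii suffices, because the
  radial limit of \<open>f\<close> is known to exist beforehand.\<close>

lemma disc_identity:
  "(cmod (1 - cnj a * z))\<^sup>2 - (cmod (a - z))\<^sup>2 = (1 - (cmod a)\<^sup>2) * (1 - (cmod z)\<^sup>2)"
proof -
  have "complex_of_real ((cmod (1 - cnj a * z))\<^sup>2 - (cmod (a - z))\<^sup>2)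
      = complex_of_real ((1 - (cmod a)\<^sup>2) * (1 - (cmod z)\<^sup>2))"
    unfolding of_real_diff of_real_mult complex_norm_square by (simp add: algebra_simps)
  then show ?thesis
    using of_real_eq_iff by blast
qed

lemma norm_one_minus_cnj_mult_ge:
  assumes "cmod w \<le> 1"
  shows "1 - cmod z \<le> cmod (1 - cnj w * z)"
proof -
  have "1 - cmod w * cmod z \<le> cmod (1 - cnj w * z)"
    using norm_triangle_ineq2[of 1 "cnj w * z"] by (simp add: norm_mult)
  moreover have "cmod w * cmod z \<le> cmod z"
    using assms by (simp add: mult_left_le_one_le)
  ultimately show ?thesis by linarith
qed

lemma norm_one_minus_cnj_mult_ge':
  assumes "cmod z \<le> 1"
  shows "1 - cmod w \<le> cmod (1 - cnj w * z)"
proof -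
  have "1 - cmod w * cmod z \<le> cmod (1 - cnj w * z)"
    using norm_triangle_ineq2[of 1 "cnj w * z"] by (simp add: norm_mult)
  moreover have "cmod w * cmod z \<le> cmod w"
    using assms by (simp add: mult_left_le)
  ultimately show ?thesis by linarith
qed

lemma norm_one_minus_cnj_mult_pos:
  assumes "cmod w \<le> 1" "cmod z < 1"
  shows "0 < cmod (1 - cnj w * z)"
  using norm_one_minus_cnj_mult_ge[OF assms(1), of z] assms(2) by linarith

lemma norm_one_minus_cnj_mult_diff:
  assumes "cmod w \<le> 1"
  shows "cmod (1 - cnj w * z) \<le> cmod (1 - cnj w * z') + cmod (z - z')"
proof -
  have "1 - cnj w * z = (1 - cnj w * z') - cnj w * (z - z')"
    by (simp add: algebra_simps)
  then have "cmod (1 - cnj w * z) \<le> cmod (1 - cnj w * z') + cmod (cnj w * (z - z'))"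
    using norm_triangle_ineq4 by metis
  moreover have "cmod (cnj w * (z - z')) \<le> cmod (z - z')"
    using assms by (simp add: norm_mult mult_left_le_one_le)
  ultimately show ?thesis by linarith
qed

lemma one_minus_square_le:
  fixes r :: real
  assumes "0 \<le> r" "r \<le> 1"
  shows "1 - r \<le> 1 - r\<^sup>2" "1 - r\<^sup>2 \<le> 2 * (1 - r)"
proof -
  have "0 \<le> r * (1 - r)" using assms by simp
  then show "1 - r \<le> 1 - r\<^sup>2" by (simp add: algebra_simps power2_eq_square)
  have "0 \<le> (1 - r)\<^sup>2" by simp
  then show "1 - r\<^sup>2 \<le> 2 * (1 - r)" by (simp add: algebra_simps power2_eq_square)
qed

lemma pkernel_nonneg: "cmod z \<le> 1 \<Longrightarrow> 0 \<le> pkernel z w"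
  unfolding pkernel_def by (auto intro!: divide_nonneg_nonneg simp: power_le_one)

lemma pkernel_le:
  assumes "cmod z < 1" "cmod w \<le> 1"
  shows "pkernel z w \<le> 2 / (1 - cmod z)"
proof -
  have a: "(1 - cmod z)\<^sup>2 \<le> (cmod (1 - cnj w * z))\<^sup>2"
    using norm_one_minus_cnj_mult_ge[OF assms(2), of z] assms by (intro power_mono) auto
  have "pkernel z w \<le> (1 - (cmod z)\<^sup>2) / (1 - cmod z)\<^sup>2"
    unfolding pkernel_def
    using a assms by (intro divide_left_mono) (auto simp: power_le_one intro!: mult_pos_pos norm_one_minus_cnj_mult_pos
      dest!: norm_one_minus_cnj_mult_pos)
  also have "\<dots> \<le> (2 * (1 - cmod z)) / (1 - cmod z)\<^sup>2"
    using one_minus_square_le[of "cmod z"] assms by (intro divide_right_mono) auto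
  also have "\<dots> = 2 / (1 - cmod z)"
    using assms by (simp add: power2_eq_square del: right_diff_distrib_numeral)
  finally show ?thesis .
qed

text \<open>The right side is the squared modulus of a Blaschke factor. Allowing
  \<open>cmod a = 1\<close> matters: boundary points later serve as filler in zero sequences, and
  for them both sides are 1.\<close>

lemma pkernel_zero_factor:
  assumes "cmod a \<le> 1" "cmod z < 1"
  shows "1 - (1 - (cmod a)\<^sup>2) * pkernel z a = (cmod (a - z))\<^sup>2 / (cmod (1 - cnj a * z))\<^sup>2"
proof -
  have "cmod (1 - cnj a * z) \<noteq> 0" using norm_one_minus_cnj_mult_pos[OF assms] by simp
  then show ?thesis
    using disc_identity[of a z] unfolding pkernel_def by (simp add: field_simps)
qed

lemma pkernel_measurable [measurable]:
  "pkernel z \<in> borel_measurable borel" "(\<lambda>z. pkernel z w) \<in> borel_measurable borel"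
  unfolding pkernel_def[abs_def]
  by (intro borel_measurable_divide borel_measurable_continuous_onI continuous_intros)+

lemma cmod_zQ: "l \<le> 1 \<Longrightarrow> cmod (zQ \<theta> l) = 1 - l"
  unfolding zQ_def by (simp add: norm_mult del: of_real_diff)

lemma zQ_in_disc: "0 < l \<Longrightarrow> l \<le> 1 \<Longrightarrow> cmod (zQ \<theta> l) < 1"
  by (simp add: cmod_zQ)

lemma norm_zQ_diff: "cmod (zQ \<theta> l - zQ \<theta> l') = \<bar>l - l'\<bar>"
proof -
  have "zQ \<theta> l - zQ \<theta> l' = complex_of_real (l' - l) * cis \<theta>"
    unfolding zQ_def by (simp add: algebra_simps)
  then show ?thesis by (simp add: norm_mult del: of_real_diff)
qed

text \<open>Jordan's inequality: sine is concave on \<open>[0, pi]\<close>, so its graph lies above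
  the chord from 0 to \<open>pi/2\<close>.\<close>

lemma sin_ge_two_over_pi:
  fixes x :: real
  assumes "0 \<le> x" "x \<le> pi / 2"
  shows "2 * x / pi \<le> sin x"
proof (cases "x = 0 \<or> x = pi/2")
  case False
  then have x: "0 < x" "x < pi/2" using assms by auto
  have conv: "convex_on {0..pi} (\<lambda>x. - sin x)"
  proof (rule f''_ge0_imp_convex)
    show "convex {0..pi}" by simp
    show "((\<lambda>x. - sin x) has_real_derivative - cos x) (at x)" for x :: real
      by (auto intro!: derivative_eq_intros)
    show "((\<lambda>x. - cos x) has_real_derivative sin x) (at x)" for x :: real
      by (auto intro!: derivative_eq_intros)
    show "sin x \<ge> 0" if "x \<in> {0..pi}" for x :: real
      using that by (auto intro: sin_ge_zero)
  qed
  define t where "t = 2 * x / pi"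
  have t: "0 \<le> t" "t \<le> 1" using x by (auto simp: t_def field_simps)
  have "- sin ((1 - t) * 0 + t * (pi/2)) \<le> (1 - t) * (- sin 0) + t * (- sin (pi/2))"
    using convex_onD[OF conv t, of 0 "pi/2"] by simp
  moreover have "(1 - t) * 0 + t * (pi/2) = x" by (simp add: t_def)
  ultimately show ?thesis by (simp add: t_def)
next
  case True
  then show ?thesis
  proof
    assume x: "x = pi/2"
    show ?thesis unfolding x by simp
  qed simp
qed

section \<open>Chords, angles and membership in closed boxes\<close>

lemma norm_one_minus_cis: "cmod (1 - cis \<alpha>) = 2 * \<bar>sin (\<alpha> / 2)\<bar>"
proof -
  have "(cmod (1 - cis \<alpha>))\<^sup>2 = (1 - cos \<alpha>)\<^sup>2 + (sin \<alpha>)\<^sup>2"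
    by (simp add: cmod_power2)
  also have "\<dots> = 2 - 2 * cos \<alpha>"
    using sin_cos_squared_add[of \<alpha>] by (simp add: power2_eq_square algebra_simps)
  also have "\<dots> = (2 * \<bar>sin (\<alpha>/2)\<bar>)\<^sup>2"
    using cos_double_sin[of "\<alpha>/2"] by (simp add: power_mult_distrib)
  finally show ?thesis
    by (rule power2_eq_imp_eq) auto
qed

lemma norm_one_minus_cis_le: "cmod (1 - cis \<alpha>) \<le> \<bar>\<alpha>\<bar>"
  using abs_sin_x_le_abs_x[of "\<alpha>/2"] by (simp add: norm_one_minus_cis)

lemma norm_one_minus_cis_ge:
  assumes "\<bar>\<alpha>\<bar> \<le> pi"
  shows "2 * \<bar>\<alpha>\<bar> / pi \<le> cmod (1 - cis \<alpha>)"
proof -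
  have "2 * (\<bar>\<alpha>\<bar>/2) / pi \<le> sin (\<bar>\<alpha>\<bar> / 2)"
    using assms by (intro sin_ge_two_over_pi) auto
  also have "\<dots> \<le> \<bar>sin (\<alpha>/2)\<bar>"
    by (cases "\<alpha> \<ge> 0") auto
  finally show ?thesis by (simp add: norm_one_minus_cis)
qed

text \<open>Pushing the point radially to the circle moves it by \<open>1 - r\<close>, which is
  itself at most its distance from 1; hence the factor 2.\<close>

lemma norm_one_minus_scaled_cis:
  assumes "0 \<le> r" "r \<le> 1"
  shows "cmod (1 - cis \<alpha>) \<le> 2 * cmod (1 - of_real r * cis \<alpha>)"
proof -
  have "1 - cis \<alpha> = (1 - of_real r * cis \<alpha>) - of_real (1 - r) * cis \<alpha>"
    by (simp add: algebra_simps)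
  then have "cmod (1 - cis \<alpha>) \<le> cmod (1 - of_real r * cis \<alpha>) + cmod (of_real (1 - r) * cis \<alpha>)"
    using norm_triangle_ineq4 by metis
  moreover have "cmod (of_real (1 - r) * cis \<alpha>) = 1 - r"
    using assms by (simp add: norm_mult del: of_real_diff)
  moreover have "1 - r \<le> cmod (1 - of_real r * cis \<alpha>)"
    using norm_triangle_ineq2[of 1 "of_real r * cis \<alpha>"] assms by (simp add: norm_mult)
  ultimately show ?thesis by linarith
qed

text \<open>Rotating by \<open>-\<theta>\<close> before taking \<open>Arg\<close> measures the angle
  from the center of the arc, so that no wrap-around case arises later.\<close>

lemma polar_around:
  obtains \<alpha> where "w = of_real (cmod w) * cis (\<theta> + \<alpha>)" "\<bar>\<alpha>\<bar> \<le> pi"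
proof -
  have "w * cis (-\<theta>) = of_real (cmod w) * cis (Arg (w * cis (-\<theta>)))"
    using rcis_cmod_Arg[of "w * cis (-\<theta>)"] by (simp add: rcis_def norm_mult)
  then have "w * cis (-\<theta>) * cis \<theta> = of_real (cmod w) * (cis \<theta> * cis (Arg (w * cis (-\<theta>))))"
    by (simp add: mult_ac)
  then have "w = of_real (cmod w) * cis (\<theta> + Arg (w * cis (-\<theta>)))"
    by (simp add: cis_mult mult.assoc)
  then show ?thesis
    using that Arg_bounded[of "w * cis (-\<theta>)"] by (metis abs_le_iff less_eq_real_def minus_le_iff)
qed

text \<open>Used in contrapositive form: a point outside the closed box keeps every Poisson
  denominator along the central radius at least \<open>l\<close>. The denominator bounds
  \<open>1 - cmod w\<close> directly and the angle through Jordan's inequality; the half-length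
  \<open>pi * l\<close> of the arc is exactly what the constant \<open>2 / pi\<close> and the factor
  2 yield.\<close>

lemma in_closure_carleson_box:
  assumes l: "0 < l" "l \<le> 1" and s: "0 < s" "s \<le> l" and w: "cmod w \<le> 1"
    and near: "cmod (1 - cnj w * zQ \<theta> s) < l"
  shows "w \<in> closure (carleson_box \<theta> l)"
proof -
  have z1: "cmod (zQ \<theta> s) = 1 - s" using l s by (simp add: cmod_zQ)
  have wl: "1 - cmod w < l"
    using norm_one_minus_cnj_mult_ge'[of "zQ \<theta> s" w] near z1 s by simp
  then have w0: "0 < cmod w" using l by linarith
  obtain \<alpha> where \<alpha>: "w = of_real (cmod w) * cis (\<theta> + \<alpha>)" "\<bar>\<alpha>\<bar> \<le> pi"
    using polar_around by blast
  have "cnj w * zQ \<theta> s = of_real (cmod w * (1 - s)) * cis (- \<alpha>)"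
    by (subst \<alpha>(1)) (simp add: zQ_def cis_cnj mult.assoc mult.left_commute cis_mult)
  then have "cmod (1 - cis (-\<alpha>)) \<le> 2 * cmod (1 - cnj w * zQ \<theta> s)"
    using norm_one_minus_scaled_cis[of "cmod w * (1 - s)" "-\<alpha>"] w s l
    by (simp add: mult_le_one)
  then have "2 * \<bar>\<alpha>\<bar> / pi < 2 * l"
    using norm_one_minus_cis_ge[of "-\<alpha>"] \<alpha>(2) near by simp
  then have \<alpha>l: "\<bar>\<alpha>\<bar> < pi * l" by (simp add: field_simps)
  have box: "of_real r * cis (\<theta> + \<alpha>) \<in> carleson_box \<theta> l" if "1 - l \<le> r" "0 < r" "r < 1" for r
  proof -
    have "cis (\<theta> + \<alpha>) \<in> arc \<theta> l"
      unfolding arc_def using \<alpha>l by (intro imageI) auto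
    then show ?thesis
      unfolding carleson_box_def using that by (simp add: norm_mult)
  qed
  show ?thesis
  proof (cases "cmod w < 1")
    case True
    then have "w \<in> carleson_box \<theta> l" using box[of "cmod w"] wl w0 \<alpha>(1) by simp
    then show ?thesis using closure_subset by blast
  next
    case False
    then have w1: "w = cis (\<theta> + \<alpha>)" using \<alpha>(1) w by simp
    \<comment> \<open>A point of the circle is reached radially from inside the box. The
      denominators start at 2, so the radii stay positive even for \<open>l = 1\<close>.\<close>
    have "(\<lambda>n. of_real (1 - l / real (Suc (Suc n))) * cis (\<theta> + \<alpha>)) \<longlonglongrightarrow> of_real (1 - 0) * cis (\<theta> + \<alpha>)"
      using LIMSEQ_ignore_initial_segment[OF lim_const_over_n[of l], of 2]
      by (intro tendsto_intros) simp
    moreover have "of_real (1 - l / real (Suc (Suc n))) * cis (\<theta> + \<alpha>) \<in> carleson_box \<theta> l" for n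
    proof (rule box)
      have "l / real (Suc (Suc n)) \<le> l / 1" using l by (intro divide_left_mono) auto
      then show "1 - l \<le> 1 - l / real (Suc (Suc n))" by simp
      have "l / real (Suc (Suc n)) < 1" using l by (simp add: field_simps)
      then show "0 < 1 - l / real (Suc (Suc n))" by simp
      show "1 - l / real (Suc (Suc n)) < 1" using l by simp
    qed
    ultimately show ?thesis
      unfolding w1 closure_sequential by (metis (mono_tags, lifting) diff_zero of_real_1 mult_1)
  qed
qed

text \<open>The image of a closed polar rectangle is compact, hence closed, so it contains the
  closure as well as the box. The \<open>max 0\<close> keeps radii nonnegative without any bound on
  \<open>l\<close>.\<close>

lemma closure_carleson_box_polar:
  assumes "w \<in> closure (carleson_box \<theta> l)"
  obtains r s where "w = of_real r * cis s" "1 - l \<le> r" "0 \<le> r" "r \<le> 1" "\<bar>s - \<theta>\<bar> \<le> pi * l"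
proof -
  define K where "K = (\<lambda>(r, s). of_real r * cis s) ` ({max 0 (1 - l)..1} \<times> {\<theta> - pi * l..\<theta> + pi * l})"
  have "compact K"
    unfolding K_def by (intro compact_continuous_image compact_Times compact_Icc)
      (auto intro!: continuous_intros simp: case_prod_unfold)
  moreover have "carleson_box \<theta> l \<subseteq> K"
  proof
    fix z assume z: "z \<in> carleson_box \<theta> l"
    then obtain s where s: "s \<in> {\<theta> - pi * l..\<theta> + pi * l}" "z / of_real (cmod z) = cis s"
      unfolding carleson_box_def arc_def by auto
    then have "z \<noteq> 0" by auto
    then have "z = of_real (cmod z) * cis s" using s(2) by (simp add: field_simps)
    moreover have "(cmod z, s) \<in> {max 0 (1 - l)..1} \<times> {\<theta> - pi * l..\<theta> + pi * l}"
      using z s unfolding carleson_box_def by auto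
    ultimately show "z \<in> K" unfolding K_def by force
  qed
  ultimately have "w \<in> K"
    using assms closure_minimal compact_imp_closed by blast
  then obtain r s where "w = of_real r * cis s" "r \<in> {max 0 (1 - l)..1}" "s \<in> {\<theta> - pi * l..\<theta> + pi * l}"
    unfolding K_def by auto
  then show ?thesis by (intro that) (auto simp: abs_le_iff)
qed

section \<open>Contractive maps charge Carleson boxes\<close>

text \<open>\<open>L \<phi>\<close> stands for the integral of \<open>\<phi>\<close> against \<open>\<mu>\<close>, which is carried by the zeros of \<open>f\<close> and
  the circle; this is why monotonicity is only tested there.\<close>

locale mass_functional =
  fixes f :: "complex \<Rightarrow> complex" and L :: "(complex \<Rightarrow> ennreal) \<Rightarrow> ennreal" and P :: "complex \<Rightarrow> real"
  assumes holf: "f holomorphic_on ball 0 1"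
    and f_disc: "\<And>z. cmod z < 1 \<Longrightarrow> cmod (f z) < 1"
    and L_mono: "\<And>\<phi> \<psi>. (\<And>w. cmod w \<le> 1 \<Longrightarrow> (cmod w < 1 \<Longrightarrow> f w = 0) \<Longrightarrow> \<phi> w \<le> \<psi> w) \<Longrightarrow> L \<phi> \<le> L \<psi>"
    and L_add: "\<And>\<phi> \<psi>. \<phi> \<in> borel_measurable borel \<Longrightarrow> \<psi> \<in> borel_measurable borel \<Longrightarrow>
        L (\<lambda>w. \<phi> w + \<psi> w) = L \<phi> + L \<psi>"
    and L_cmult: "\<And>c \<phi>. \<phi> \<in> borel_measurable borel \<Longrightarrow> L (\<lambda>w. c * \<phi> w) = c * L \<phi>"
    and P_nonneg: "\<And>z. cmod z < 1 \<Longrightarrow> 0 \<le> P z"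
    and L_pkernel: "\<And>z. cmod z < 1 \<Longrightarrow> L (\<lambda>w. ennreal (pkernel z w)) = ennreal (P z)"
    and f_upper: "\<And>z. cmod z < 1 \<Longrightarrow> (cmod (f z))\<^sup>2 \<le> exp (- P z)"
    and f_lower: "\<And>z. cmod z < 1 \<Longrightarrow> P z \<le> 1/2 \<Longrightarrow> exp (- 2 * P z) \<le> (cmod (f z))\<^sup>2"
begin

text \<open>On \<open>[0, 1]\<close> one has
  \<open>exp (- x) \<le> 1 / (1 + x) \<le> 1 - x / 2\<close>.\<close>

lemma one_minus_f_ge:
  assumes "cmod z < 1" "P z \<le> 1"
  shows "P z / 2 \<le> 1 - (cmod (f z))\<^sup>2"
proof -
  have "exp (- P z) \<le> 1 - P z / 2"
  proof -
    have "exp (P z) \<ge> 1 + P z" by (rule exp_ge_add_one_self)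
    then have "exp (- P z) \<le> 1 / (1 + P z)"
      using P_nonneg[OF assms(1)] by (simp add: exp_minus field_simps)
    also have "\<dots> \<le> 1 - P z / 2"
    proof -
      have "0 \<le> P z * (1 - P z)" using assms P_nonneg by simp
      then have "1 \<le> (1 - P z / 2) * (1 + P z)" by (simp add: algebra_simps)
      then show ?thesis using P_nonneg[OF assms(1)] by (simp add: divide_le_eq)
    qed
    finally show ?thesis .
  qed
  then show ?thesis using f_upper[OF assms(1)] by linarith
qed

lemma one_minus_f_le:
  assumes "cmod z < 1" "P z \<le> 1/2"
  shows "1 - (cmod (f z))\<^sup>2 \<le> 2 * P z"
  using f_lower[OF assms] exp_ge_add_one_self[of "- 2 * P z"] by linarith

text \<open>Smallness is assumed of \<open>1 - |f|^2\<close> and not of \<open>P\<close>: in the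
  converse implication only \<open>|f|\<close> is under control at first, and this is how
  \<open>P\<close> becomes small. With \<open>x = 1 - |f|^2\<close>,
  \<open>1 + P \<le> exp P \<le> 1 / (1 - x) \<le> 1 + 2 x\<close>.\<close>

lemma P_le:
  assumes "cmod z < 1" "1 - (cmod (f z))\<^sup>2 \<le> 1/2"
  shows "P z \<le> 2 * (1 - (cmod (f z))\<^sup>2)"
proof -
  define x where "x = 1 - (cmod (f z))\<^sup>2"
  have x: "0 \<le> x" "x \<le> 1/2" using assms f_disc[of z] by (auto simp: x_def power_le_one)
  have "1 / (1 - x) \<le> 1 + 2 * x"
  proof -
    have "0 \<le> x * (1 - 2 * x)" using x by simp
    then have "1 \<le> (1 + 2 * x) * (1 - x)" by (simp add: algebra_simps)
    then show ?thesis using x by (simp add: divide_le_eq)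
  qed
  moreover have "exp (P z) \<le> 1 / (1 - x)"
  proof -
    have "(1 - x) * exp (P z) \<le> exp (- P z) * exp (P z)"
      using f_upper[OF assms(1)] by (intro mult_right_mono) (auto simp: x_def)
    also have "\<dots> = 1" by (simp add: exp_minus)
    finally show ?thesis using x by (simp add: pos_le_divide_eq mult.commute)
  qed
  moreover have "1 + P z \<le> exp (P z)" by (rule exp_ge_add_one_self)
  ultimately have "P z \<le> 2 * x" by linarith
  then show ?thesis by (simp add: x_def)
qed

lemma L_zero: "L (\<lambda>w. 0) = 0"
  using L_cmult[of "\<lambda>w. 0" 0] by simp

lemma L_sum:
  assumes "finite A" "\<And>i. i \<in> A \<Longrightarrow> \<phi> i \<in> borel_measurable borel"
  shows "L (\<lambda>w. \<Sum>i\<in>A. \<phi> i w) = (\<Sum>i\<in>A. L (\<phi> i))"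
  using assms by (induction A rule: finite_induct) (simp_all add: L_zero L_add)

text \<open>Integrates the differential inequality for \<open>1 - |f|^2\<close> along a radius: the
  auxiliary \<open>G\<close> compares \<open>- ln (1 - |f|^2)\<close> with \<open>c\<close> times
  the hyperbolic arc length and has nonpositive derivative. The base of the power is
  \<open>exp\<close> of minus the hyperbolic distance between the two points, for the metric
  \<open>2 |dz| / (1 - |z|^2)\<close>.\<close>

lemma radial_contraction:
  assumes c: "0 \<le> c" "\<And>z. cmod z < 1 \<Longrightarrow> hyp_deriv f z \<le> c"
    and s: "0 \<le> s0" "s0 \<le> s1" "s1 < 1"
  shows "(1 - (cmod (f (of_real s0 * cis \<theta>)))\<^sup>2) * (((1 - s1) * (1 + s0)) / ((1 + s1) * (1 - s0))) powr c
     \<le> 1 - (cmod (f (of_real s1 * cis \<theta>)))\<^sup>2"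
proof -
  define v where "v s = f (of_real s * cis \<theta>)" for s :: real
  define d where "d s = deriv f (of_real s * cis \<theta>) * cis \<theta>" for s :: real
  define y where "y s = 1 - (cmod (v s))\<^sup>2" for s
  have disc: "cmod (of_real s * cis \<theta>) < 1" if "0 \<le> s" "s \<le> s1" for s :: real
    using that assms by (simp add: norm_mult)
  have ypos: "0 < y s" if "0 \<le> s" "s \<le> s1" for s
    using f_disc[OF disc[OF that]] by (simp add: y_def v_def power_less_one_iff abs_square_less_1)
  have vder: "(v has_vector_derivative d s) (at s)" if "0 \<le> s" "s \<le> s1" for s
  proof -
    have "(f has_field_derivative deriv f (of_real s * cis \<theta>)) (at (of_real s * cis \<theta>))"
      using holf disc[OF that] by (intro holomorphic_derivI[of _ "ball 0 1"]) auto
    moreover have "((\<lambda>s. of_real s * cis \<theta>) has_vector_derivative cis \<theta>) (at s)"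
      by (auto intro!: derivative_eq_intros simp: has_vector_derivative_def scaleR_conv_of_real)
    ultimately show ?thesis
      using field_vector_diff_chain_at[of "\<lambda>s. of_real s * cis \<theta>" "cis \<theta>" s f "deriv f (of_real s * cis \<theta>)"]
      by (simp add: v_def[abs_def] d_def o_def mult.commute[of "cis \<theta>"])
  qed
  have yder: "(y has_real_derivative - (2 * (v s \<bullet> d s))) (at s)" if "0 \<le> s" "s \<le> s1" for s
  proof -
    have eq: "y = (\<lambda>s. 1 - v s \<bullet> v s)" by (auto simp: y_def power2_norm_eq_inner)
    show ?thesis
      unfolding eq using vder[OF that]
      unfolding has_vector_derivative_def has_field_derivative_def
      by (auto intro!: derivative_eq_intros simp: inner_commute algebra_simps)
  qed
  define G where "G s = - ln (y s) - c * (ln (1 + s) - ln (1 - s))" for s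
  have Gder: "(G has_real_derivative (2 * (v s \<bullet> d s)) / y s - c * (1 / (1 + s) + 1 / (1 - s))) (at s)"
    if "0 \<le> s" "s \<le> s1" for s
    unfolding G_def[abs_def] using that ypos[OF that] s
    by (auto intro!: derivative_eq_intros yder[OF that] simp: divide_inverse algebra_simps)
  have "G s1 \<le> G s0"
  proof (rule DERIV_nonpos_imp_nonincreasing[OF s(2)])
    fix s assume "s0 \<le> s" "s \<le> s1"
    then have s': "0 \<le> s" "s \<le> s1" using s by auto
    have s1': "s < 1" using s' s by simp
    have "v s \<bullet> d s \<le> cmod (v s) * cmod (d s)" by (rule norm_cauchy_schwarz)
    also have "\<dots> \<le> cmod (d s)"
      using f_disc[OF disc[OF s']] by (simp add: v_def mult_left_le_one_le)
    finally have "(v s \<bullet> d s) / y s \<le> cmod (d s) / y s"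
      using ypos[OF s'] by (simp add: divide_right_mono)
    also have "\<dots> = hyp_deriv f (of_real s * cis \<theta>) / (1 - s\<^sup>2)"
    proof -
      have "s\<^sup>2 \<noteq> 1" using s' s1' by (metis abs_of_nonneg abs_square_eq_1 less_irrefl)
      then show ?thesis
        using s' s1' unfolding hyp_deriv_def y_def v_def d_def by (simp add: norm_mult)
    qed
    also have "\<dots> \<le> c / (1 - s\<^sup>2)"
      using c(2)[OF disc[OF s']] s' s1' by (intro divide_right_mono) (auto simp: power_le_one)
    finally have "2 * (v s \<bullet> d s) / y s \<le> 2 * c / (1 - s\<^sup>2)" by simp
    also have "\<dots> = c * (1 / (1 + s) + 1 / (1 - s))"
    proof -
      have "1 - s\<^sup>2 = (1 + s) * (1 - s)" by (simp add: power2_eq_square algebra_simps)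
      then show ?thesis using s' s1' by (simp add: divide_simps)
    qed
    finally have "2 * (v s \<bullet> d s) / y s - c * (1 / (1 + s) + 1 / (1 - s)) \<le> 0" by simp
    then show "\<exists>y. (G has_real_derivative y) (at s) \<and> y \<le> 0"
      using Gder[OF s'] by blast
  qed
  then have "ln (y s0) + c * (ln (1 - s1) + ln (1 + s0) - ln (1 + s1) - ln (1 - s0)) \<le> ln (y s1)"
    by (simp add: G_def algebra_simps)
  also have "ln (1 - s1) + ln (1 + s0) - ln (1 + s1) - ln (1 - s0) = ln (((1 - s1) * (1 + s0)) / ((1 + s1) * (1 - s0)))"
    using s by (simp add: ln_div ln_mult)
  finally have "exp (ln (y s0) + c * ln (((1 - s1) * (1 + s0)) / ((1 + s1) * (1 - s0)))) \<le> y s1"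
    using ypos[of s1] s by (metis exp_le_cancel_iff exp_ln order.refl order_trans)
  moreover have "0 < ((1 - s1) * (1 + s0)) / ((1 + s1) * (1 - s0))" using s by auto
  ultimately show ?thesis
    using ypos[of s0] s by (simp add: exp_add powr_def y_def v_def)
qed

theorem contractive_imp_mass_bound:
  assumes "contractive f"
  shows "\<exists>C>0. \<forall>\<theta> l. 0 < l \<and> l \<le> 1 \<and> P (zQ \<theta> l) \<le> C \<longrightarrow>
        ennreal (C * l * P (zQ \<theta> l)) \<le> L (indicator (closure (carleson_box \<theta> l)))"
proof -
  obtain c0 where c0: "c0 < 1" "\<And>z. cmod z < 1 \<Longrightarrow> hyp_deriv f z \<le> c0"
    using assms unfolding contractive_def by auto
  define c where "c = max c0 0"
  have c: "0 \<le> c" "c < 1" "\<And>z. cmod z < 1 \<Longrightarrow> hyp_deriv f z \<le> c"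
    using c0 by (auto simp: c_def le_max_iff_disj)
  \<comment> \<open>Chosen with \<open>t powr (1 - c) = 1/128\<close>, which gives
    \<open>64 * t \<le> (t/2) powr c\<close>. The surplus 64 pays for two comparisons of
    \<open>P\<close> with \<open>1 - |f|^2\<close>, a factor 2 each, and leaves 16 against the 8
    lost to the mass outside the box.\<close>
  define t where "t = (1/128 :: real) powr (1 / (1 - c))"
  have t: "0 < t" "t \<le> 1"
    using c by (auto simp: t_def intro!: powr_le1)
  have tc: "64 * t \<le> (t/2) powr c"
  proof -
    have "(t/2) powr (1 - c) \<le> t powr (1 - c)"
      using t c by (intro powr_mono2) auto
    also have "\<dots> = 1/128" using c by (simp add: t_def powr_powr)
    finally have "128 * (t/2) powr (1 - c) \<le> 1" by simp
    then have "128 * (t/2) powr (1 - c) * (t/2) powr c \<le> (t/2) powr c"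
      by (simp add: mult_left_le_one_le)
    moreover have "(t/2) powr (1 - c) * (t/2) powr c = t/2"
      using t by (simp add: powr_add[symmetric])
    ultimately show ?thesis by (simp add: mult.assoc)
  qed
  \<comment> \<open>The term \<open>4 * t\<^sup>2\<close> is the mass bound that the final
    inequality delivers. The term \<open>t/16\<close> turns the Harnack factor \<open>8 / t\<close>
    into \<open>P z' \<le> 1/2\<close>, where \<open>1 - |f|^2\<close> is at most
    \<open>2 * P\<close>.\<close>
  define C where "C = min (4 * t\<^sup>2) (t/16)"
  have C: "0 < C" "C \<le> 4 * t\<^sup>2" "C \<le> t/16" "C \<le> 1"
    using t by (auto simp: C_def min_le_iff_disj)
  show ?thesis
  proof (intro exI[of _ C] conjI allI impI C)
    fix \<theta> l :: real assume H: "0 < l \<and> l \<le> 1 \<and> P (zQ \<theta> l) \<le> C"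
    then have l: "0 < l" "l \<le> 1" and PC: "P (zQ \<theta> l) \<le> C" by auto
    define z where "z = zQ \<theta> l"
    define z' where "z' = zQ \<theta> (t * l)"
    have tl: "0 < t * l" "t * l \<le> l" "t * l \<le> 1" using t l by (auto simp: mult_le_one mult_left_le_one_le)
    have z: "cmod z = 1 - l" "cmod z' = 1 - t * l" "cmod z < 1" "cmod z' < 1"
      using l tl by (auto simp: z_def z'_def cmod_zQ)
    have zz: "cmod (z - z') \<le> l" using tl by (simp add: z_def z'_def norm_zQ_diff)
    define Q where "Q = closure (carleson_box \<theta> l)"
    have [measurable]: "Q \<in> sets borel" by (simp add: Q_def)
    \<comment> \<open>One computation for both comparisons below: a bound \<open>k\<close> on the
      quotient of the denominators enters squared, the numerators contribute
      \<open>2 * t\<close>.\<close>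
    have base: "pkernel z' w \<le> 2 * k\<^sup>2 * t * pkernel z w"
      if w: "cmod w \<le> 1" and k: "0 \<le> k" "cmod (1 - cnj w * z) \<le> k * cmod (1 - cnj w * z')" for w k
    proof -
      have p: "0 < cmod (1 - cnj w * z)" "0 < cmod (1 - cnj w * z')"
        using norm_one_minus_cnj_mult_pos[OF w] z by auto
      have "1 - (cmod z')\<^sup>2 \<le> 2 * (t * l)" "l \<le> 1 - (cmod z)\<^sup>2"
        using one_minus_square_le[of "cmod z'"] one_minus_square_le[of "cmod z"] z tl l by auto
      moreover from this(2) have "2 * t * l \<le> 2 * t * (1 - (cmod z)\<^sup>2)"
        using t by (intro mult_left_mono) auto
      ultimately have "1 - (cmod z')\<^sup>2 \<le> 2 * t * (1 - (cmod z)\<^sup>2)" by linarith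
      moreover have "(cmod (1 - cnj w * z))\<^sup>2 \<le> k\<^sup>2 * (cmod (1 - cnj w * z'))\<^sup>2"
        using k by (metis norm_ge_zero power_mono power_mult_distrib)
      moreover have "0 \<le> 2 * t * (1 - (cmod z)\<^sup>2)" using t z l by (simp add: power_le_one)
      ultimately have "(1 - (cmod z')\<^sup>2) * (cmod (1 - cnj w * z))\<^sup>2
          \<le> (2 * t * (1 - (cmod z)\<^sup>2)) * (k\<^sup>2 * (cmod (1 - cnj w * z'))\<^sup>2)"
        by (intro mult_mono) auto
      then show ?thesis
        unfolding pkernel_def using p by (simp add: field_simps)
    qed
    \<comment> \<open>Outside the box the kernel decays in proportion to the height, here with
      \<open>k = 2\<close>. Inside, the maximum of the kernel is paid for each unit of mass.\<close>
    have out: "ennreal (pkernel z' w) \<le> ennreal (8 * t) * ennreal (pkernel z w) + ennreal (2 / (t * l)) * indicator Q w"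
      if w: "cmod w \<le> 1" for w
    proof (cases "w \<in> Q")
      case True
      have "pkernel z' w \<le> 2 / (t * l)" using pkernel_le[of z' w] z w by simp
      then show ?thesis using True by (simp add: add_increasing ennreal_leI)
    next
      case False
      have "l \<le> cmod (1 - cnj w * z')"
        using in_closure_carleson_box[OF l tl(1,2) w] False unfolding Q_def z'_def by force
      then have "cmod (1 - cnj w * z) \<le> 2 * cmod (1 - cnj w * z')"
        using norm_one_minus_cnj_mult_diff[OF w, of z z'] zz by simp
      then have "pkernel z' w \<le> 8 * t * pkernel z w" using base[OF w, of 2] by simp
      then show ?thesis using False t pkernel_nonneg[of z w] z
        by (simp add: ennreal_mult[symmetric] ennreal_leI)
    qed
    \<comment> \<open>Harnack's inequality, valid for all mass with \<open>k = 2/t\<close>. It is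
      too weak for the main estimate and serves only to keep \<open>P z'\<close> below 1/2.\<close>
    have har: "ennreal (pkernel z' w) \<le> ennreal (8 / t) * ennreal (pkernel z w)" if w: "cmod w \<le> 1" for w
    proof -
      have "t * l \<le> cmod (1 - cnj w * z')"
        using norm_one_minus_cnj_mult_ge[OF w, of z'] z by simp
      then have "l \<le> (1/t) * cmod (1 - cnj w * z')" using t by (simp add: field_simps)
      moreover have "cmod (1 - cnj w * z') \<le> (1/t) * cmod (1 - cnj w * z')"
        using t by (simp add: pos_le_divide_eq mult_left_le)
      ultimately have "cmod (1 - cnj w * z) \<le> (2/t) * cmod (1 - cnj w * z')"
        using norm_one_minus_cnj_mult_diff[OF w, of z z'] zz by simp
      from base[OF w _ this] have "pkernel z' w \<le> 8 / t * pkernel z w"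
        using t by (simp add: power2_eq_square)
      then show ?thesis using t pkernel_nonneg[of z w] z
        by (simp add: ennreal_mult[symmetric] ennreal_leI)
    qed
    have "ennreal (P z') \<le> ennreal (8 / t) * ennreal (P z)"
    proof -
      have "L (\<lambda>w. ennreal (pkernel z' w)) \<le> L (\<lambda>w. ennreal (8 / t) * ennreal (pkernel z w))"
        using har by (intro L_mono) auto
      then show ?thesis by (simp add: L_cmult L_pkernel z(3,4))
    qed
    then have "P z' \<le> 8 / t * P z"
      using t P_nonneg z(3,4) by (simp add: ennreal_mult[symmetric])
    also have "\<dots> \<le> 8 / t * (t / 16)"
      using PC C(3) t by (intro mult_left_mono) (auto simp: z_def)
    finally have Pz': "P z' \<le> 1/2" using t by simp
    define M where "M = L (indicator Q)"
    have main: "ennreal (P z') \<le> ennreal (8 * t * P z) + ennreal (2 / (t * l)) * M"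
    proof -
      have "L (\<lambda>w. ennreal (pkernel z' w))
          \<le> L (\<lambda>w. ennreal (8 * t) * ennreal (pkernel z w) + ennreal (2 / (t * l)) * indicator Q w)"
        using out by (intro L_mono) auto
      also have "\<dots> = ennreal (8 * t) * L (\<lambda>w. ennreal (pkernel z w)) + ennreal (2 / (t * l)) * L (indicator Q)"
        by (subst L_add) (auto simp: L_cmult)
      finally show ?thesis using z(3,4) t P_nonneg by (simp add: L_pkernel M_def ennreal_mult)
    qed
    \<comment> \<open>This is where contractivity acts: 16 exceeds the 8 of the outside estimate, so
      half of the lower bound has to come from mass in the box.\<close>
    have low: "16 * t * P z \<le> P z'"
    proof -
      have ratio: "t / 2 \<le> ((1 - (1 - t * l)) * (1 + (1 - l))) / ((1 + (1 - t * l)) * (1 - (1 - l)))"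
      proof -
        have "(2 - t * l) \<le> 2 * (2 - l)" 
        proof -
          define e where "e = t * l"
          have "0 < e" using tl by (simp add: e_def)
          then show ?thesis unfolding e_def[symmetric] using l by (simp add: algebra_simps)
        qed
        then have "1 / 2 \<le> (2 - l) / (2 - t * l)" using tl by (simp add: field_simps)
        then have "t * (1/2) \<le> t * ((2 - l) / (2 - t * l))" using t by (intro mult_left_mono) auto
        also have "\<dots> = ((1 - (1 - t * l)) * (1 + (1 - l))) / ((1 + (1 - t * l)) * (1 - (1 - l)))"
          using l by simp
        finally show ?thesis by simp
      qed
      have "(1 - (cmod (f z))\<^sup>2) * (64 * t) \<le> (1 - (cmod (f z))\<^sup>2) * (t/2) powr c"
        using tc f_disc[of z] z(3) by (intro mult_left_mono) (auto simp: power_le_one)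
      also have "\<dots> \<le> (1 - (cmod (f z))\<^sup>2) *
          (((1 - (1 - t * l)) * (1 + (1 - l))) / ((1 + (1 - t * l)) * (1 - (1 - l)))) powr c"
        using ratio t c f_disc[of z] z(3) by (intro mult_left_mono powr_mono2) (auto simp: power_le_one)
      also have "\<dots> \<le> 1 - (cmod (f z'))\<^sup>2"
        using radial_contraction[OF c(1,3), of "1 - l" "1 - t * l" \<theta>] l tl
        by (simp add: z_def z'_def zQ_def)
      also have "\<dots> \<le> 2 * P z'" using one_minus_f_le Pz' z(4) by simp
      finally have "(1 - (cmod (f z))\<^sup>2) * (64 * t) \<le> 2 * P z'" .
      moreover have "P z / 2 * (64 * t) \<le> (1 - (cmod (f z))\<^sup>2) * (64 * t)"
        using one_minus_f_ge[of z] PC C z(3) t by (intro mult_right_mono) (auto simp: z_def)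
      ultimately show ?thesis by simp
    qed
    have "ennreal (16 * t * P z) \<le> ennreal (8 * t * P z) + ennreal (2 / (t * l)) * M"
      using main low by (meson ennreal_leI order_trans)
    then show "ennreal (C * l * P (zQ \<theta> l)) \<le> L (indicator (closure (carleson_box \<theta> l)))"
      unfolding Q_def[symmetric] M_def[symmetric] z_def[symmetric]
    proof (cases M)
      case (real m)
      assume "ennreal (16 * t * P z) \<le> ennreal (8 * t * P z) + ennreal (2 / (t * l)) * M"
      then have "16 * t * P z \<le> 8 * t * P z + 2 / (t * l) * m"
        using real t l z(3) P_nonneg[of z] by (simp add: ennreal_mult[symmetric] ennreal_plus[symmetric] del: ennreal_plus)
      then have "8 * t * P z \<le> 2 / (t * l) * m" by simp
      then have "8 * t * P z * (t * l) \<le> 2 * m" using tl by (simp add: field_simps)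
      then have "4 * t\<^sup>2 * l * P z \<le> m" by (simp add: power2_eq_square algebra_simps)
      moreover have "C * l * P z \<le> 4 * t\<^sup>2 * l * P z"
        using C l z(3) P_nonneg[of z] by (intro mult_right_mono) auto
      ultimately show "ennreal (C * l * P z) \<le> M" using real by (simp add: ennreal_leI)
    qed simp
  qed
qed

end

section \<open>Maps that are almost isometric at a point\<close>

text \<open>Quantitative form of the maximum principle: a map into the closed disc whose value at 0
  is within \<open>d\<close> of the circle is almost constant, by Schwarz-Pick. The 7 is 4 from
  Schwarz-Pick plus three errors of size \<open>d\<close>: twice for shrinking the map, once for
  replacing \<open>h 0\<close> by its unimodular direction.\<close>

lemma bounded_near_unimodular_value:
  assumes holh: "h holomorphic_on ball 0 1" and h1: "\<And>z. cmod z < 1 \<Longrightarrow> cmod (h z) \<le> 1"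
    and d: "0 < d" "d < 1" "1 - d \<le> cmod (h 0)" and z: "cmod z < 1"
  shows "cmod (h z - h 0 / of_real (cmod (h 0))) \<le> 7 * d / (1 - cmod z)"
proof -
  \<comment> \<open>The map \<open>h\<close> may be a unimodular constant; scaling by
    \<open>1 - d\<close> makes it a strict self-map, to which the Schwarz lemma applies.\<close>
  define H where "H z = of_real (1 - d) * h z" for z
  have normH: "cmod (H z) = (1 - d) * cmod (h z)" for z
    using d by (simp add: H_def norm_mult del: of_real_diff)
  have H1: "cmod (H z) < 1" if "cmod z < 1" for z
  proof -
    have "(1 - d) * cmod (h z) \<le> 1 - d" using h1[OF that] d by (intro mult_left_le) auto
    also have "\<dots> < 1" using d by simp
    finally show ?thesis unfolding normH .
  qed
  define u where "u = H 0"
  have u1: "cmod u < 1" using H1[of 0] by (simp add: u_def)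
  define k where "k z = Moebius_function 0 u (H z)" for z
  have "cmod (k z) \<le> cmod z"
  proof (rule Schwarz_Lemma(1))
    have "H holomorphic_on ball 0 1" unfolding H_def by (intro holomorphic_intros holh)
    moreover have "Moebius_function 0 u holomorphic_on ball 0 1"
      by (rule Moebius_function_holomorphic[OF u1])
    ultimately have "(Moebius_function 0 u \<circ> H) holomorphic_on ball 0 1"
      using H1 by (intro holomorphic_on_compose_gen[of _ _ _ "ball 0 1"]) auto
    then show "k holomorphic_on ball 0 1" by (simp add: k_def[abs_def] o_def)
    show "k 0 = 0" by (simp add: k_def u_def Moebius_function_def)
    show "cmod (k z) < 1" if "cmod z < 1" for z
      unfolding k_def using H1[OF that] u1 by (intro Moebius_function_norm_lt_1)
  qed (use z in auto)
  moreover have den: "0 < cmod (1 - cnj u * H z)"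
    using norm_one_minus_cnj_mult_pos[of u "H z"] u1 H1[OF z] by simp
  ultimately have "cmod (H z - u) \<le> cmod z * cmod (1 - cnj u * H z)"
    by (simp add: k_def Moebius_function_def norm_divide norm_mult divide_le_eq)
  \<comment> \<open>The unknown distance \<open>cmod (H z - u)\<close> reappears on the right, but
    with the factor \<open>cmod z < 1\<close>, so it can be absorbed on the left.\<close>
  also have "cmod (1 - cnj u * H z) \<le> (1 - (cmod u)\<^sup>2) + cmod (H z - u)"
  proof -
    have "1 - cnj u * H z = of_real (1 - (cmod u)\<^sup>2) - cnj u * (H z - u)"
      unfolding of_real_diff complex_norm_square by (simp add: algebra_simps)
    then have "cmod (1 - cnj u * H z) \<le> cmod (of_real (1 - (cmod u)\<^sup>2) :: complex) + cmod (cnj u * (H z - u))"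
      using norm_triangle_ineq4 by metis
    moreover have "cmod (of_real (1 - (cmod u)\<^sup>2) :: complex) = 1 - (cmod u)\<^sup>2"
      using u1 by (simp add: power_le_one del: of_real_diff)
    moreover have "cmod (cnj u * (H z - u)) \<le> cmod (H z - u)"
      using u1 by (simp add: norm_mult mult_left_le_one_le)
    ultimately show ?thesis by linarith
  qed
  finally have "cmod (H z - u) \<le> cmod z * ((1 - (cmod u)\<^sup>2) + cmod (H z - u))"
    by (simp add: mult_left_mono)
  moreover have "cmod z * (1 - (cmod u)\<^sup>2) \<le> 1 - (cmod u)\<^sup>2"
    using u1 z by (simp add: mult_left_le_one_le power_le_one)
  ultimately have "cmod (H z - u) * (1 - cmod z) \<le> 1 - (cmod u)\<^sup>2"
    by (simp add: algebra_simps)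
  also have "\<dots> \<le> 4 * d"
  proof -
    have "(1 - d) * (1 - d) \<le> cmod u"
      using d by (simp add: u_def normH mult_left_mono)
    then have "1 - 2 * d \<le> cmod u" using d by (simp add: algebra_simps) (smt (verit) mult_nonneg_nonneg)
    moreover have "1 - (cmod u)\<^sup>2 \<le> 2 * (1 - cmod u)" using one_minus_square_le u1 by simp
    ultimately show ?thesis by simp
  qed
  finally have b1: "cmod (H z - u) \<le> 4 * d / (1 - cmod z)" using z by (simp add: pos_le_divide_eq)
  have b2: "cmod (h w - H w) \<le> d" if "cmod w < 1" for w
  proof -
    have "h w - H w = of_real d * h w" by (simp add: H_def algebra_simps)
    then show ?thesis using h1[OF that] d by (simp add: norm_mult mult_left_le)
  qed
  have b3: "cmod (h 0 - h 0 / of_real (cmod (h 0))) \<le> d"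
  proof -
    have h0: "h 0 \<noteq> 0" using d by auto
    then have "h 0 - h 0 / of_real (cmod (h 0)) = (h 0 / of_real (cmod (h 0))) * of_real (cmod (h 0) - 1)"
      by (simp add: field_simps)
    then have "cmod (h 0 - h 0 / of_real (cmod (h 0))) = \<bar>cmod (h 0) - 1\<bar>"
      using h0 by (simp add: norm_mult norm_divide del: of_real_diff)
    then show ?thesis using h1[of 0] d by simp
  qed
  have tri: "cmod (a + b + c + e) \<le> cmod a + cmod b + cmod c + cmod e" for a b c e
    by (intro order_trans[OF norm_triangle_ineq] add_mono order.refl)
  have "h z - h 0 / of_real (cmod (h 0)) = (h z - H z) + (H z - u) + (u - h 0) + (h 0 - h 0 / of_real (cmod (h 0)))"
    by simp
  then have "cmod (h z - h 0 / of_real (cmod (h 0)))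
      \<le> cmod (h z - H z) + cmod (H z - u) + cmod (u - h 0) + cmod (h 0 - h 0 / of_real (cmod (h 0)))"
    using tri by metis
  also have "\<dots> \<le> d + 4 * d / (1 - cmod z) + d + d"
    using b1 b2[OF z] b2[of 0] b3 by (simp add: u_def norm_minus_commute)
  also have "\<dots> \<le> 7 * d / (1 - cmod z)"
  proof -
    have "3 * d \<le> 3 * d / (1 - cmod z)" using d z by (simp add: pos_le_divide_eq mult_left_le)
    then show ?thesis by (simp add: add_divide_distrib[symmetric])
  qed
  finally show ?thesis .
qed

lemma Moebius_has_derivative:
  assumes "cmod a < 1" "cmod z < 1"
  shows "(Moebius_function 0 a has_field_derivative
     ((1 - cnj a * z) + (z - a) * cnj a) / (1 - cnj a * z)\<^sup>2) (at z)"
proof -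
  have "1 - cnj a * z \<noteq> 0" using norm_one_minus_cnj_mult_pos[of a z] assms by auto
  then show ?thesis
    unfolding Moebius_function_def[abs_def]
    by (auto intro!: derivative_eq_intros simp: power2_eq_square algebra_simps)
qed

text \<open>Moving \<open>z0\<close> and \<open>f z0\<close> to 0 turns \<open>f\<close> into
  \<open>F\<close> with \<open>F y = y * h y\<close> and \<open>cmod (h 0) = hyp_deriv f z0\<close>.
  Almost equality in Schwarz-Pick thus makes \<open>h\<close> nearly the unimodular constant
  \<open>\<eta>\<close>.\<close>

lemma near_rotation:
  assumes holf: "f holomorphic_on ball 0 1" and f1: "\<And>z. cmod z < 1 \<Longrightarrow> cmod (f z) < 1"
    and z0: "cmod z0 < 1" and d: "0 < d" "d < 1" "1 - d \<le> hyp_deriv f z0"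
  obtains \<eta> where "cmod \<eta> = 1"
    "\<And>z. cmod z < 1 \<Longrightarrow> cmod (Moebius_function 0 (f z0) (f z) - \<eta> * Moebius_function 0 z0 z)
        \<le> 7 * d / (1 - cmod (Moebius_function 0 z0 z))"
proof -
  define w0 where "w0 = f z0"
  have w0: "cmod w0 < 1" using f1 z0 by (simp add: w0_def)
  define M where "M = Moebius_function 0 (- z0)"
  have M1: "cmod (M z) < 1" if "cmod z < 1" for z
    unfolding M_def using Moebius_function_norm_lt_1[of "- z0" z 0] z0 that by simp
  have M0: "M 0 = z0" by (simp add: M_def Moebius_function_def)
  define F where "F = Moebius_function 0 w0 \<circ> (f \<circ> M)"
  have holM: "M holomorphic_on ball 0 1"
    unfolding M_def using z0 by (intro Moebius_function_holomorphic) simp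
  have holfM: "(f \<circ> M) holomorphic_on ball 0 1"
    using M1 by (intro holomorphic_on_compose_gen[OF holM holf]) auto
  have holF: "F holomorphic_on ball 0 1"
    unfolding F_def using f1 M1
    by (intro holomorphic_on_compose_gen[OF holfM Moebius_function_holomorphic[OF w0]]) auto
  have F0: "F 0 = 0" by (simp add: F_def M0 w0_def Moebius_function_def)
  have F1: "cmod (F z) < 1" if "cmod z < 1" for z
    unfolding F_def using f1[OF M1[OF that]] w0 by (simp add: Moebius_function_norm_lt_1)
  obtain h where h: "h holomorphic_on ball 0 1" "\<And>z. cmod z < 1 \<Longrightarrow> F z = z * h z" "deriv F 0 = h 0"
    using Schwarz3[OF holF F0] by auto
  have h1: "cmod (h z) \<le> 1" if "cmod z < 1" for z
  proof (cases "z = 0")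
    case True
    then show ?thesis using Schwarz_Lemma(2)[OF holF F0 F1, of 0] h(3) by simp
  next
    case False
    have "cmod (F z) \<le> cmod z" using Schwarz_Lemma(1)[OF holF F0 F1 that] by simp
    then show ?thesis using h(2)[OF that] False by (simp add: norm_mult)
  qed
  have normh0: "cmod (h 0) = hyp_deriv f z0"
  proof -
    have d1: "(M has_field_derivative (1 - of_real ((cmod z0)\<^sup>2))) (at 0)"
      using Moebius_has_derivative[of "- z0" 0] z0 unfolding M_def complex_norm_square by simp
    have d2: "(f has_field_derivative deriv f z0) (at (M 0))"
      unfolding M0 using holf z0 by (intro holomorphic_derivI[of _ "ball 0 1"]) auto
    have d3: "(Moebius_function 0 w0 has_field_derivative 1 / (1 - of_real ((cmod w0)\<^sup>2))) (at ((f \<circ> M) 0))"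
    proof -
      have "complex_of_real ((cmod w0)\<^sup>2) \<noteq> 1"
        using w0 by (metis abs_norm_cancel abs_square_less_1 less_irrefl of_real_eq_1_iff)
      then have "1 - cnj w0 * w0 \<noteq> 0" unfolding complex_norm_square by (simp add: mult.commute)
      then show ?thesis
        using Moebius_has_derivative[of w0 w0] w0
        unfolding complex_norm_square by (simp add: M0 w0_def power2_eq_square mult.commute)
    qed
    have "(F has_field_derivative (1 / (1 - of_real ((cmod w0)\<^sup>2)) * (deriv f z0 * (1 - of_real ((cmod z0)\<^sup>2))))) (at 0)"
      unfolding F_def by (intro DERIV_chain d1 d2 d3)
    then have "h 0 = of_real (1 / (1 - (cmod w0)\<^sup>2)) * (deriv f z0 * of_real (1 - (cmod z0)\<^sup>2))"
      using h(3) DERIV_imp_deriv by fastforce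
    moreover have "0 \<le> 1 - (cmod w0)\<^sup>2" "0 \<le> 1 - (cmod z0)\<^sup>2" using w0 z0 by (auto simp: power_le_one)
    ultimately show ?thesis
      unfolding hyp_deriv_def w0_def[symmetric]
      by (simp add: norm_mult norm_divide del: of_real_diff of_real_power) 
  qed
  define \<eta> where "\<eta> = h 0 / of_real (cmod (h 0))"
  have "h 0 \<noteq> 0" using normh0 d by auto
  then have l1: "cmod \<eta> = 1" by (simp add: \<eta>_def norm_divide)
  show ?thesis
  proof (rule that[OF l1])
    fix z assume z: "cmod z < 1"
    define y where "y = Moebius_function 0 z0 z"
    have y: "cmod y < 1" unfolding y_def by (intro Moebius_function_norm_lt_1 z0 z)
    have My: "M y = z" unfolding M_def y_def
      using z0 z by (intro Moebius_function_compose) auto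
    have "Moebius_function 0 (f z0) (f z) - \<eta> * y = y * (h y - \<eta>)"
      using h(2)[OF y] by (simp add: F_def My w0_def algebra_simps)
    then have "cmod (Moebius_function 0 (f z0) (f z) - \<eta> * y) \<le> cmod (h y - \<eta>)"
      using y by (simp add: norm_mult mult_left_le_one_le)
    also have "\<dots> \<le> 7 * d / (1 - cmod y)"
      unfolding \<eta>_def using d normh0 h1 y by (intro bounded_near_unimodular_value h) auto
    finally show "cmod (Moebius_function 0 (f z0) (f z) - \<eta> * Moebius_function 0 z0 z)
        \<le> 7 * d / (1 - cmod (Moebius_function 0 z0 z))" by (simp add: y_def)
  qed
qed

text \<open>The disc identity for the inverse automorphism. It converts closeness of
  \<open>g\<close> to a rotation into a multiplicative estimate for \<open>1 - |f|^2\<close>, which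
  an additive estimate of \<open>f\<close> would not give.\<close>

lemma one_minus_Moebius_inverse:
  assumes w0: "cmod w0 < 1" and w: "cmod w < 1" and g: "g = Moebius_function 0 w0 w"
  shows "1 - (cmod w)\<^sup>2 = (1 - (cmod w0)\<^sup>2) * (1 - (cmod g)\<^sup>2) / (cmod (1 + cnj w0 * g))\<^sup>2"
proof -
  have g1: "cmod g < 1" unfolding g by (intro Moebius_function_norm_lt_1 w0 w)
  have "w = Moebius_function 0 (- w0) g"
    unfolding g using w0 w by (subst Moebius_function_compose) auto
  then have w_eq: "w = (g + w0) / (1 + cnj w0 * g)" by (simp add: Moebius_function_def)
  have p: "0 < cmod (1 + cnj w0 * g)"
    using norm_one_minus_cnj_mult_pos[of "- w0" g] w0 g1 by simp
  have "- w0 - g = - (g + w0)" by simp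
  then have "cmod (- w0 - g) = cmod (g + w0)" by (metis norm_minus_cancel)
  then have "(cmod (1 + cnj w0 * g))\<^sup>2 - (cmod (g + w0))\<^sup>2 = (1 - (cmod w0)\<^sup>2) * (1 - (cmod g)\<^sup>2)"
    using disc_identity[of "- w0" g] by simp
  then show ?thesis
    using p by (simp add: w_eq norm_divide power_divide field_simps)
qed

text \<open>The model is the automorphism that takes \<open>z0\<close> to \<open>f z0\<close> and is
  the rotation \<open>\<eta>\<close> in coordinates centered at both points; \<open>a\<close> is its
  zero, and \<open>1 - |.|^2\<close> of the model is \<open>(1 - |a|^2) pkernel z a\<close>. The
  condition with \<open>\<kappa>\<close> says that \<open>z\<close> lies in a fixed hyperbolic disc
  around \<open>z0\<close>.\<close>

lemma near_automorphism:
  assumes holf: "f holomorphic_on ball 0 1" and f1: "\<And>z. cmod z < 1 \<Longrightarrow> cmod (f z) < 1"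
    and z0: "cmod z0 < 1" and d: "0 < d" "d < 1" "1 - d \<le> hyp_deriv f z0"
    and \<kappa>: "0 < \<kappa>" "112 * d \<le> \<kappa>\<^sup>2"
  obtains a where "cmod a < 1"
    "\<And>z. cmod z < 1 \<Longrightarrow> \<kappa> \<le> (1 - (cmod z0)\<^sup>2) * pkernel z z0 \<Longrightarrow>
       1 - (cmod (f z))\<^sup>2 \<le> 3 * ((1 - (cmod a)\<^sup>2) * pkernel z a) \<and>
       (1 - (cmod a)\<^sup>2) * pkernel z a \<le> 4 * (1 - (cmod (f z))\<^sup>2)"
proof -
  obtain \<eta> where l1: "cmod \<eta> = 1" and
    near: "\<And>z. cmod z < 1 \<Longrightarrow> cmod (Moebius_function 0 (f z0) (f z) - \<eta> * Moebius_function 0 z0 z)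
        \<le> 7 * d / (1 - cmod (Moebius_function 0 z0 z))"
    using near_rotation[OF holf f1 z0 d] by blast
  define w0 where "w0 = f z0"
  have w0: "cmod w0 < 1" using f1 z0 by (simp add: w0_def)
  \<comment> \<open>In terms of \<open>z\<close>, the denominator of the model automorphism is
    proportional to \<open>p - q * z\<close>; its zero is the reflection of the pole
    \<open>p / q\<close> in the circle, whence \<open>a = cnj (q / p)\<close>.\<close>
  define p where "p = 1 - cnj w0 * \<eta> * z0"
  define q where "q = cnj z0 - cnj w0 * \<eta>"
  have pq: "(cmod p)\<^sup>2 - (cmod q)\<^sup>2 = (1 - (cmod w0)\<^sup>2) * (1 - (cmod z0)\<^sup>2)"
  proof -
    have "(cmod (1 - cnj (w0 * cnj \<eta>) * z0))\<^sup>2 - (cmod (w0 * cnj \<eta> - z0))\<^sup>2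
        = (1 - (cmod (w0 * cnj \<eta>))\<^sup>2) * (1 - (cmod z0)\<^sup>2)" by (rule disc_identity)
    moreover have "cmod (w0 * cnj \<eta> - z0) = cmod q"
      unfolding q_def by (metis complex_cnj_cnj complex_cnj_diff complex_cnj_mult complex_mod_cnj norm_minus_commute)
    ultimately show ?thesis by (simp add: p_def norm_mult l1)
  qed
  have pos: "0 < (1 - (cmod w0)\<^sup>2) * (1 - (cmod z0)\<^sup>2)"
    using w0 z0 by (intro mult_pos_pos) (auto simp: abs_square_less_1)
  have "(cmod q)\<^sup>2 < (cmod p)\<^sup>2" using pq pos by linarith
  then have qp: "cmod q < cmod p" by (simp add: power2_less_imp_less)
  then have p0: "p \<noteq> 0" by auto
  define a where "a = cnj (q / p)"
  have a1: "cmod a < 1" using qp p0 by (simp add: a_def norm_divide)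
  show ?thesis
  proof (rule that[OF a1])
    fix z assume z: "cmod z < 1" and zk: "\<kappa> \<le> (1 - (cmod z0)\<^sup>2) * pkernel z z0"
    define y where "y = Moebius_function 0 z0 z"
    define g where "g = Moebius_function 0 w0 (f z)"
    have y1: "cmod y < 1" unfolding y_def by (intro Moebius_function_norm_lt_1 z0 z)
    have dz: "1 - cnj z0 * z \<noteq> 0" using norm_one_minus_cnj_mult_pos[of z0 z] z0 z by auto
    have y_eq: "1 - (cmod y)\<^sup>2 = (1 - (cmod z0)\<^sup>2) * pkernel z z0"
    proof -
      have "(cmod y)\<^sup>2 = (cmod (z0 - z))\<^sup>2 / (cmod (1 - cnj z0 * z))\<^sup>2"
        by (simp add: y_def Moebius_function_def norm_divide power_divide norm_minus_commute)
      then show ?thesis using pkernel_zero_factor[of z0 z] z0 z by simp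
    qed
    then have "\<kappa> \<le> 2 * (1 - cmod y)" using one_minus_square_le[of "cmod y"] y1 zk by simp
    then have "(\<kappa>/2)\<^sup>2 \<le> (1 - cmod y)\<^sup>2" using \<kappa> by (intro power_mono) auto
    \<comment> \<open>The constant 112 is \<open>7 * 4 * 4\<close>: 7 from the rotation estimate, 4
      from squaring \<open>\<kappa>/2\<close>, and 4 so that the error is at most a quarter of
      \<open>1 - cmod y\<close>.\<close>
    then have "28 * d \<le> (1 - cmod y)\<^sup>2" using \<kappa> by (simp add: power_divide)
    then have "7 * d / (1 - cmod y) \<le> (1 - cmod y) / 4"
      using y1 by (simp add: divide_le_eq power2_eq_square)
    then have gy: "cmod (g - \<eta> * y) \<le> (1 - cmod y) / 4"
      using near[OF z] by (simp add: g_def y_def w0_def)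
    have g1: "cmod g < 1" unfolding g_def by (intro Moebius_function_norm_lt_1 w0 f1 z)
    have ny: "cmod (\<eta> * y) = cmod y" by (simp add: norm_mult l1)
    have "\<bar>cmod g - cmod y\<bar> \<le> (1 - cmod y) / 4"
      using norm_triangle_ineq3[of g "\<eta> * y"] gy ny by simp
    then have sq: "\<bar>(cmod g)\<^sup>2 - (cmod y)\<^sup>2\<bar> \<le> (1 - cmod y) / 4 * 2"
    proof -
      have "\<bar>(cmod g)\<^sup>2 - (cmod y)\<^sup>2\<bar> = \<bar>cmod g - cmod y\<bar> * (cmod g + cmod y)"
        by (simp only: power2_eq_square square_diff_square_factored abs_mult) simp
      also have "\<dots> \<le> (1 - cmod y) / 4 * 2"
        using \<open>\<bar>cmod g - cmod y\<bar> \<le> (1 - cmod y) / 4\<close> g1 y1 by (intro mult_mono) auto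
      finally show ?thesis .
    qed
    have "1 - cmod y \<le> 1 - (cmod y)\<^sup>2" using one_minus_square_le y1 by simp
    then have num: "1 - (cmod g)\<^sup>2 \<le> 3/2 * (1 - (cmod y)\<^sup>2)" "1/2 * (1 - (cmod y)\<^sup>2) \<le> 1 - (cmod g)\<^sup>2"
      using abs_le_D1[OF sq] abs_le_D2[OF sq] by argo+
    define X where "X = cmod (1 + cnj w0 * g)"
    define Y where "Y = cmod (1 + cnj w0 * (\<eta> * y))"
    have "\<bar>X - Y\<bar> \<le> cmod (cnj w0 * (g - \<eta> * y))"
      unfolding X_def Y_def
      using norm_triangle_ineq3[of "1 + cnj w0 * g" "1 + cnj w0 * (\<eta> * y)"] by (simp add: algebra_simps)
    also have "\<dots> \<le> cmod (g - \<eta> * y)" using w0 by (simp add: norm_mult mult_left_le_one_le)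
    finally have XY: "\<bar>X - Y\<bar> \<le> (1 - cmod y) / 4" using gy by simp
    have Yy: "1 - cmod y \<le> Y"
      using norm_one_minus_cnj_mult_ge[of "- w0" "\<eta> * y"] w0 ny by (simp add: Y_def)
    have X: "3/4 * Y \<le> X" "X \<le> 5/4 * Y" using abs_le_D1[OF XY] abs_le_D2[OF XY] Yy by argo+
    have Y0: "0 < Y" using Yy y1 by simp
    have X2: "9/16 * Y\<^sup>2 \<le> X\<^sup>2" "X\<^sup>2 \<le> 25/16 * Y\<^sup>2"
      using power_mono[OF X(1), of 2] power_mono[OF X(2), of 2] X Y0 by (auto simp: power_mult_distrib power2_eq_square)
    define A where "A = (1 - (cmod a)\<^sup>2) * pkernel z a"
    have A: "A = (1 - (cmod w0)\<^sup>2) * (1 - (cmod y)\<^sup>2) / Y\<^sup>2"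
    proof -
      have "1 + cnj w0 * (\<eta> * y) = (p - q * z) / (1 - cnj z0 * z)"
        using dz by (simp add: y_def Moebius_function_def p_def q_def field_simps)
      then have Y: "Y = cmod (p - q * z) / cmod (1 - cnj z0 * z)"
        by (simp add: Y_def norm_divide)
      have "1 - cnj a * z = (p - q * z) / p"
        using p0 by (simp add: a_def field_simps)
      then have "pkernel z a = (1 - (cmod z)\<^sup>2) * (cmod p)\<^sup>2 / (cmod (p - q * z))\<^sup>2"
        by (simp add: pkernel_def norm_divide power_divide)
      moreover have "1 - (cmod a)\<^sup>2 = (1 - (cmod w0)\<^sup>2) * (1 - (cmod z0)\<^sup>2) / (cmod p)\<^sup>2"
        using p0 unfolding pq[symmetric] by (simp add: a_def norm_divide power_divide field_simps)
      ultimately have "A = (1 - (cmod w0)\<^sup>2) * (1 - (cmod z0)\<^sup>2) * (1 - (cmod z)\<^sup>2) / (cmod (p - q * z))\<^sup>2"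
        using p0 by (simp add: A_def)
      moreover have "(1 - (cmod y)\<^sup>2) / Y\<^sup>2 = (1 - (cmod z0)\<^sup>2) * (1 - (cmod z)\<^sup>2) / (cmod (p - q * z))\<^sup>2"
        unfolding y_eq pkernel_def Y using dz by (simp add: power_divide)
      ultimately show ?thesis by (simp only: mult.assoc times_divide_eq_right[symmetric])
    qed
    have fz: "1 - (cmod (f z))\<^sup>2 = (1 - (cmod w0)\<^sup>2) * (1 - (cmod g)\<^sup>2) / X\<^sup>2"
      unfolding X_def by (rule one_minus_Moebius_inverse[OF w0 f1[OF z] g_def])
    have W: "0 < 1 - (cmod w0)\<^sup>2" using w0 by (simp add: abs_square_less_1)
    have N: "0 < 1 - (cmod y)\<^sup>2" using y1 by (simp add: abs_square_less_1)
    have X0: "0 < X" using X Y0 by simp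
    \<comment> \<open>The quotients of the numerical bounds are 8/3 here and 25/8 in the reverse
      direction; 3 and 4 round them up.\<close>
    have "(1 - (cmod g)\<^sup>2) / X\<^sup>2 \<le> (3/2 * (1 - (cmod y)\<^sup>2)) / (9/16 * Y\<^sup>2)"
      using num X2 N Y0 by (intro frac_le) auto
    also have "\<dots> \<le> 3 * ((1 - (cmod y)\<^sup>2) / Y\<^sup>2)" using N Y0 by (simp add: field_simps)
    finally have "(1 - (cmod w0)\<^sup>2) * ((1 - (cmod g)\<^sup>2) / X\<^sup>2) \<le> (1 - (cmod w0)\<^sup>2) * (3 * ((1 - (cmod y)\<^sup>2) / Y\<^sup>2))"
      using W by (intro mult_left_mono) auto
    then have r1: "1 - (cmod (f z))\<^sup>2 \<le> 3 * A" unfolding fz A by (simp add: mult_ac del: right_diff_distrib_numeral)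
    have "(1 - (cmod y)\<^sup>2) / Y\<^sup>2 \<le> 4 * ((1/2 * (1 - (cmod y)\<^sup>2)) / (25/16 * Y\<^sup>2))" using N Y0 by (simp add: field_simps)
    also have "\<dots> \<le> 4 * ((1 - (cmod g)\<^sup>2) / X\<^sup>2)"
      using num X2 N Y0 X0 by (intro mult_left_mono frac_le) auto
    finally have "(1 - (cmod w0)\<^sup>2) * ((1 - (cmod y)\<^sup>2) / Y\<^sup>2) \<le> (1 - (cmod w0)\<^sup>2) * (4 * ((1 - (cmod g)\<^sup>2) / X\<^sup>2))"
      using W by (intro mult_left_mono) auto
    then have r2: "A \<le> 4 * (1 - (cmod (f z))\<^sup>2)" unfolding fz A by (simp add: mult_ac del: right_diff_distrib_numeral)
    show "1 - (cmod (f z))\<^sup>2 \<le> 3 * ((1 - (cmod a)\<^sup>2) * pkernel z a) \<and>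
       (1 - (cmod a)\<^sup>2) * pkernel z a \<le> 4 * (1 - (cmod (f z))\<^sup>2)"
      using r1 r2 by (simp add: A_def)
  qed
qed

section \<open>Maps charging Carleson boxes are contractive\<close>

lemma norm_polar_diff:
  assumes "0 \<le> r'" "r' \<le> 1"
  shows "cmod (of_real r * cis s - of_real r' * cis s') \<le> \<bar>r - r'\<bar> + \<bar>s - s'\<bar>"
proof -
  have "of_real r * cis s - of_real r' * cis s' = of_real (r - r') * cis s + of_real r' * (cis s' * (cis (s - s') - 1))"
    by (simp add: right_diff_distrib cis_mult left_diff_distrib)
  then have "cmod (of_real r * cis s - of_real r' * cis s')
      \<le> cmod (of_real (r - r') * cis s) + cmod (of_real r' * (cis s' * (cis (s - s') - 1)))"
    by (metis norm_triangle_ineq)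
  moreover have "cmod (of_real (r - r') * cis s) = \<bar>r - r'\<bar>"
    by (simp add: norm_mult del: of_real_diff)
  moreover have "cmod (of_real r' * (cis s' * (cis (s - s') - 1))) \<le> cmod (cis (s - s') - 1)"
    using assms by (simp add: norm_mult mult_left_le_one_le)
  moreover have "cmod (cis (s - s') - 1) \<le> \<bar>s - s'\<bar>"
    using norm_one_minus_cis_le[of "s - s'"] by (simp add: norm_minus_commute)
  ultimately show ?thesis by linarith
qed

text \<open>The kernel based at the top of a box of size \<open>e\<close> is of order
  \<open>1/e\<close> throughout the closed box, so indicators of boxes are dominated by kernels and
  mass by values of \<open>P\<close>. The distance \<open>6 * e\<close> consists of
  \<open>2 * e\<close> radially and \<open>pi * e < 4 * e\<close> along the arc.\<close>

lemma pkernel_ge_on_small_box: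
  assumes e: "0 < e" "e \<le> 1" and r: "0 \<le> r" "r \<le> 1" "1 - r \<le> e" and s: "\<bar>s - \<theta>\<bar> \<le> pi * e"
  shows "1 / (36 * e) \<le> pkernel (zQ \<theta> e) (of_real r * cis s)"
proof -
  have w1: "cmod (of_real r * cis s) \<le> 1" using r by (simp add: norm_mult)
  have "cmod (1 - cnj (of_real r * cis s) * zQ \<theta> e) = cmod (of_real 1 * cis s - of_real (r * (1 - e)) * cis \<theta>)"
  proof -
    have "of_real 1 * cis s - of_real (r * (1 - e)) * cis \<theta> = cis s * (1 - cnj (of_real r * cis s) * zQ \<theta> e)"
    proof -
      have "cis s * (1 - cnj (of_real r * cis s) * zQ \<theta> e) = cis s - (cis s * cis (- s)) * (of_real (r * (1 - e)) * cis \<theta>)"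
        by (simp add: zQ_def cis_cnj algebra_simps)
      then show ?thesis by (simp add: cis_mult)
    qed
    then show ?thesis by (simp add: norm_mult)
  qed
  also have "\<dots> \<le> \<bar>1 - r * (1 - e)\<bar> + \<bar>s - \<theta>\<bar>"
    using r e by (intro norm_polar_diff) (auto simp: mult_le_one)
  also have "\<dots> \<le> 2 * e + 4 * e"
  proof (intro add_mono)
    have "r * (1 - e) \<le> 1" using r e by (simp add: mult_le_one)
    moreover have "r * e \<le> e" using r e by (simp add: mult_left_le_one_le)
    ultimately show "\<bar>1 - r * (1 - e)\<bar> \<le> 2 * e" using r by (simp add: algebra_simps)
    have "pi * e \<le> 4 * e" using e pi_less_4 by (intro mult_right_mono) auto
    then show "\<bar>s - \<theta>\<bar> \<le> 4 * e" using s by simp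
  qed
  finally have le: "cmod (1 - cnj (of_real r * cis s) * zQ \<theta> e) \<le> 6 * e" by simp
  have pos: "0 < cmod (1 - cnj (of_real r * cis s) * zQ \<theta> e)"
    using w1 e by (intro norm_one_minus_cnj_mult_pos) (auto simp: cmod_zQ)
  have "1 / (36 * e) = e / (6 * e)\<^sup>2" using e by (simp add: power2_eq_square)
  also have "\<dots> \<le> (1 - (cmod (zQ \<theta> e))\<^sup>2) / (cmod (1 - cnj (of_real r * cis s) * zQ \<theta> e))\<^sup>2"
  proof (intro frac_le power_mono le)
    show "e \<le> 1 - (cmod (zQ \<theta> e))\<^sup>2" using one_minus_square_le(1)[of "1 - e"] e by (simp add: cmod_zQ)
  qed (use e pos in \<open>auto simp: cmod_zQ power_le_one\<close>)
  finally show ?thesis by (simp add: pkernel_def)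
qed

lemma arc_subdivision:
  fixes N :: nat
  assumes "0 < N" "0 < l" "\<bar>s - \<theta>\<bar> \<le> pi * l"
  obtains j where "j < N" "\<bar>s - (\<theta> + pi * l * ((2 * real j + 1) / real N - 1))\<bar> \<le> pi * (l / real N)"
proof -
  define x where "x = (s - \<theta>) / (pi * l)"
  have x: "-1 \<le> x" "x \<le> 1" using assms by (auto simp: x_def field_simps abs_le_iff)
  define y where "y = (x + 1) * real N / 2"
  have y: "0 \<le> y" "y \<le> real N" using x assms by (auto simp: y_def)
  \<comment> \<open>The minimum with \<open>N - 1\<close> assigns the right end of the arc, where
    \<open>y = N\<close>, to the last subarc.\<close>
  define j where "j = min (nat \<lfloor>y\<rfloor>) (N - 1)"
  have j: "j < N" using assms by (simp add: j_def)
  have yj: "real j \<le> y" "y \<le> real j + 1"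
  proof -
    have 1: "real (nat \<lfloor>y\<rfloor>) = of_int \<lfloor>y\<rfloor>" using y by simp
    have "real j \<le> real (nat \<lfloor>y\<rfloor>)" by (simp add: j_def)
    then show "real j \<le> y" using 1 by linarith
    show "y \<le> real j + 1"
    proof (cases "nat \<lfloor>y\<rfloor> \<le> N - 1")
      case True
      then show ?thesis using 1 by (simp add: j_def)
    next
      case False
      then have "j = N - 1" by (simp add: j_def)
      then show ?thesis using y assms by simp
    qed
  qed
  have s: "s = \<theta> + pi * l * (2 * y / real N - 1)" using assms by (simp add: x_def y_def)
  have "s - (\<theta> + pi * l * ((2 * real j + 1) / real N - 1)) = pi * (l / real N) * (2 * (y - real j) - 1)"
    using assms by (simp add: s field_simps)
  moreover have "\<bar>pi * (l / real N) * (2 * (y - real j) - 1)\<bar> \<le> pi * (l / real N)"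
  proof -
    have "\<bar>2 * (y - real j) - 1\<bar> \<le> 1" using yj by (simp add: abs_le_iff)
    then have "\<bar>pi * (l / real N)\<bar> * \<bar>2 * (y - real j) - 1\<bar> \<le> \<bar>pi * (l / real N)\<bar>"
      by (intro mult_left_le) auto
    then show ?thesis using assms by (simp add: abs_mult)
  qed
  ultimately show ?thesis using that[OF j] by simp
qed

context mass_functional
begin

theorem mass_bound_imp_contractive:
  assumes C: "0 < C" and
    bound: "\<And>\<theta> l. 0 < l \<Longrightarrow> l \<le> 1 \<Longrightarrow> P (zQ \<theta> l) \<le> C \<Longrightarrow>
        ennreal (C * l * P (zQ \<theta> l)) \<le> L (indicator (closure (carleson_box \<theta> l)))"
  shows "contractive f"
proof (rule ccontr)
  assume notc: "\<not> contractive f"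
  \<comment> \<open>Here \<open>13824 = 36 * 384\<close>, the product of the constant in the
    covering of the box and the one in the bound for \<open>P\<close> at the tops of the small
    boxes.\<close>
  obtain N :: nat where N: "13824 / C < real N" using reals_Archimedean2 by blast
  have N0: "0 < N" using N C by (metis divide_pos_pos gr0I not_less_iff_gr_or_eq of_nat_0 less_asym zero_less_numeral)
  define t where "t = 1 / real N"
  have t: "0 < t" "t \<le> 1" "real N * t = 1" using N0 by (auto simp: t_def)
  have tC: "13824 * t < C" using N C N0 by (simp add: t_def field_simps)
  \<comment> \<open>The size of the box relative to the distance of \<open>z0\<close> from the
    circle. The bound \<open>C/100\<close> ensures
    \<open>P zi \<le> 96 * \<epsilon> \<le> C\<close>; the bound \<open>1/1000\<close> keeps
    \<open>1 - |f|^2\<close>, at most \<open>3 * 128 * \<epsilon>\<close> on the upper part of the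
    box, below 1/2.\<close>
  define \<epsilon> where "\<epsilon> = min (1/1000) (C/100)"
  have \<epsilon>: "0 < \<epsilon>" "\<epsilon> \<le> 1/1000" "\<epsilon> \<le> C/100" using C by (auto simp: \<epsilon>_def)
  \<comment> \<open>Points of the box with height at least \<open>t * l\<close> satisfy the region
    condition with this value: the numerator is at least \<open>D * (t * l)\<close>, the denominator
    at most \<open>(10 * D)\<^sup>2\<close>, and \<open>l = \<epsilon> * D\<close>.\<close>
  define \<kappa> where "\<kappa> = t * \<epsilon> / 100"
  have \<kappa>: "0 < \<kappa>" "\<kappa> \<le> 1" using t \<epsilon> mult_mono[of t 1 \<epsilon> 1] by (auto simp: \<kappa>_def)
  define d where "d = \<kappa>\<^sup>2 / 112"
  have d: "0 < d" "d < 1" "112 * d \<le> \<kappa>\<^sup>2"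
    using \<kappa> power_le_one[of \<kappa> 2] by (auto simp: d_def)
  obtain z0 where z0: "cmod z0 < 1" "1 - d \<le> hyp_deriv f z0"
    using notc d unfolding contractive_def
    by (metis (no_types, opaque_lifting) diff_less_eq dist_0_norm le_cases less_add_same_cancel1 mem_ball)
  obtain a where a1: "cmod a < 1" and
    approx: "\<And>z. cmod z < 1 \<Longrightarrow> \<kappa> \<le> (1 - (cmod z0)\<^sup>2) * pkernel z z0 \<Longrightarrow>
       1 - (cmod (f z))\<^sup>2 \<le> 3 * ((1 - (cmod a)\<^sup>2) * pkernel z a) \<and>
       (1 - (cmod a)\<^sup>2) * pkernel z a \<le> 4 * (1 - (cmod (f z))\<^sup>2)"
    using near_automorphism[OF holf f_disc z0(1) d(1,2) z0(2) \<kappa>(1) d(3)] by blast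
  define D where "D = 1 - cmod z0"
  have D: "0 < D" "D \<le> 1" using z0 by (auto simp: D_def)
  define l where "l = \<epsilon> * D"
  have l: "0 < l" "l \<le> 1" "l \<le> D / 1000" "l \<le> D"
    using \<epsilon> D mult_right_mono[OF \<epsilon>(2), of D] by (auto simp: l_def mult_le_one)
  obtain \<theta>0 where \<theta>0: "z0 = of_real (cmod z0) * cis \<theta>0"
    using polar_around[of z0 0] by auto
  define \<theta>1 where "\<theta>1 = \<theta>0 + pi * D"
  \<comment> \<open>The two candidate tops are at distance at least \<open>D\<close>, so for
    \<open>cmod a > 1/2\<close> their denominators add up to at least \<open>D/2\<close> and one of
    them is large. For smaller \<open>cmod a\<close> every denominator is at least 1/2.\<close>
  have "\<exists>\<theta>\<in>{\<theta>0, \<theta>1}. D / 4 \<le> cmod (1 - cnj a * zQ \<theta> l)"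
  proof (cases "cmod a \<le> 1/2")
    case True
    have "1 - cmod a \<le> cmod (1 - cnj a * zQ \<theta>0 l)"
      using l by (intro norm_one_minus_cnj_mult_ge') (simp add: cmod_zQ)
    then show ?thesis using True D by (intro bexI[of _ \<theta>0]) auto
  next
    case False
    have "zQ \<theta>0 l - zQ \<theta>1 l = of_real (1 - l) * (cis \<theta>0 * (1 - cis (pi * D)))"
      by (simp add: zQ_def \<theta>1_def cis_mult[symmetric] algebra_simps)
    then have "cmod (zQ \<theta>0 l - zQ \<theta>1 l) = (1 - l) * cmod (1 - cis (pi * D))"
      using l by (simp add: norm_mult del: of_real_diff)
    moreover have "2 * D \<le> cmod (1 - cis (pi * D))"
      using norm_one_minus_cis_ge[of "pi * D"] D by simp
    moreover have "1 / 2 \<le> 1 - l" using l D by simp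
    moreover have "1 / 2 * (2 * D) \<le> (1 - l) * cmod (1 - cis (pi * D))"
      using calculation D by (intro mult_mono) auto
    ultimately have "D \<le> cmod (zQ \<theta>0 l - zQ \<theta>1 l)" by simp
    then have "1 / 2 * D \<le> cmod a * cmod (zQ \<theta>0 l - zQ \<theta>1 l)"
      using False D by (intro mult_mono) auto
    also have "\<dots> = cmod ((1 - cnj a * zQ \<theta>1 l) - (1 - cnj a * zQ \<theta>0 l))"
    proof -
      have "(1 - cnj a * zQ \<theta>1 l) - (1 - cnj a * zQ \<theta>0 l) = cnj a * (zQ \<theta>0 l - zQ \<theta>1 l)"
        by (simp add: algebra_simps)
      then show ?thesis by (simp only: norm_mult complex_mod_cnj)
    qed
    also have "\<dots> \<le> cmod (1 - cnj a * zQ \<theta>1 l) + cmod (1 - cnj a * zQ \<theta>0 l)"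
      by (rule norm_triangle_ineq4)
    finally show ?thesis by force
  qed
  then obtain \<theta> where \<theta>: "\<theta> = \<theta>0 \<or> \<theta> = \<theta>1" and far: "D / 4 \<le> cmod (1 - cnj a * zQ \<theta> l)" by auto
  define zi where "zi = zQ \<theta> l"
  have zi: "cmod zi = 1 - l" "cmod zi < 1" using l by (auto simp: zi_def cmod_zQ)
  define A where "A z = (1 - (cmod a)\<^sup>2) * pkernel z a" for z
  have A0: "0 \<le> A z" if "cmod z < 1" for z
    using that a1 pkernel_nonneg[of z a] by (simp add: A_def power_le_one)
  have Azi: "A zi \<le> 16 * \<epsilon>"
  proof -
    define X where "X = cmod (1 - cnj a * zi)"
    have X: "0 < X" "D / 4 \<le> X" using far D by (auto simp: X_def zi_def)
    have "1 - (cmod a)\<^sup>2 \<le> 2 * X"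
      using one_minus_square_le(2)[of "cmod a"] norm_one_minus_cnj_mult_ge'[of zi a] a1 zi by (simp add: X_def)
    moreover have "1 - (cmod zi)\<^sup>2 \<le> 2 * l"
      using one_minus_square_le(2)[of "cmod zi"] zi l by simp
    ultimately have "(1 - (cmod a)\<^sup>2) * (1 - (cmod zi)\<^sup>2) \<le> (2 * X) * (2 * l)"
      using a1 zi(2) X l by (intro mult_mono) (auto simp: power_le_one)
    then have "A zi \<le> ((2 * X) * (2 * l)) / X\<^sup>2"
      unfolding A_def pkernel_def X_def[symmetric] using X by (simp add: divide_right_mono)
    also have "\<dots> = 4 * l / X" using X by (simp add: power2_eq_square)
    also have "\<dots> \<le> 4 * l / (D / 4)" using X D l by (intro divide_left_mono) auto
    also have "\<dots> = 16 * \<epsilon>" using D by (simp add: l_def)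
    finally show ?thesis .
  qed
  \<comment> \<open>Above height \<open>t * l\<close> the box lies in the hyperbolic disc where the
    model is accurate. Since \<open>l\<close> is tiny against \<open>D\<close>, the denominator
    loses at most a factor 2 over the box, so \<open>A\<close> is bounded by a multiple of the
    height \<open>1 - r\<close>.\<close>
  have region: "cmod (of_real r * cis s) < 1 \<and> 
      1 - (cmod (f (of_real r * cis s)))\<^sup>2 \<le> 3 * A (of_real r * cis s) \<and>
      A (of_real r * cis s) \<le> 4 * (1 - (cmod (f (of_real r * cis s)))\<^sup>2) \<and>
      A (of_real r * cis s) \<le> 8 * ((1 - r) / l) * A zi"
    if r: "t * l \<le> 1 - r" "1 - r \<le> l" and s: "\<bar>s - \<theta>\<bar> \<le> pi * l" for r s
  proof -
    define z where "z = of_real r * cis s"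
    have tl: "0 < t * l" using t l by simp
    have r1: "0 \<le> r" "r < 1" using r l tl by auto
    have z: "cmod z = r" "cmod z < 1" using r1 by (auto simp: z_def norm_mult)
    have pi4: "pi * l \<le> 4 * l" "pi * D \<le> 4 * D"
      using l D pi_less_4 by (auto intro!: mult_right_mono)
    have zz0: "cmod (z - z0) \<le> 8 * D"
    proof -
      have "cmod (z - z0) \<le> \<bar>r - cmod z0\<bar> + \<bar>s - \<theta>0\<bar>"
        unfolding z_def by (subst \<theta>0) (use z0 in \<open>auto intro!: norm_polar_diff\<close>)
      moreover have "\<bar>r - cmod z0\<bar> \<le> D" using r r1 l z0 by (auto simp: D_def)
      moreover have "\<bar>s - \<theta>0\<bar> \<le> pi * l + pi * D"
      proof -
        have "0 \<le> pi * D" using D by simp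
        then show ?thesis using s \<theta> by (auto simp: \<theta>1_def abs_le_iff)
      qed
      moreover have "pi * l + pi * D \<le> 5 * D"
      proof -
        have "pi * l + pi * D \<le> 4 * l + 4 * D" by (rule add_mono[OF pi4])
        also have "\<dots> \<le> 5 * D" using l by simp
        finally show ?thesis .
      qed
      ultimately show ?thesis by linarith
    qed
    have "cmod (1 - cnj z0 * z) \<le> cmod (1 - cnj z0 * z0) + cmod (z - z0)"
      using z0 by (intro norm_one_minus_cnj_mult_diff) auto
    moreover have "cmod (1 - cnj z0 * z0) \<le> 2 * D"
    proof -
      have "1 - cnj z0 * z0 = of_real (1 - (cmod z0)\<^sup>2)"
        unfolding of_real_diff complex_norm_square by (simp add: mult.commute)
      then have "cmod (1 - cnj z0 * z0) = 1 - (cmod z0)\<^sup>2"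
        using z0 by (simp add: power_le_one del: of_real_diff)
      then show ?thesis using one_minus_square_le(2)[of "cmod z0"] z0 by (simp add: D_def)
    qed
    ultimately have le10: "cmod (1 - cnj z0 * z) \<le> 10 * D" using zz0 by linarith
    have pos: "0 < cmod (1 - cnj z0 * z)" using z0 z by (intro norm_one_minus_cnj_mult_pos) auto
    have "\<kappa> = (D * (t * l)) / (10 * D)\<^sup>2" using D by (simp add: \<kappa>_def l_def power2_eq_square)
    also have "\<dots> \<le> ((1 - (cmod z0)\<^sup>2) * (1 - (cmod z)\<^sup>2)) / (cmod (1 - cnj z0 * z))\<^sup>2"
    proof (intro frac_le mult_mono power_mono le10)
      show "D \<le> 1 - (cmod z0)\<^sup>2" using one_minus_square_le(1)[of "cmod z0"] z0 by (simp add: D_def)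
      show "t * l \<le> 1 - (cmod z)\<^sup>2" using one_minus_square_le(1)[of r] r1 r z by simp
    qed (use z0 z tl pos in \<open>auto simp: power_le_one\<close>)
    finally have kz: "\<kappa> \<le> (1 - (cmod z0)\<^sup>2) * pkernel z z0" by (simp add: pkernel_def)
    define X where "X = cmod (1 - cnj a * zi)"
    define Y where "Y = cmod (1 - cnj a * z)"
    have X: "D / 4 \<le> X" using far by (simp add: X_def zi_def)
    have "X \<le> Y + cmod (zi - z)" unfolding X_def Y_def using a1 by (intro norm_one_minus_cnj_mult_diff) auto
    moreover have "cmod (zi - z) \<le> 5 * l"
    proof -
      have "cmod (z - of_real (1 - l) * cis \<theta>) \<le> \<bar>r - (1 - l)\<bar> + \<bar>s - \<theta>\<bar>"
        unfolding z_def using l by (intro norm_polar_diff) auto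
      then have "cmod (zi - z) \<le> \<bar>r - (1 - l)\<bar> + \<bar>s - \<theta>\<bar>"
        by (simp add: zi_def zQ_def norm_minus_commute)
      moreover have "\<bar>s - \<theta>\<bar> \<le> 4 * l" by (rule order_trans[OF s pi4(1)])
      moreover have "\<bar>r - (1 - l)\<bar> \<le> l" using r r1 by (simp add: abs_le_iff)
      ultimately show ?thesis by linarith
    qed
    ultimately have Y: "X \<le> 2 * Y" using X l by linarith
    have X0: "0 < X" "0 < Y" using X D Y by auto
    have "A z \<le> 8 * ((1 - r) / l) * A zi"
    proof -
      have "1 - (cmod z)\<^sup>2 \<le> 2 * (1 - r)" using one_minus_square_le(2)[of r] z r1 by simp
      also have "\<dots> = 2 * ((1 - r) / l) * l" using l by simp
      also have "\<dots> \<le> 2 * ((1 - r) / l) * (1 - (cmod zi)\<^sup>2)"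
        using one_minus_square_le(1)[of "cmod zi"] zi r1 l by (intro mult_left_mono) auto
      finally have 1: "1 - (cmod z)\<^sup>2 \<le> 2 * ((1 - r) / l) * (1 - (cmod zi)\<^sup>2)" .
      have "(1 - (cmod z)\<^sup>2) / Y\<^sup>2 \<le> (2 * ((1 - r) / l) * (1 - (cmod zi)\<^sup>2)) / (X/2)\<^sup>2"
        using 1 Y X0 z(2) zi(2) r1 l by (intro frac_le power_mono) (auto simp: power_le_one)
      moreover have "(2 * q * m) / (X/2)\<^sup>2 = 8 * q * (m / X\<^sup>2)" for q m :: real
        by (simp add: power_divide)
      ultimately have "pkernel z a \<le> 8 * ((1 - r) / l) * pkernel zi a"
        unfolding pkernel_def X_def[symmetric] Y_def[symmetric] by (simp only:)
      then have "(1 - (cmod a)\<^sup>2) * pkernel z a \<le> (1 - (cmod a)\<^sup>2) * (8 * ((1 - r) / l) * pkernel zi a)"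
        using a1 by (intro mult_left_mono) (auto simp: power_le_one)
      then show ?thesis by (simp add: A_def mult_ac)
    qed
    then show ?thesis using approx[OF z(2) kz] z unfolding A_def z_def by blast
  qed
  have rzi: "1 - (cmod (f zi))\<^sup>2 \<le> 3 * A zi" "A zi \<le> 4 * (1 - (cmod (f zi))\<^sup>2)"
    using region[of "1 - l" \<theta>] t l by (auto simp: zi_def zQ_def mult_left_le_one_le)
  have Pzi: "P zi \<le> 96 * \<epsilon>"
    using P_le[OF zi(2)] rzi(1) Azi \<epsilon> by simp
  then have Pzi2: "P zi \<le> C" "P zi \<le> 1/2" using \<epsilon> by auto
  have fzi: "1 - (cmod (f zi))\<^sup>2 \<le> 2 * P zi" using one_minus_f_le zi(2) Pzi2 by simp
  have "(cmod (f zi))\<^sup>2 < 1" using f_disc[OF zi(2)] by (simp add: abs_square_less_1)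
  then have Ppos: "0 < P zi" using fzi by simp
  define e where "e = t * l"
  have e: "0 < e" "e \<le> l" "e \<le> 1" using t l by (auto simp: e_def mult_left_le_one_le mult_le_one)
  \<comment> \<open>Centers of the \<open>N\<close> equal subarcs of the arc; the boxes over them
    have size \<open>e = l / N\<close>.\<close>
  define \<sigma> where "\<sigma> j = \<theta> + pi * l * ((2 * real j + 1) / real N - 1)" for j :: nat
  have Pj: "P (zQ (\<sigma> j) e) \<le> 384 * t * P zi" if "j < N" for j
  proof -
    have "\<bar>(2 * real j + 1) / real N - 1\<bar> \<le> 1" using that by (auto simp: abs_le_iff field_simps)
    then have "\<bar>\<sigma> j - \<theta>\<bar> \<le> pi * l" using l by (simp add: \<sigma>_def abs_mult mult_left_le)
    then have R: "1 - (cmod (f (zQ (\<sigma> j) e)))\<^sup>2 \<le> 3 * A (zQ (\<sigma> j) e)" "A (zQ (\<sigma> j) e) \<le> 8 * (e / l) * A zi"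
      using region[of "1 - e" "\<sigma> j"] e t(2) by (auto simp: zQ_def e_def)
    have el: "e / l = t" using l by (simp add: e_def)
    have "A (zQ (\<sigma> j) e) \<le> 8 * t * (16 * \<epsilon>)"
    proof -
      have "8 * t * A zi \<le> 8 * t * (16 * \<epsilon>)" using Azi t by (intro mult_left_mono) auto
      then show ?thesis using R(2) unfolding el by (rule order_trans[rotated])
    qed
    also have "\<dots> \<le> 8 * 1 * (16 * \<epsilon>)" using t \<epsilon> by (intro mult_right_mono) auto
    finally have half: "1 - (cmod (f (zQ (\<sigma> j) e)))\<^sup>2 \<le> 1/2" using R(1) \<epsilon> by simp
    have "P (zQ (\<sigma> j) e) \<le> 2 * (1 - (cmod (f (zQ (\<sigma> j) e)))\<^sup>2)"
      using e half by (intro P_le) (auto simp: cmod_zQ)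
    also have "\<dots> \<le> 2 * (3 * (8 * t * (4 * (2 * P zi))))"
    proof -
      have "8 * t * A zi \<le> 8 * t * (4 * (2 * P zi))"
        using rzi(2) fzi t by (intro mult_left_mono) auto
      then have "A (zQ (\<sigma> j) e) \<le> 8 * t * (4 * (2 * P zi))"
        using R(2) unfolding el by (rule order_trans[rotated])
      then show ?thesis by (intro mult_left_mono order_trans[OF R(1)]) auto
    qed
    finally show ?thesis by simp
  qed
  \<comment> \<open>It suffices to cover the points at which \<open>L\<close> is tested. Above
    height \<open>e\<close> the region estimate gives \<open>f w \<noteq> 0\<close>, so no such
    point lies there; what remains near the circle is covered by the small boxes.\<close>
  have cover: "indicator (closure (carleson_box \<theta> l)) w \<le> (\<Sum>j<N. ennreal (36 * e) * ennreal (pkernel (zQ (\<sigma> j) e) w))"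
    if w: "cmod w \<le> 1" "cmod w < 1 \<Longrightarrow> f w = 0" for w
  proof (cases "w \<in> closure (carleson_box \<theta> l)")
    case True
    obtain r s where rs: "w = of_real r * cis s" "1 - l \<le> r" "0 \<le> r" "r \<le> 1" "\<bar>s - \<theta>\<bar> \<le> pi * l"
      using closure_carleson_box_polar[OF True] by blast
    have "1 - r \<le> e"
    proof (rule ccontr)
      assume "\<not> 1 - r \<le> e"
      then have rr: "t * l \<le> 1 - r" "1 - r \<le> l" using rs by (auto simp: e_def)
      have R: "cmod w < 1" "1 - (cmod (f w))\<^sup>2 \<le> 3 * A w" "A w \<le> 8 * ((1 - r) / l) * A zi"
        using region[OF rr rs(5)] rs(1) by auto
      have "(1 - r) / l \<le> 1" using rr l by simp
      then have "8 * ((1 - r) / l) * A zi \<le> 8 * 1 * (16 * \<epsilon>)"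
        using Azi A0[OF zi(2)] rs(4) l by (intro mult_mono) auto
      from order_trans[OF R(3) this] have "A w \<le> 128 * \<epsilon>" by simp
      then have "1 - (cmod (f w))\<^sup>2 < 1" using R(2) \<epsilon> by linarith
      then show False using w(2)[OF R(1)] by simp
    qed
    obtain j where j: "j < N" "\<bar>s - \<sigma> j\<bar> \<le> pi * (l / real N)"
      using arc_subdivision[OF N0 l(1) rs(5)] unfolding \<sigma>_def by blast
    have "l / real N = e" by (simp add: e_def t_def)
    then have "1 / (36 * e) \<le> pkernel (zQ (\<sigma> j) e) w"
      using pkernel_ge_on_small_box[OF e(1,3) rs(3,4) \<open>1 - r \<le> e\<close>, of s "\<sigma> j"] j rs(1) by simp
    then have "1 \<le> 36 * e * pkernel (zQ (\<sigma> j) e) w" using e by (simp add: field_simps)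
    then have "ennreal 1 \<le> ennreal (36 * e) * ennreal (pkernel (zQ (\<sigma> j) e) w)"
      using e pkernel_nonneg[of "zQ (\<sigma> j) e" w] by (simp add: ennreal_mult[symmetric] cmod_zQ ennreal_leI del: ennreal_1)
    also have "\<dots> \<le> (\<Sum>j<N. ennreal (36 * e) * ennreal (pkernel (zQ (\<sigma> j) e) w))"
      using j by (intro member_le_sum) auto
    finally show ?thesis using True by simp
  qed simp
  have "L (indicator (closure (carleson_box \<theta> l))) \<le> L (\<lambda>w. \<Sum>j<N. ennreal (36 * e) * ennreal (pkernel (zQ (\<sigma> j) e) w))"
    by (rule L_mono[OF cover])
  also have "\<dots> = (\<Sum>j<N. ennreal (36 * e) * ennreal (P (zQ (\<sigma> j) e)))"
    using e by (subst L_sum) (auto simp: L_cmult L_pkernel cmod_zQ)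
  also have "\<dots> \<le> (\<Sum>j<N. ennreal (36 * e) * ennreal (384 * t * P zi))"
    using Pj by (intro sum_mono mult_left_mono ennreal_leI) auto
  also have "\<dots> = ennreal (real N * (36 * e * (384 * t * P zi)))"
    using e t Ppos by (simp add: ennreal_mult[symmetric] ennreal_of_nat_eq_real_of_nat)
  also have "real N * (36 * e * (384 * t * P zi)) = 13824 * t * l * P zi"
    using t(3) by (simp add: e_def)
  finally have "L (indicator (closure (carleson_box \<theta> l))) \<le> ennreal (13824 * t * l * P zi)" .
  moreover have "ennreal (C * l * P zi) \<le> L (indicator (closure (carleson_box \<theta> l)))"
    using bound[OF l(1,2)] Pzi2 unfolding zi_def by blast
  ultimately have "ennreal (C * l * P zi) \<le> ennreal (13824 * t * l * P zi)" by (rule order_trans[rotated])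
  then have "C * l * P zi \<le> 13824 * t * l * P zi"
    using t l Ppos by simp
  then show False using tC l Ppos by simp
qed

end

section \<open>Integration on the circle\<close>

lemma space_circle_m [simp]: "space circle_m = sphere 0 1"
  by (simp add: circle_m_def space_restrict_space)

lemma sets_circle_m [measurable_cong]: "sets circle_m = sets (restrict_space borel (sphere 0 1))"
  by (simp add: circle_m_def)

lemma measurable_cis_circle [measurable]: "cis \<in> measurable borel (restrict_space borel (sphere 0 1))"
  by (intro measurable_restrict_space2 borel_measurable_continuous_onI continuous_intros) auto

lemma borel_measurable_circle_m [measurable_dest]:
  "g \<in> borel_measurable circle_m \<Longrightarrow> (\<lambda>t. g (cis t)) \<in> borel_measurable borel"
  using measurable_compose[OF measurable_cis_circle, of g borel]
  by (simp add: measurable_cong_sets[OF sets_circle_m refl])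

lemma borel_measurable_circle_mI:
  "g \<in> borel_measurable borel \<Longrightarrow> g \<in> borel_measurable circle_m"
  by (simp add: measurable_cong_sets[OF sets_circle_m refl] measurable_restrict_space1)

lemma nn_integral_circle_m:
  assumes [measurable]: "g \<in> borel_measurable circle_m"
  shows "(\<integral>\<^sup>+\<zeta>. g \<zeta> \<partial>circle_m) = (\<integral>\<^sup>+t. ennreal (indicator {0..2*pi} t / (2*pi)) * g (cis t) \<partial>lborel)"
proof -
  have "(\<integral>\<^sup>+\<zeta>. g \<zeta> \<partial>circle_m) = (\<integral>\<^sup>+t. g (cis t) \<partial>density lborel (\<lambda>t::real. ennreal (indicator {0..2*pi} t / (2*pi))))"
    using assms unfolding circle_m_def by (intro nn_integral_distr) auto
  also have "\<dots> = (\<integral>\<^sup>+t. ennreal (indicator {0..2*pi} t / (2*pi)) * g (cis t) \<partial>lborel)"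
    by (intro nn_integral_density) auto
  finally show ?thesis .
qed

lemma integrable_circle_m_iff:
  fixes g :: "complex \<Rightarrow> 'b::{banach, second_countable_topology}"
  assumes [measurable]: "g \<in> borel_measurable circle_m"
  shows "integrable circle_m g \<longleftrightarrow> set_integrable lborel {0..2*pi} (\<lambda>t. g (cis t))"
proof -
  have "integrable circle_m g \<longleftrightarrow> integrable (density lborel (\<lambda>t::real. ennreal (indicator {0..2*pi} t / (2*pi)))) (\<lambda>t. g (cis t))"
    using assms unfolding circle_m_def by (intro integrable_distr_eq) auto
  also have "\<dots> \<longleftrightarrow> integrable lborel (\<lambda>t. (indicator {0..2*pi} t / (2*pi)) *\<^sub>R g (cis t))"
    by (intro integrable_density) auto
  also have "(\<lambda>t. (indicator {0..2*pi} t / (2*pi)) *\<^sub>R g (cis t)) = (\<lambda>t. (1/(2*pi)) *\<^sub>R (indicator {0..2*pi} t *\<^sub>R g (cis t)))"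
    by (simp add: fun_eq_iff)
  also have "integrable lborel \<dots> \<longleftrightarrow> set_integrable lborel {0..2*pi} (\<lambda>t. g (cis t))"
  proof
    assume A: "integrable lborel (\<lambda>t. (1/(2*pi)) *\<^sub>R (indicator {0..2*pi} t *\<^sub>R g (cis t)))"
    have "integrable lborel (\<lambda>t. (2*pi) *\<^sub>R ((1/(2*pi)) *\<^sub>R (indicator {0..2*pi} t *\<^sub>R g (cis t))))"
      by (rule integrable_scaleR_right) (rule A)
    then show "set_integrable lborel {0..2*pi} (\<lambda>t. g (cis t))" by (simp add: set_integrable_def)
  next
    assume A: "set_integrable lborel {0..2*pi} (\<lambda>t. g (cis t))"
    show "integrable lborel (\<lambda>t. (1/(2*pi)) *\<^sub>R (indicator {0..2*pi} t *\<^sub>R g (cis t)))"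
      using A unfolding set_integrable_def by (intro integrable_scaleR_right)
  qed
  finally show ?thesis .
qed

lemma integral_circle_m:
  fixes g :: "complex \<Rightarrow> 'b::{banach, second_countable_topology}"
  assumes [measurable]: "g \<in> borel_measurable circle_m"
  shows "integral\<^sup>L circle_m g = (1/(2*pi)) *\<^sub>R (LINT t:{0..2*pi}|lborel. g (cis t))"
proof -
  have "integral\<^sup>L circle_m g = integral\<^sup>L (density lborel (\<lambda>t::real. ennreal (indicator {0..2*pi} t / (2*pi)))) (\<lambda>t. g (cis t))"
    using assms unfolding circle_m_def by (intro integral_distr) auto
  also have "\<dots> = integral\<^sup>L lborel (\<lambda>t. (indicator {0..2*pi} t / (2*pi)) *\<^sub>R g (cis t))"
    by (intro integral_density) auto
  also have "(\<lambda>t. (indicator {0..2*pi} t / (2*pi)) *\<^sub>R g (cis t)) = (\<lambda>t. (1/(2*pi)) *\<^sub>R (indicator {0..2*pi} t *\<^sub>R g (cis t)))"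
    by (simp add: fun_eq_iff)
  finally show ?thesis unfolding set_lebesgue_integral_def by (simp only: integral_scaleR_right)
qed

lemma emeasure_circle_m_space: "emeasure circle_m (sphere 0 1) = 1"
proof -
  have "emeasure circle_m (space circle_m) = (\<integral>\<^sup>+\<zeta>. 1 \<partial>circle_m)" by (simp only: nn_integral_const mult_1)
  also have "\<dots> = (\<integral>\<^sup>+t. ennreal (indicator {0..2*pi} t / (2*pi)) * 1 \<partial>lborel)"
    by (intro nn_integral_circle_m) auto
  also have "\<dots> = (\<integral>\<^sup>+t. ennreal (1 / (2*pi)) * indicator {0..2*pi} t \<partial>lborel)"
    by (intro nn_integral_cong) (auto simp: indicator_def)
  also have "\<dots> = 1" by (simp add: nn_integral_cmult ennreal_mult[symmetric])
  finally show ?thesis by simp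
qed

interpretation circle_m: finite_measure circle_m
  by (rule finite_measureI) (simp add: emeasure_circle_m_space)

lemma borel_measurable_Arg2pi: "Arg2pi \<in> borel_measurable borel"
  by (subst borel_measurable_iff_greater) (simp add: open_Arg2pi2pi_gt borel_open)

text \<open>Null sets are transported by \<open>Arg2pi\<close>, a Borel inverse of
  \<open>cis\<close> on \<open>[0, 2 pi)\<close>. The angle 0 joins the exceptional set because the
  hypothesis concerns the open interval only.\<close>

lemma AE_circle_mI:
  assumes "AE t in lborel. 0 < t \<longrightarrow> t < 2 * pi \<longrightarrow> P (cis t)"
  shows "AE \<zeta> in circle_m. P \<zeta>"
proof -
  obtain N where N: "N \<in> null_sets lborel"
    "\<And>t. t \<in> space lborel - N \<Longrightarrow> 0 < t \<longrightarrow> t < 2 * pi \<longrightarrow> P (cis t)"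
    using AE_E3[OF assms] by blast
  define Z where "Z = {\<zeta> \<in> sphere 0 1. Arg2pi \<zeta> \<in> N \<union> {0}}"
  have [measurable]: "N \<in> sets borel" using N by auto
  have Zset: "Z \<in> sets circle_m"
  proof -
    have "Arg2pi -` (N \<union> {0}) \<in> sets borel"
      using measurable_sets[OF borel_measurable_Arg2pi, of "N \<union> {0}"] by simp
    moreover have "Z = Arg2pi -` (N \<union> {0}) \<inter> sphere 0 1" by (auto simp: Z_def)
    ultimately show ?thesis
      unfolding sets_circle_m by (auto simp: sets_restrict_space)
  qed
  have "emeasure circle_m Z = (\<integral>\<^sup>+\<zeta>. indicator Z \<zeta> \<partial>circle_m)" using Zset by simp
  also have "\<dots> = (\<integral>\<^sup>+t. ennreal (indicator {0..2*pi} t / (2*pi)) * indicator Z (cis t) \<partial>lborel)"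
    using Zset by (intro nn_integral_circle_m) auto
  also have "\<dots> = (\<integral>\<^sup>+t. 0 \<partial>(lborel :: real measure))"
  proof (rule nn_integral_cong_AE)
    show "AE t in lborel. ennreal (indicator {0..2*pi} t / (2*pi)) * indicator Z (cis t) = 0"
      using AE_not_in[OF N(1)] AE_lborel_singleton[of 0] AE_lborel_singleton[of "2*pi"]
    proof eventually_elim
      case (elim t)
      show ?case
      proof (cases "0 \<le> t \<and> t \<le> 2 * pi")
        case True
        then have "0 \<le> t" "t < 2 * pi" using elim by auto
        then have "Arg2pi (cis t) = t" by (intro Arg2pi_unique[of 1]) (auto simp: cis_conv_exp)
        then show ?thesis using elim by (simp add: Z_def)
      qed (auto simp: indicator_def)
    qed
  qed
  finally have "Z \<in> null_sets circle_m" using Zset by (simp add: null_sets_def)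
  moreover have "{\<zeta> \<in> space circle_m. \<not> P \<zeta>} \<subseteq> Z"
  proof
    fix \<zeta> assume "\<zeta> \<in> {\<zeta> \<in> space circle_m. \<not> P \<zeta>}"
    then have z: "cmod \<zeta> = 1" "\<not> P \<zeta>" by auto
    then have eq: "cis (Arg2pi \<zeta>) = \<zeta>" using complex_norm_eq_1_exp[of \<zeta>] by (simp add: cis_conv_exp)
    have "Arg2pi \<zeta> \<in> N \<union> {0}"
    proof (rule ccontr)
      assume "Arg2pi \<zeta> \<notin> N \<union> {0}"
      then have "Arg2pi \<zeta> \<notin> N" "0 < Arg2pi \<zeta>" "Arg2pi \<zeta> < 2 * pi"
        using Arg2pi_ge_0[of \<zeta>] Arg2pi_lt_2pi[of \<zeta>] by auto
      then have "P (cis (Arg2pi \<zeta>))" using N(2)[of "Arg2pi \<zeta>"] by auto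
      then show False using z eq by simp
    qed
    then show "\<zeta> \<in> Z" using z by (simp add: Z_def)
  qed
  ultimately show ?thesis by (rule AE_I')
qed

text \<open>On the circle \<open>dw = i w dt\<close>, which accounts for the factor
  \<open>\<zeta>\<close> in the numerator.\<close>

lemma Cauchy_circle_m:
  assumes hol: "F holomorphic_on ball 0 R" and R: "1 < R" and z: "cmod z < 1"
  shows "integral\<^sup>L circle_m (\<lambda>\<zeta>. F \<zeta> * (\<zeta> / (\<zeta> - z))) = F z"
proof -
  have "((\<lambda>w. F w / (w - z)) has_contour_integral 2 * of_real pi * \<i> * F z) (circlepath 0 1)"
    using z R by (intro Cauchy_integral_circlepath holomorphic_on_imp_continuous_on holomorphic_on_subset[OF hol]) auto
  then have "((\<lambda>t. F (cis t) / (cis t - z) * \<i> * cis t) has_integral 2 * of_real pi * \<i> * F z) {0..2*pi}"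
    unfolding circlepath_def by (subst (asm) has_contour_integral_part_circlepath_iff) auto
  then have *: "((\<lambda>t. (1 / \<i>) * (F (cis t) / (cis t - z) * \<i> * cis t)) has_integral (1 / \<i>) * (2 * of_real pi * \<i> * F z)) {0..2*pi}"
    by (rule has_integral_mult_right)
  have I: "((\<lambda>t. F (cis t) * (cis t / (cis t - z))) has_integral (2 * of_real pi * F z)) {0..2*pi}"
    by (rule has_integral_eq_rhs[OF has_integral_eq[OF _ *]]) (auto simp: divide_inverse mult_ac)
  have cont: "continuous_on (sphere 0 1) (\<lambda>\<zeta>. F \<zeta> * (\<zeta> / (\<zeta> - z)))"
    using z R by (intro continuous_intros holomorphic_on_imp_continuous_on holomorphic_on_subset[OF hol]) auto
  then have meas: "(\<lambda>\<zeta>. F \<zeta> * (\<zeta> / (\<zeta> - z))) \<in> borel_measurable circle_m"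
    unfolding measurable_cong_sets[OF sets_circle_m refl] by (rule borel_measurable_continuous_on_restrict)
  have "continuous_on {0..2*pi} (\<lambda>t. F (cis t) * (cis t / (cis t - z)))"
    by (rule continuous_on_compose2[OF cont]) (auto intro!: continuous_intros)
  then have "set_integrable lborel {0..2*pi} (\<lambda>t. F (cis t) * (cis t / (cis t - z)))"
    unfolding set_integrable_def by (intro borel_integrable_compact) auto
  then have "(LINT t:{0..2*pi}|lborel. F (cis t) * (cis t / (cis t - z))) = 2 * of_real pi * F z"
    using set_borel_integral_eq_integral(2) integral_unique[OF I] by metis
  then show ?thesis
    unfolding integral_circle_m[OF meas] by (simp add: scaleR_conv_of_real)
qed

text \<open>The first summand is the Cauchy kernel; the second is analytic in \<open>w\<close> on
  the closed disc and vanishes at 0. This reduces the Poisson formula to two applications of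
  Cauchy's.\<close>

lemma pkernel_on_circle:
  assumes z: "cmod z < 1" and w: "cmod w = 1"
  shows "complex_of_real (pkernel z w) = w / (w - z) + cnj z * w / (1 - cnj z * w)"
proof -
  have ww: "cnj w * w = 1" using complex_norm_square[of w] w by (simp add: mult.commute)
  have "w \<noteq> z" using z w by auto
  have nz: "1 - cnj z * w \<noteq> 0" using norm_one_minus_cnj_mult_pos[of w z] z w
    by (metis complex_cnj_cnj complex_cnj_diff complex_cnj_mult complex_cnj_one complex_cnj_zero_iff less_irrefl mult.commute norm_zero order_refl)
  have "complex_of_real (pkernel z w) = of_real (1 - (cmod z)\<^sup>2) / of_real ((cmod (1 - cnj w * z))\<^sup>2)"
    by (simp add: pkernel_def)
  also have "of_real ((cmod (1 - cnj w * z))\<^sup>2) = (1 - cnj w * z) * (1 - w * cnj z)"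
    unfolding complex_norm_square by simp
  also have "1 - cnj w * z = cnj w * (w - z)" using ww by (simp add: algebra_simps)
  also have "complex_of_real (1 - (cmod z)\<^sup>2) = 1 - z * cnj z"
    unfolding of_real_diff complex_norm_square by simp
  also have "(1 - z * cnj z) / (cnj w * (w - z) * (1 - w * cnj z)) = w / (w - z) + cnj z * w / (1 - cnj z * w)"
  proof -
    have "cnj w * (w / (w - z) + cnj z * w / (1 - cnj z * w)) = 1 / (w - z) + cnj z / (1 - cnj z * w)"
      using ww by (simp add: distrib_left mult.left_commute)
    also have "\<dots> = (1 - z * cnj z) / ((w - z) * (1 - cnj z * w))"
      using nz \<open>w \<noteq> z\<close> by (simp add: field_simps)
    finally have "w / (w - z) + cnj z * w / (1 - cnj z * w) = ((1 - z * cnj z) / ((w - z) * (1 - cnj z * w))) / cnj w"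
      using w by (metis complex_cnj_zero_iff nonzero_mult_div_cancel_left norm_zero zero_neq_one)
    then show ?thesis by (simp add: mult_ac)
  qed
  finally show ?thesis .
qed

lemma continuous_on_circle_integrable:
  fixes F :: "complex \<Rightarrow> complex"
  assumes "continuous_on (sphere 0 1) F"
  shows "integrable circle_m F"
proof -
  have m: "F \<in> borel_measurable circle_m"
    unfolding measurable_cong_sets[OF sets_circle_m refl] by (rule borel_measurable_continuous_on_restrict[OF assms])
  have "continuous_on {0..2*pi} (\<lambda>t. F (cis t))"
    by (rule continuous_on_compose2[OF assms]) (auto intro!: continuous_intros)
  then show ?thesis
    unfolding integrable_circle_m_iff[OF m] set_integrable_def by (intro borel_integrable_compact) auto
qed

lemma Poisson_formula:
  assumes hol: "F holomorphic_on ball 0 R" and R: "1 < R" and z: "cmod z < 1"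
  shows "integral\<^sup>L circle_m (\<lambda>\<zeta>. of_real (pkernel z \<zeta>) * F \<zeta>) = F z"
proof -
  \<comment> \<open>For \<open>cmod w < 2 / (1 + cmod z)\<close> the product
    \<open>cmod z * cmod w\<close> is below 1, so the pole of the second summand is avoided while
    \<open>R'\<close> still exceeds 1.\<close>
  define R' where "R' = min R (2 / (1 + cmod z))"
  have R': "1 < R'" "R' \<le> R" using R z by (auto simp: R'_def add_pos_nonneg)
  have nz: "1 - cnj z * w \<noteq> 0" if "cmod w < R'" for w
  proof
    assume "1 - cnj z * w = 0"
    then have "cmod z * cmod w = 1" by (metis complex_mod_cnj eq_iff_diff_eq_0 norm_mult norm_one)
    moreover have "cmod z * cmod w \<le> cmod z * (2 / (1 + cmod z))"
      using that by (intro mult_left_mono) (auto simp: R'_def)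
    moreover have "cmod z * (2 / (1 + cmod z)) < 1" using z by (simp add: field_simps add_pos_nonneg)
    ultimately show False by simp
  qed
  define F2 where "F2 \<zeta> = F \<zeta> * (cnj z * \<zeta> / (1 - cnj z * \<zeta>))" for \<zeta>
  have hol2: "F2 holomorphic_on ball 0 R'"
    unfolding F2_def using nz R' by (intro holomorphic_intros holomorphic_on_subset[OF hol]) auto
  have c1: "continuous_on (sphere 0 1) (\<lambda>\<zeta>. F \<zeta> * (\<zeta> / (\<zeta> - z)))"
    using z R by (intro continuous_intros holomorphic_on_imp_continuous_on holomorphic_on_subset[OF hol]) auto
  have c2: "continuous_on (sphere 0 1) (\<lambda>\<zeta>. F2 \<zeta> * (\<zeta> / (\<zeta> - 0)))"
    using R' by (intro continuous_intros holomorphic_on_imp_continuous_on holomorphic_on_subset[OF hol2]) auto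
  have "integral\<^sup>L circle_m (\<lambda>\<zeta>. of_real (pkernel z \<zeta>) * F \<zeta>)
      = integral\<^sup>L circle_m (\<lambda>\<zeta>. F \<zeta> * (\<zeta> / (\<zeta> - z)) + F2 \<zeta> * (\<zeta> / (\<zeta> - 0)))"
    by (intro Bochner_Integration.integral_cong refl)
      (auto simp: pkernel_on_circle[OF z] F2_def algebra_simps)
  also have "\<dots> = F z + F2 0"
    unfolding Bochner_Integration.integral_add[OF continuous_on_circle_integrable[OF c1] continuous_on_circle_integrable[OF c2]]
    using Cauchy_circle_m[OF hol R z] Cauchy_circle_m[OF hol2 R'(1), of 0] by simp
  finally show ?thesis by (simp add: F2_def)
qed

lemma pkernel_integral:
  assumes z: "cmod z < 1"
  shows "integrable circle_m (pkernel z)" "integral\<^sup>L circle_m (pkernel z) = 1"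
proof -
  show "integrable circle_m (pkernel z)"
  proof (rule circle_m.integrable_const_bound)
    show "AE w in circle_m. norm (pkernel z w) \<le> 2 / (1 - cmod z)"
      using pkernel_le[OF z] pkernel_nonneg[of z] z by (intro AE_I2) auto
    show "pkernel z \<in> borel_measurable circle_m"
      by (intro borel_measurable_circle_mI) measurable
  qed
  have "integral\<^sup>L circle_m (\<lambda>\<zeta>. of_real (pkernel z \<zeta>) * (1::complex)) = 1"
    by (rule Poisson_formula[of _ 2]) (use z in auto)
  then show "integral\<^sup>L circle_m (pkernel z) = 1"
    by (simp add: of_real_eq_1_iff)
qed

section \<open>Radial limits of Poisson integrals\<close>

text \<open>Integration by parts against the primitive of \<open>H\<close>. As \<open>H\<close> is
  merely integrable, it is done by Fubini after writing \<open>p s\<close> as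
  \<open>p \<eta>\<close> plus the integral of \<open>- p'\<close> over
  \<open>[s, \<eta>]\<close>.\<close>

lemma layer_cake_integral:
  fixes H :: "real \<Rightarrow> 'b::{banach, second_countable_topology}" and p p' :: "real \<Rightarrow> real"
  assumes \<eta>: "0 \<le> \<eta>" and H: "set_integrable lborel {0..\<eta>} H"
    and p: "\<And>x. 0 \<le> x \<Longrightarrow> x \<le> \<eta> \<Longrightarrow> (p has_real_derivative p' x) (at x)"
    and p': "continuous_on {0..\<eta>} p'"
  shows "(LINT s:{0..\<eta>}|lborel. p s *\<^sub>R H s) = p \<eta> *\<^sub>R (LINT s:{0..\<eta>}|lborel. H s)
       + (LINT x:{0..\<eta>}|lborel. (- p' x) *\<^sub>R (LINT s:{0..x}|lborel. H s))"
proof -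
  define q where "q x = indicator {0..\<eta>} x *\<^sub>R (- p' x)" for x
  define H' where "H' s = indicator {0..\<eta>} s *\<^sub>R H s" for s
  have H'int: "integrable lborel H'" using H by (simp add: set_integrable_def H'_def[abs_def])
  then have [measurable]: "H' \<in> borel_measurable borel" by auto
  have qint: "integrable lborel q"
    unfolding q_def[abs_def] using p' by (intro borel_integrable_compact continuous_intros) auto
  then have [measurable]: "q \<in> borel_measurable borel" by auto
  define k where "k x s = q x *\<^sub>R (indicator {..x} s *\<^sub>R H' s)" for x s
  have kint: "integrable (lborel \<Otimes>\<^sub>M lborel) (case_prod k)"
  proof (rule lborel_pair.Fubini_integrable)
    show km: "case_prod k \<in> borel_measurable (lborel \<Otimes>\<^sub>M lborel)"
    proof -
      have "(\<lambda>z. q (fst z) *\<^sub>R (indicator {z. snd z \<le> fst z} z *\<^sub>R H' (snd z)))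
          \<in> borel_measurable (lborel \<Otimes>\<^sub>M lborel)"
        by measurable
      moreover have "case_prod k = (\<lambda>z. q (fst z) *\<^sub>R (indicator {z. snd z \<le> fst z} z *\<^sub>R H' (snd z)))"
        by (auto simp: k_def fun_eq_iff indicator_def)
      ultimately show ?thesis by simp
    qed
    show "AE x in lborel. integrable lborel (\<lambda>s. case_prod k (x, s))"
    proof (intro AE_I2)
      fix x
      have "integrable lborel (\<lambda>s. indicator {..x} s *\<^sub>R H' s)"
        by (rule integrable_mult_indicator[OF _ H'int]) simp
      then show "integrable lborel (\<lambda>s. case_prod k (x, s))"
        unfolding case_prod_conv k_def by (intro integrable_scaleR_right)
    qed
    show "integrable lborel (\<lambda>x. LINT s|lborel. norm (case_prod k (x, s)))"
    proof (rule Bochner_Integration.integrable_bound)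
      show "integrable lborel (\<lambda>x. q x * (LINT s|lborel. norm (H' s)))"
        using qint by auto
      show "(\<lambda>x. LINT s|lborel. norm (case_prod k (x, s))) \<in> borel_measurable lborel"
        using km by measurable
      show "AE x in lborel. norm (LINT s|lborel. norm (case_prod k (x, s))) \<le> norm (q x * (LINT s|lborel. norm (H' s)))"
      proof (intro AE_I2)
        fix x
        have "(LINT s|lborel. norm (case_prod k (x, s))) \<le> (LINT s|lborel. \<bar>q x\<bar> * norm (H' s))"
        proof (rule integral_mono)
          have "integrable lborel (\<lambda>s. indicator {..x} s *\<^sub>R H' s)"
            by (rule integrable_mult_indicator[OF _ H'int]) simp
          then show "integrable lborel (\<lambda>s. norm (case_prod k (x, s)))"
            unfolding case_prod_conv k_def by (intro integrable_norm integrable_scaleR_right)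
          show "integrable lborel (\<lambda>s. \<bar>q x\<bar> * norm (H' s))" using H'int by auto
          show "norm (case_prod k (x, s)) \<le> \<bar>q x\<bar> * norm (H' s)" for s
            by (auto simp: k_def indicator_def)
        qed
        then show "norm (LINT s|lborel. norm (case_prod k (x, s))) \<le> norm (q x * (LINT s|lborel. norm (H' s)))"
          by (simp add: abs_mult)
      qed
    qed
  qed
  have in1: "(LINT s|lborel. k x s) = indicator {0..\<eta>} x *\<^sub>R ((- p' x) *\<^sub>R (LINT s:{0..x}|lborel. H s))" for x
  proof (cases "x \<in> {0..\<eta>}")
    case True
    have "(LINT s|lborel. k x s) = q x *\<^sub>R (LINT s|lborel. indicator {..x} s *\<^sub>R H' s)"
      unfolding k_def by (rule integral_scaleR_right)
    also have "(\<lambda>s. indicator {..x} s *\<^sub>R H' s) = (\<lambda>s. indicator {0..x} s *\<^sub>R H s)"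
      using True by (auto simp: H'_def indicator_def fun_eq_iff)
    finally show ?thesis using True by (simp add: q_def set_lebesgue_integral_def)
  qed (simp add: k_def q_def)
  have in2: "(LINT x|lborel. k x s) = (p s - p \<eta>) *\<^sub>R H' s" for s
  proof (cases "s \<in> {0..\<eta>}")
    case True
    have "(LINT x|lborel. k x s) = (LINT x|lborel. (indicator {s..\<eta>} x *\<^sub>R (- p' x)) *\<^sub>R H' s)"
      unfolding k_def q_def using True by (intro Bochner_Integration.integral_cong refl) (auto simp: indicator_def)
    also have "\<dots> = (LINT x|lborel. indicator {s..\<eta>} x *\<^sub>R (- p' x)) *\<^sub>R H' s"
    proof -
      have "integrable lborel (\<lambda>x. indicator {s..\<eta>} x *\<^sub>R (- p' x))"
        using True by (intro borel_integrable_compact continuous_intros continuous_on_subset[OF p']) auto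
      then show ?thesis by (intro integral_scaleR_left) auto
    qed
    also have "(LINT x|lborel. indicator {s..\<eta>} x *\<^sub>R (- p' x)) = (- p \<eta>) - (- p s)"
    proof (rule integral_FTC_Icc)
      show "s \<le> \<eta>" using True by simp
      show "((\<lambda>x. - p x) has_vector_derivative - p' x) (at x within {s..\<eta>})" if "s \<le> x" "x \<le> \<eta>" for x
      proof -
        have "((\<lambda>x. - p x) has_real_derivative - p' x) (at x)"
          using that True by (intro DERIV_minus p) auto
        then show ?thesis
          by (simp add: has_real_derivative_iff_has_vector_derivative has_vector_derivative_at_within)
      qed
      show "continuous_on {s..\<eta>} (\<lambda>x. - p' x)"
        using True by (intro continuous_intros continuous_on_subset[OF p']) auto
    qed
    finally show ?thesis by simp
  qed (simp add: k_def H'_def)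
  have pH: "integrable lborel (\<lambda>s. (p s - p \<eta>) *\<^sub>R H' s)"
    using lborel_pair.integrable_snd[OF kint] by (simp add: in2)
  have "(LINT s:{0..\<eta>}|lborel. p s *\<^sub>R H s) = (LINT s|lborel. p \<eta> *\<^sub>R H' s + (p s - p \<eta>) *\<^sub>R H' s)"
    unfolding set_lebesgue_integral_def by (intro Bochner_Integration.integral_cong refl) (auto simp: H'_def algebra_simps indicator_def)
  also have "\<dots> = p \<eta> *\<^sub>R (LINT s|lborel. H' s) + (LINT s|lborel. (p s - p \<eta>) *\<^sub>R H' s)"
    using H'int pH by (subst Bochner_Integration.integral_add) auto
  also have "(LINT s|lborel. (p s - p \<eta>) *\<^sub>R H' s) = (LINT x|lborel. (LINT s|lborel. k x s))"
    using lborel_pair.Fubini_integral[OF kint] by (simp add: in2)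
  finally show ?thesis by (simp add: in1 set_lebesgue_integral_def H'_def[abs_def])
qed

text \<open>Integrability of \<open>f\<close> need not be checked: otherwise its Bochner integral is
  0 by convention, and the dominating integral is nonnegative.\<close>

lemma norm_integral_le:
  fixes f :: "'a \<Rightarrow> 'b::{banach, second_countable_topology}"
  assumes g: "integrable M g" and fg: "\<And>x. x \<in> space M \<Longrightarrow> norm (f x) \<le> g x"
  shows "norm (integral\<^sup>L M f) \<le> integral\<^sup>L M g"
proof (cases "integrable M f")
  case True
  have "norm (integral\<^sup>L M f) \<le> integral\<^sup>L M (\<lambda>x. norm (f x))" by (rule integral_norm_bound)
  also have "\<dots> \<le> integral\<^sup>L M g" using True g fg by (intro integral_mono) auto
  finally show ?thesis .
next
  case False
  have "0 \<le> integral\<^sup>L M g"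
    using fg by (intro Bochner_Integration.integral_nonneg_AE AE_I2) (meson norm_ge_zero order_trans)
  then show ?thesis using False by (simp add: not_integrable_integral_eq)
qed

text \<open>A nonincreasing kernel is a positive mixture of indicators of \<open>[0, x]\<close>, so
  bounds \<open>e * x\<close> on the integrals of \<open>H\<close> over these intervals add up.
  Applying the same formula to the constant 1 identifies the resulting weight as the integral of
  \<open>p\<close>.\<close>

lemma decreasing_kernel_bound:
  fixes H :: "real \<Rightarrow> complex" and p p' :: "real \<Rightarrow> real"
  assumes \<eta>: "0 \<le> \<eta>" and H: "set_integrable lborel {0..\<eta>} H"
    and p: "\<And>x. 0 \<le> x \<Longrightarrow> x \<le> \<eta> \<Longrightarrow> (p has_real_derivative p' x) (at x)"
    and p': "continuous_on {0..\<eta>} p'"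
    and dec: "\<And>x. 0 \<le> x \<Longrightarrow> x \<le> \<eta> \<Longrightarrow> p' x \<le> 0" and pos: "0 \<le> p \<eta>"
    and bound: "\<And>x. 0 \<le> x \<Longrightarrow> x \<le> \<eta> \<Longrightarrow> cmod (LINT s:{0..x}|lborel. H s) \<le> e * x"
  shows "cmod (LINT s:{0..\<eta>}|lborel. p s *\<^sub>R H s) \<le> e * (LINT s:{0..\<eta>}|lborel. p s)"
proof -
  have len: "(LINT s:{0..x}|lborel. 1::real) = x" if "0 \<le> x" for x
    using that by (simp add: set_lebesgue_integral_def)
  have "(LINT s:{0..\<eta>}|lborel. p s *\<^sub>R (1::real)) = p \<eta> *\<^sub>R (LINT s:{0..\<eta>}|lborel. 1)
       + (LINT x:{0..\<eta>}|lborel. (- p' x) *\<^sub>R (LINT s:{0..x}|lborel. 1))"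
  proof (rule layer_cake_integral[OF \<eta> _ p p'])
    show "set_integrable lborel {0..\<eta>} (\<lambda>s. 1::real)"
      unfolding set_integrable_def by (intro borel_integrable_compact) auto
  qed
  also have "(LINT x:{0..\<eta>}|lborel. (- p' x) *\<^sub>R (LINT s:{0..x}|lborel. 1::real)) = (LINT x:{0..\<eta>}|lborel. (- p' x) * x)"
    by (intro set_lebesgue_integral_cong) (auto simp: len)
  finally have one: "(LINT s:{0..\<eta>}|lborel. p s) = p \<eta> * \<eta> + (LINT x:{0..\<eta>}|lborel. (- p' x) * x)"
    using \<eta> by (simp add: len)
  have "cmod (LINT x:{0..\<eta>}|lborel. (- p' x) *\<^sub>R (LINT s:{0..x}|lborel. H s)) \<le> (LINT x:{0..\<eta>}|lborel. e * ((- p' x) * x))"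
    unfolding set_lebesgue_integral_def
  proof (rule norm_integral_le)
    have "continuous_on {0..\<eta>} (\<lambda>x. e * ((- p' x) * x))" by (intro continuous_intros p')
    then show "integrable lborel (\<lambda>x. indicat_real {0..\<eta>} x *\<^sub>R (e * (- p' x * x)))"
      by (intro borel_integrable_compact) auto
    fix x
    show "cmod (indicat_real {0..\<eta>} x *\<^sub>R - p' x *\<^sub>R (LINT s|lborel. indicat_real {0..x} s *\<^sub>R H s))
         \<le> indicat_real {0..\<eta>} x *\<^sub>R (e * (- p' x * x))"
    proof (cases "x \<in> {0..\<eta>}")
      case True
      have "\<bar>p' x\<bar> * cmod (LINT s:{0..x}|lborel. H s) \<le> \<bar>p' x\<bar> * (e * x)"
        using True bound by (intro mult_left_mono) auto
      then show ?thesis using True dec[of x] by (simp add: set_lebesgue_integral_def mult_ac)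
    qed simp
  qed
  moreover have "cmod (p \<eta> *\<^sub>R (LINT s:{0..\<eta>}|lborel. H s)) \<le> p \<eta> * (e * \<eta>)"
    using bound[of \<eta>] \<eta> pos by (simp add: mult_left_mono)
  ultimately have "cmod (LINT s:{0..\<eta>}|lborel. p s *\<^sub>R H s) \<le> p \<eta> * (e * \<eta>) + (LINT x:{0..\<eta>}|lborel. e * ((- p' x) * x))"
    by (subst layer_cake_integral[OF \<eta> H p p']) (auto intro!: norm_triangle_mono)
  also have "(LINT x:{0..\<eta>}|lborel. e * ((- p' x) * x)) = e * (LINT x:{0..\<eta>}|lborel. (- p' x) * x)"
    by (rule set_integral_mult_right)
  finally show ?thesis unfolding one by (simp add: algebra_simps)
qed

section \<open>The Poisson kernel as an approximate identity\<close>

lemma pkernel_polar: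
  "pkernel (of_real r * cis a) (cis b) = (1 - r\<^sup>2) / (1 - 2 * r * cos (b - a) + r\<^sup>2)"
proof -
  have e1: "1 - cnj (cis b) * (of_real r * cis a) = 1 - of_real r * cis (a - b)"
    by (simp add: cis_cnj cis_mult mult.left_commute)
  have "(cmod (1 - of_real r * cis (a - b)))\<^sup>2 = (1 - r * cos (a - b))\<^sup>2 + (r * sin (a - b))\<^sup>2"
    by (simp add: cmod_power2)
  moreover have "(1 - r * c)\<^sup>2 + (r * s)\<^sup>2 = 1 - 2 * r * c + r\<^sup>2 * (s\<^sup>2 + c\<^sup>2)" for c s :: real
    by (simp add: power2_eq_square algebra_simps)
  ultimately have "(cmod (1 - cnj (cis b) * (of_real r * cis a)))\<^sup>2 = 1 - 2 * r * cos (a - b) + r\<^sup>2"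
    unfolding e1 by simp
  then show ?thesis
    using cos_minus[of "a - b"] by (simp add: pkernel_def norm_mult)
qed

text \<open>Lebesgue differentiation for right-hand averages. Only the signed average is controlled,
  not that of \<open>|K (t + s) - K t|\<close>; for a monotone kernel this is enough.\<close>

lemma right_average_AE:
  fixes K :: "real \<Rightarrow> complex"
  assumes K: "integrable lborel K"
  obtains N where "negligible N"
    "\<And>t e. t \<notin> N \<Longrightarrow> 0 < e \<Longrightarrow> \<exists>d>0. \<forall>x. 0 \<le> x \<and> x < d \<longrightarrow> cmod (LINT s:{0..x}|lborel. (K (t + s) - K t)) \<le> e * x"
proof -
  have [measurable]: "K \<in> borel_measurable borel" using K by auto
  have "K integrable_on cbox a b" for a b
    using integrable_on_subcbox[OF integrable_on_lborel[OF K], of a b] by simp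
  then obtain N where N: "negligible N" "\<And>x e. \<lbrakk>x \<notin> N; 0 < e\<rbrakk> \<Longrightarrow>
               \<exists>d>0. \<forall>h. 0 < h \<and> h < d \<longrightarrow>
                         norm(integral (cbox x (x + h *\<^sub>R One)) K /\<^sub>R h ^ DIM(real) - K x) < e"
    using integrable_ccontinuous_explicit by blast
  show ?thesis
  proof (rule that[OF N(1)])
    fix t e :: real assume "t \<notin> N" "0 < e"
    then obtain d where d: "0 < d" "\<And>h. 0 < h \<Longrightarrow> h < d \<Longrightarrow> norm (integral {t..t+h} K /\<^sub>R h - K t) < e"
      using N(2)[of t e] by auto
    have "cmod (LINT s:{0..x}|lborel. (K (t + s) - K t)) \<le> e * x" if x: "0 \<le> x" "x < d" for x
    proof (cases "x = 0")
      case True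
      have "(LINT s:{0..x}|lborel. (K (t + s) - K t)) = (LINT s|(lborel::real measure). 0)"
        unfolding set_lebesgue_integral_def
      proof (rule integral_cong_AE)
        show "AE s in lborel. indicat_real {0..x} s *\<^sub>R (K (t + s) - K t) = 0"
          using AE_lborel_singleton[of 0] by eventually_elim (auto simp: True)
      qed auto
      then show ?thesis using True by simp
    next
      case False
      have sh: "integrable lborel (\<lambda>s. K (t + 1 * s))" using K by (intro lborel_integrable_real_affine) auto
      have si: "set_integrable lborel S K" "set_integrable lborel S (\<lambda>s. K (t + s))" if "S \<in> sets borel" for S
        unfolding set_integrable_def using K sh that by (auto intro!: integrable_mult_indicator)
      have const: "set_integrable lborel {0..x} (\<lambda>s. K t)"
        unfolding set_integrable_def by (intro borel_integrable_compact) auto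
      have "(LINT s:{0..x}|lborel. (K (t + s) - K t)) = (LINT s:{0..x}|lborel. K (t + s)) - (LINT s:{0..x}|lborel. K t)"
        using si const by (intro set_integral_diff) auto
      also have "(LINT s:{0..x}|lborel. K (t + s)) = (LINT s:{t..t+x}|lborel. K s)"
      proof -
        have "(LINT s:{t..t+x}|lborel. K s) = \<bar>1\<bar> *\<^sub>R (LINT s|lborel. indicat_real {t..t+x} (t + 1 * s) *\<^sub>R K (t + 1 * s))"
          unfolding set_lebesgue_integral_def by (rule lborel_integral_real_affine) simp
        also have "(\<lambda>s. indicat_real {t..t+x} (t + 1 * s) *\<^sub>R K (t + 1 * s)) = (\<lambda>s. indicat_real {0..x} s *\<^sub>R K (t + s))"
          by (auto simp: fun_eq_iff indicator_def)
        finally show ?thesis by (simp add: set_lebesgue_integral_def)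
      qed
      also have "\<dots> = integral {t..t+x} K" using si by (intro set_borel_integral_eq_integral) auto
      also have "(LINT s:{0..x}|lborel. K t) = x *\<^sub>R K t"
        using x by (simp add: set_lebesgue_integral_def)
      finally have eq: "(LINT s:{0..x}|lborel. (K (t + s) - K t)) = x *\<^sub>R (integral {t..t+x} K /\<^sub>R x - K t)"
        using False by (simp add: scaleR_diff_right)
      show ?thesis
        unfolding eq using d(2)[of x] x False by (simp add: mult.commute[of e] mult_left_mono less_imp_le)
    qed
    then show "\<exists>d>0. \<forall>x. 0 \<le> x \<and> x < d \<longrightarrow> cmod (LINT s:{0..x}|lborel. (K (t + s) - K t)) \<le> e * x"
      using d(1) by blast
  qed
qed

lemma poisson_denominator_pos:
  fixes r s :: real
  assumes "0 \<le> r" "r < 1"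
  shows "0 < 1 - 2 * r * cos s + r\<^sup>2"
proof -
  have "r * cos s \<le> r * 1" using assms by (intro mult_left_mono) auto
  moreover have "0 < (1 - r)\<^sup>2" using assms by simp
  ultimately show ?thesis by (simp add: power2_eq_square algebra_simps)
qed

lemma poisson_kernel_nonneg:
  fixes r s :: real
  assumes "0 \<le> r" "r < 1"
  shows "0 \<le> (1 - r\<^sup>2) / (1 - 2 * r * cos s + r\<^sup>2)"
  using poisson_denominator_pos[OF assms, of s] assms by (auto intro!: divide_nonneg_pos simp: power_le_one)

lemma poisson_kernel_integral_le:
  fixes r \<eta> :: real
  assumes r: "0 \<le> r" "r < 1" and \<eta>: "0 \<le> \<eta>" "\<eta> \<le> 2 * pi"
  shows "(LINT s:{0..\<eta>}|lborel. (1 - r\<^sup>2) / (1 - 2 * r * cos s + r\<^sup>2)) \<le> 2 * pi"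
proof -
  let ?p = "\<lambda>s. (1 - r\<^sup>2) / (1 - 2 * r * cos s + r\<^sup>2)"
  have int: "set_integrable lborel {0..x} ?p" for x
    unfolding set_integrable_def
    using poisson_denominator_pos[OF r] by (intro borel_integrable_compact continuous_intros) (auto simp: less_imp_neq[symmetric])
  have "pkernel (of_real r) \<in> borel_measurable circle_m" by (intro borel_measurable_circle_mI) measurable
  from integral_circle_m[OF this] have "1 = (1/(2*pi)) *\<^sub>R (LINT t:{0..2*pi}|lborel. pkernel (of_real r) (cis t))"
    using pkernel_integral(2)[of "of_real r"] r by simp
  moreover have "pkernel (of_real r) (cis t) = ?p t" for t
    using pkernel_polar[of r 0 t] by simp
  ultimately have "2 * pi = (LINT t:{0..2*pi}|lborel. ?p t)" by (simp add: field_simps)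
  moreover have "(LINT s:{0..\<eta>}|lborel. ?p s) \<le> (LINT s:{0..2*pi}|lborel. ?p s)"
    unfolding set_lebesgue_integral_def
  proof (rule integral_mono)
    fix s
    show "indicat_real {0..\<eta>} s *\<^sub>R ?p s \<le> indicat_real {0..2*pi} s *\<^sub>R ?p s"
      using \<eta> poisson_kernel_nonneg[OF r, of s] by (auto simp: indicator_def)
  qed (use int in \<open>auto simp: set_integrable_def\<close>)
  ultimately show ?thesis by simp
qed

lemma poisson_near_bound:
  fixes H :: "real \<Rightarrow> complex"
  assumes r: "0 \<le> r" "r < 1" and \<eta>: "0 \<le> \<eta>" "\<eta> \<le> pi" and H: "set_integrable lborel {0..\<eta>} H"
    and e: "0 \<le> e" and bound: "\<And>x. 0 \<le> x \<Longrightarrow> x \<le> \<eta> \<Longrightarrow> cmod (LINT s:{0..x}|lborel. H s) \<le> e * x"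
  shows "cmod (LINT s:{0..\<eta>}|lborel. ((1 - r\<^sup>2) / (1 - 2 * r * cos s + r\<^sup>2)) *\<^sub>R H s) \<le> e * (2 * pi)"
proof -
  let ?p = "\<lambda>s. (1 - r\<^sup>2) / (1 - 2 * r * cos s + r\<^sup>2)"
  let ?p' = "\<lambda>s. - ((1 - r\<^sup>2) * (2 * r * sin s)) / (1 - 2 * r * cos s + r\<^sup>2)\<^sup>2"
  have pos: "0 < 1 - 2 * r * cos s + r\<^sup>2" for s by (rule poisson_denominator_pos[OF r])
  have "cmod (LINT s:{0..\<eta>}|lborel. ?p s *\<^sub>R H s) \<le> e * (LINT s:{0..\<eta>}|lborel. ?p s)"
  proof (rule decreasing_kernel_bound[OF \<eta>(1) H _ _ _ _ bound])
    show "(?p has_real_derivative ?p' x) (at x)" for x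
      using pos[of x] by (auto intro!: derivative_eq_intros simp: power2_eq_square)
    show "continuous_on {0..\<eta>} ?p'"
      using pos by (intro continuous_intros) (auto simp: less_imp_neq[symmetric])
    show "?p' x \<le> 0" if "0 \<le> x" "x \<le> \<eta>" for x
    proof -
      have "0 \<le> (1 - r\<^sup>2) * (2 * r * sin x)"
        using r that \<eta> by (intro mult_nonneg_nonneg sin_ge_zero) (auto simp: power_le_one)
      then show ?thesis by (simp add: divide_nonpos_nonneg)
    qed
    show "0 \<le> ?p \<eta>" by (rule poisson_kernel_nonneg[OF r])
  qed
  also have "\<dots> \<le> e * (2 * pi)"
    using e r \<eta> by (intro mult_left_mono poisson_kernel_integral_le) auto
  finally show ?thesis .
qed

text \<open>On \<open>[\<eta>, 2 pi - \<eta>]\<close> the function \<open>sin (x/2)\<close> is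
  smallest at the ends, and \<open>\<bar>sin (s/2)\<bar>\<close> bounds
  \<open>cmod (1 - r cis s)\<close> from below for every \<open>r\<close>.\<close>

lemma poisson_far_bound:
  assumes r: "0 \<le> r" "r < 1" and \<eta>: "0 < \<eta>" "\<eta> \<le> pi" and s: "\<eta> \<le> \<bar>s\<bar>" "\<bar>s\<bar> \<le> 2 * pi - \<eta>"
  shows "(1 - r\<^sup>2) / (1 - 2 * r * cos s + r\<^sup>2) \<le> (1 - r\<^sup>2) / (sin (\<eta>/2))\<^sup>2"
proof -
  have si: "0 < sin (\<eta>/2)" using \<eta> by (intro sin_gt_zero) auto
  have "sin (\<eta>/2) \<le> sin (\<bar>s\<bar>/2)"
  proof (cases "\<bar>s\<bar> \<le> pi")
    case True
    then show ?thesis using s \<eta> by (intro sin_monotone_2pi_le) auto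
  next
    case False
    have "sin (\<eta>/2) \<le> sin (pi - \<bar>s\<bar>/2)" using s \<eta> False by (intro sin_monotone_2pi_le) auto
    then show ?thesis by simp
  qed
  also have "sin (\<bar>s\<bar>/2) \<le> \<bar>sin (s/2)\<bar>" by (cases "0 \<le> s") auto
  also have "\<bar>sin (s/2)\<bar> \<le> cmod (1 - of_real r * cis s)"
    using norm_one_minus_scaled_cis[of r s] r by (simp add: norm_one_minus_cis)
  finally have "(sin (\<eta>/2))\<^sup>2 \<le> (cmod (1 - of_real r * cis s))\<^sup>2"
    using si by (intro power_mono) auto
  also have "\<dots> = 1 - 2 * r * cos s + r\<^sup>2"
  proof -
    have "(cmod (1 - of_real r * cis s))\<^sup>2 = (1 - r * cos s)\<^sup>2 + (r * sin s)\<^sup>2"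
      by (simp add: cmod_power2)
    moreover have "(1 - r * c)\<^sup>2 + (r * d)\<^sup>2 = 1 - 2 * r * c + r\<^sup>2 * (d\<^sup>2 + c\<^sup>2)" for c d :: real
      by (simp add: power2_eq_square algebra_simps)
    ultimately show ?thesis by simp
  qed
  finally show ?thesis
    using si r by (intro divide_left_mono mult_pos_pos poisson_denominator_pos) (auto simp: power_le_one)
qed

text \<open>The kernel decreases on either side of \<open>t0\<close>, so the one-sided averages
  control the near part for all \<open>r\<close> at once; on the rest of the circle the kernel tends
  to 0 uniformly.\<close>

lemma poisson_point_limit:
  fixes G :: "real \<Rightarrow> complex"
  assumes G: "set_integrable lborel {0..2*pi} G" and Gm [measurable]: "G \<in> borel_measurable borel"
    and t0: "0 < t0" "t0 < 2 * pi"
    and right: "\<And>e. 0 < e \<Longrightarrow> \<exists>d>0. \<forall>x. 0 \<le> x \<and> x < d \<longrightarrow> cmod (LINT s:{0..x}|lborel. (G (t0 + s) - G t0)) \<le> e * x"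
    and left: "\<And>e. 0 < e \<Longrightarrow> \<exists>d>0. \<forall>x. 0 \<le> x \<and> x < d \<longrightarrow> cmod (LINT s:{0..x}|lborel. (G (t0 - s) - G t0)) \<le> e * x"
  shows "((\<lambda>r. (LINT t:{0..2*pi}|lborel. ((1 - r\<^sup>2) / (1 - 2 * r * cos (t - t0) + r\<^sup>2)) *\<^sub>R (G t - G t0))) \<longlongrightarrow> 0) (at_left 1)"
proof (rule tendstoI)
  fix e :: real assume e: "0 < e"
  \<comment> \<open>The two near pieces cost \<open>2 * pi * e'\<close> each, together
    \<open>e / 2\<close>.\<close>
  define e' where "e' = e / (8 * pi)"
  have e': "0 < e'" using e by (simp add: e'_def)
  obtain d1 where d1: "0 < d1" "\<And>x. 0 \<le> x \<Longrightarrow> x < d1 \<Longrightarrow> cmod (LINT s:{0..x}|lborel. (G (t0 + s) - G t0)) \<le> e' * x"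
    using right[OF e'] by blast
  obtain d2 where d2: "0 < d2" "\<And>x. 0 \<le> x \<Longrightarrow> x < d2 \<Longrightarrow> cmod (LINT s:{0..x}|lborel. (G (t0 - s) - G t0)) \<le> e' * x"
    using left[OF e'] by blast
  define m where "m = min (min d1 d2) (min (min t0 (2*pi - t0)) pi)"
  \<comment> \<open>Half of the minimum, so that the neighbourhood of \<open>t0\<close> stays
    strictly inside \<open>(0, 2 pi)\<close> and periodicity never comes into play.\<close>
  define \<eta> where "\<eta> = m / 2"
  have m: "0 < m" "m \<le> d1" "m \<le> d2" "m \<le> t0" "m \<le> 2*pi - t0" "m \<le> pi"
    using d1 d2 t0 by (auto simp: m_def)
  have \<eta>: "0 < \<eta>" "\<eta> < d1" "\<eta> < d2" "\<eta> < t0" "\<eta> < 2*pi - t0" "\<eta> \<le> pi"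
    using m pi_gt_zero unfolding \<eta>_def by auto
  define K where "K = (LINT t:{0..2*pi}|lborel. cmod (G t - G t0))"
  have const: "set_integrable lborel {a..b} (\<lambda>t. G t0)" for a b :: real
    unfolding set_integrable_def by (intro borel_integrable_compact) auto
  have Gd: "set_integrable lborel {0..2*pi} (\<lambda>t. G t - G t0)"
    by (rule set_integral_diff(1)[OF G const])
  have Gd': "set_integrable lborel S (\<lambda>t. G t - G t0)" if "S \<subseteq> {0..2*pi}" "S \<in> sets borel" for S
    using Gd that by (intro set_integrable_subset[OF Gd]) auto
  have ev: "eventually (\<lambda>r. (1 - r\<^sup>2) / (sin (\<eta>/2))\<^sup>2 * K < e / 2) (at_left (1::real))"
  proof -
    have "((\<lambda>r. (1 - r\<^sup>2) / (sin (\<eta>/2))\<^sup>2 * K) \<longlongrightarrow> (1 - 1\<^sup>2) / (sin (\<eta>/2))\<^sup>2 * K) (at_left (1::real))"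
      using sin_gt_zero[of "\<eta>/2"] \<eta> by (intro tendsto_intros) auto
    from order_tendstoD(2)[OF this, of "e/2"] show ?thesis using e by simp
  qed
  have ev2: "eventually (\<lambda>r. r \<in> {0<..<1}) (at_left (1::real))"
    by (intro eventually_at_leftI[of 0]) auto
  show "eventually (\<lambda>r. dist (LINT t:{0..2*pi}|lborel. ((1 - r\<^sup>2) / (1 - 2 * r * cos (t - t0) + r\<^sup>2)) *\<^sub>R (G t - G t0)) 0 < e) (at_left 1)"
    using ev ev2
  proof eventually_elim
    case (elim r)
    then have r: "0 \<le> r" "r < 1" by auto
    define p where "p s = (1 - r\<^sup>2) / (1 - 2 * r * cos s + r\<^sup>2)" for s
    have pos: "0 < 1 - 2 * r * cos s + r\<^sup>2" for s by (rule poisson_denominator_pos[OF r])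
    have p0: "0 \<le> p s" for s unfolding p_def by (rule poisson_kernel_nonneg[OF r])
    have pm [measurable]: "p \<in> borel_measurable borel"
      unfolding p_def[abs_def] by measurable
    have ple: "p s \<le> (1 - r\<^sup>2) / (1 - r)\<^sup>2" for s
    proof -
      have "(1 - r)\<^sup>2 \<le> 1 - 2 * r * cos s + r\<^sup>2"
        using mult_left_mono[of "cos s" 1 r] r by (simp add: power2_eq_square algebra_simps)
      then show ?thesis unfolding p_def using r pos[of s]
        by (intro divide_left_mono) (auto simp: power_le_one)
    qed
    define \<Phi> where "\<Phi> t = p (t - t0) *\<^sub>R (G t - G t0)" for t
    have \<Phi>S: "set_integrable lborel S \<Phi>" if S: "S \<subseteq> {0..2*pi}" "S \<in> sets borel" for S
      unfolding set_integrable_def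
    proof (rule Bochner_Integration.integrable_bound)
      show "integrable lborel (\<lambda>t. ((1 - r\<^sup>2) / (1 - r)\<^sup>2) *\<^sub>R (indicat_real S t *\<^sub>R (G t - G t0)))"
        using Gd'[OF S] unfolding set_integrable_def by (rule integrable_scaleR_right)
      show "(\<lambda>t. indicat_real S t *\<^sub>R \<Phi> t) \<in> borel_measurable lborel"
        using S unfolding \<Phi>_def by measurable
      show "AE t in lborel. norm (indicat_real S t *\<^sub>R \<Phi> t) \<le> norm (((1 - r\<^sup>2) / (1 - r)\<^sup>2) *\<^sub>R (indicat_real S t *\<^sub>R (G t - G t0)))"
      proof (intro AE_I2)
        fix t
        have "\<bar>p (t - t0)\<bar> \<le> \<bar>(1 - r\<^sup>2) / (1 - r)\<^sup>2\<bar>"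
          using ple[of "t - t0"] p0[of "t - t0"] by linarith
        then have "\<bar>p (t - t0)\<bar> * norm (indicat_real S t *\<^sub>R (G t - G t0)) \<le> \<bar>(1 - r\<^sup>2) / (1 - r)\<^sup>2\<bar> * norm (indicat_real S t *\<^sub>R (G t - G t0))"
          by (rule mult_right_mono) simp
        then show "norm (indicat_real S t *\<^sub>R \<Phi> t) \<le> norm (((1 - r\<^sup>2) / (1 - r)\<^sup>2) *\<^sub>R (indicat_real S t *\<^sub>R (G t - G t0)))"
          unfolding norm_scaleR \<Phi>_def by (simp only: mult_ac)
      qed
    qed
    define A where "A = {t0..t0+\<eta>}"
    \<comment> \<open>Half-open to be disjoint from \<open>A\<close>; after reflection it differs
      from \<open>[0, \<eta>]\<close> only at the point 0.\<close>
    define B where "B = {t0-\<eta>..<t0}"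
    define R where "R = {0..2*pi} - {t0-\<eta>..t0+\<eta>}"
    have sub: "A \<subseteq> {0..2*pi}" "B \<subseteq> {0..2*pi}" "R \<subseteq> {0..2*pi}" using \<eta> t0 by (auto simp: A_def B_def R_def)
    have [measurable]: "A \<in> sets borel" "B \<in> sets borel" "R \<in> sets borel" by (auto simp: A_def B_def R_def)
    have "{0..2*pi} = (A \<union> B) \<union> R" using \<eta> t0 by (auto simp: A_def B_def R_def)
    then have split: "(LINT t:{0..2*pi}|lborel. \<Phi> t) = (LINT t:A|lborel. \<Phi> t) + (LINT t:B|lborel. \<Phi> t) + (LINT t:R|lborel. \<Phi> t)"
    proof -
      have "(LINT t:(A \<union> B) \<union> R|lborel. \<Phi> t) = (LINT t:A \<union> B|lborel. \<Phi> t) + (LINT t:R|lborel. \<Phi> t)"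
        using sub by (intro set_integral_Un \<Phi>S) (auto simp: A_def B_def R_def)
      moreover have "(LINT t:A \<union> B|lborel. \<Phi> t) = (LINT t:A|lborel. \<Phi> t) + (LINT t:B|lborel. \<Phi> t)"
        using sub by (intro set_integral_Un \<Phi>S) (auto simp: A_def B_def)
      ultimately show ?thesis using \<open>{0..2*pi} = (A \<union> B) \<union> R\<close> by simp
    qed
    have bA: "cmod (LINT t:A|lborel. \<Phi> t) \<le> e' * (2 * pi)"
    proof -
      have "(LINT t:A|lborel. \<Phi> t) = \<bar>1\<bar> *\<^sub>R (LINT s|lborel. indicat_real A (t0 + 1 * s) *\<^sub>R \<Phi> (t0 + 1 * s))"
        unfolding set_lebesgue_integral_def by (rule lborel_integral_real_affine) simp
      also have "\<dots> = (LINT s:{0..\<eta>}|lborel. p s *\<^sub>R (G (t0 + s) - G t0))"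
        unfolding set_lebesgue_integral_def by (auto intro!: Bochner_Integration.integral_cong simp: indicator_def A_def \<Phi>_def)
      also have "cmod \<dots> \<le> e' * (2 * pi)"
        unfolding p_def
      proof (rule poisson_near_bound[OF r])
        have "integrable lborel (\<lambda>s. indicat_real A (t0 + 1 * s) *\<^sub>R (G (t0 + 1 * s) - G t0))"
          using Gd'[OF sub(1)] unfolding set_integrable_def by (intro lborel_integrable_real_affine[of "\<lambda>t. indicat_real A t *\<^sub>R (G t - G t0)"]) auto
        moreover have "indicat_real A (t0 + 1 * s) = indicat_real {0..\<eta>} s" for s by (auto simp: A_def indicator_def)
        ultimately show "set_integrable lborel {0..\<eta>} (\<lambda>s. G (t0 + s) - G t0)" by (simp add: set_integrable_def)
      qed (use \<eta> e' d1(2) in auto)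
      finally show ?thesis .
    qed
    have bB: "cmod (LINT t:B|lborel. \<Phi> t) \<le> e' * (2 * pi)"
    proof -
      have "(LINT t:B|lborel. \<Phi> t) = \<bar>-1\<bar> *\<^sub>R (LINT s|lborel. indicat_real B (t0 + (-1) * s) *\<^sub>R \<Phi> (t0 + (-1) * s))"
        unfolding set_lebesgue_integral_def by (rule lborel_integral_real_affine) simp
      also have "\<dots> = (LINT s:{0..\<eta>}|lborel. p s *\<^sub>R (G (t0 - s) - G t0))"
      proof -
        have "(LINT s|lborel. indicat_real B (t0 + (-1) * s) *\<^sub>R \<Phi> (t0 + (-1) * s)) = (LINT s:{0..\<eta>}|lborel. p s *\<^sub>R (G (t0 - s) - G t0))"
          unfolding set_lebesgue_integral_def
        proof (rule integral_cong_AE)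
          show "AE s in lborel. indicat_real B (t0 + (-1) * s) *\<^sub>R \<Phi> (t0 + (-1) * s) = indicat_real {0..\<eta>} s *\<^sub>R p s *\<^sub>R (G (t0 - s) - G t0)"
            using AE_lborel_singleton[of 0] by eventually_elim (auto simp: B_def \<Phi>_def p_def indicator_def)
        qed (auto simp: \<Phi>_def)
        then show ?thesis by simp
      qed
      also have "cmod \<dots> \<le> e' * (2 * pi)"
        unfolding p_def
      proof (rule poisson_near_bound[OF r])
        have "integrable lborel (\<lambda>s. indicat_real {t0-\<eta>..t0} (t0 + (-1) * s) *\<^sub>R (G (t0 + (-1) * s) - G t0))"
          using Gd'[of "{t0-\<eta>..t0}"] \<eta> t0 unfolding set_integrable_def
          by (intro lborel_integrable_real_affine[of "\<lambda>t. indicat_real {t0-\<eta>..t0} t *\<^sub>R (G t - G t0)"]) auto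
        moreover have "indicat_real {t0-\<eta>..t0} (t0 + (-1) * s) = indicat_real {0..\<eta>} s" for s by (auto simp: indicator_def)
        ultimately show "set_integrable lborel {0..\<eta>} (\<lambda>s. G (t0 - s) - G t0)" by (simp add: set_integrable_def)
      qed (use \<eta> e' d2(2) in auto)
      finally show ?thesis .
    qed
    have bR: "cmod (LINT t:R|lborel. \<Phi> t) \<le> (1 - r\<^sup>2) / (sin (\<eta>/2))\<^sup>2 * K"
    proof -
      have c0: "0 \<le> (1 - r\<^sup>2) / (sin (\<eta>/2))\<^sup>2" using r by (intro divide_nonneg_nonneg) (auto simp: power_le_one)
      have int: "integrable lborel (\<lambda>t. indicat_real {0..2*pi} t *\<^sub>R cmod (G t - G t0))"
        using set_integrable_norm[OF Gd] by (simp add: set_integrable_def)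
      have "cmod (LINT t:R|lborel. \<Phi> t) \<le> (LINT t|lborel. (1 - r\<^sup>2) / (sin (\<eta>/2))\<^sup>2 * (indicat_real {0..2*pi} t *\<^sub>R cmod (G t - G t0)))"
        unfolding set_lebesgue_integral_def
      proof (rule norm_integral_le)
        show "integrable lborel (\<lambda>t. (1 - r\<^sup>2) / (sin (\<eta>/2))\<^sup>2 * (indicat_real {0..2*pi} t *\<^sub>R cmod (G t - G t0)))"
          using int by (rule integrable_mult_right)
        fix t
        show "cmod (indicat_real R t *\<^sub>R \<Phi> t) \<le> (1 - r\<^sup>2) / (sin (\<eta>/2))\<^sup>2 * (indicat_real {0..2*pi} t *\<^sub>R cmod (G t - G t0))"
        proof (cases "t \<in> R")
          case True
          then have tt: "0 \<le> t" "t \<le> 2 * pi" "\<not> (t0 - \<eta> \<le> t \<and> t \<le> t0 + \<eta>)" by (auto simp: R_def)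
          then have "\<eta> \<le> \<bar>t - t0\<bar>" "\<bar>t - t0\<bar> \<le> 2 * pi - \<eta>" using \<eta> t0 by auto
          then have "p (t - t0) \<le> (1 - r\<^sup>2) / (sin (\<eta>/2))\<^sup>2"
            unfolding p_def using \<eta> by (intro poisson_far_bound r) auto
          from mult_right_mono[OF this, of "cmod (G t - G t0)"] show ?thesis
            using True tt p0[of "t - t0"] by (simp add: \<Phi>_def)
        next
          case False
          moreover from c0 have "0 \<le> (1 - r\<^sup>2) / (sin (\<eta>/2))\<^sup>2 * (indicat_real {0..2*pi} t *\<^sub>R cmod (G t - G t0))"
            by (rule mult_nonneg_nonneg) simp
          ultimately show ?thesis by simp
        qed
      qed
      also have "\<dots> = (1 - r\<^sup>2) / (sin (\<eta>/2))\<^sup>2 * K"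
        unfolding K_def set_lebesgue_integral_def by (rule integral_mult_right_zero)
      finally show ?thesis .
    qed
    have "cmod (LINT t:{0..2*pi}|lborel. \<Phi> t) \<le> e' * (2 * pi) + e' * (2 * pi) + (1 - r\<^sup>2) / (sin (\<eta>/2))\<^sup>2 * K"
      unfolding split by (intro norm_triangle_mono bA bB bR)
    also have "\<dots> < e"
    proof -
      have "e' * (2 * pi) + e' * (2 * pi) = e / 2" by (simp add: e'_def)
      then show ?thesis
        using add_strict_left_mono[OF elim(1), of "e / 2"] by (simp only: field_sum_of_halves)
    qed
    finally show ?case by (simp add: \<Phi>_def p_def)
  qed
qed

lemma AE_lborel_of_negligible:
  assumes "negligible N"
  shows "AE t in lborel. t \<notin> N"
proof -
  have "AE t in lebesgue. t \<notin> N" using assms by (intro AE_not_in) (simp add: negligible_iff_null_sets)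
  then show ?thesis by (simp add: AE_completion_iff)
qed

theorem poisson_integral_radial_limit:
  fixes g :: "complex \<Rightarrow> complex"
  assumes g: "integrable circle_m g"
  shows "AE \<zeta> in circle_m. ((\<lambda>r. integral\<^sup>L circle_m (\<lambda>w. pkernel (of_real r * \<zeta>) w *\<^sub>R g w)) \<longlongrightarrow> g \<zeta>) (at_left 1)"
proof (rule AE_circle_mI)
  have gm [measurable]: "g \<in> borel_measurable circle_m" using g by auto
  define G where "G t = g (cis t)" for t
  have [measurable]: "G \<in> borel_measurable borel" unfolding G_def by measurable
  have Gint: "set_integrable lborel {0..2*pi} G" using g integrable_circle_m_iff[OF gm] by (simp add: G_def[abs_def])
  \<comment> \<open>Cutting off gives a function integrable on the whole line. Near a point of the
    open interval it agrees with \<open>G\<close>.\<close>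
  define G0 where "G0 t = indicator {0..2*pi} t *\<^sub>R G t" for t :: real
  have G0: "integrable lborel G0" using Gint by (simp add: set_integrable_def G0_def[abs_def])
  have G0': "integrable lborel (\<lambda>t. G0 (0 + (-1) * t))" using G0 by (intro lborel_integrable_real_affine) auto
  obtain N1 where N1: "negligible N1"
    "\<And>t e. t \<notin> N1 \<Longrightarrow> 0 < e \<Longrightarrow> \<exists>d>0. \<forall>x. 0 \<le> x \<and> x < d \<longrightarrow> cmod (LINT s:{0..x}|lborel. (G0 (t + s) - G0 t)) \<le> e * x"
    using right_average_AE[OF G0] by blast
  obtain N2 where N2: "negligible N2"
    "\<And>t e. t \<notin> N2 \<Longrightarrow> 0 < e \<Longrightarrow> \<exists>d>0. \<forall>x. 0 \<le> x \<and> x < d \<longrightarrow> cmod (LINT s:{0..x}|lborel. (G0 (0 + (-1) * (t + s)) - G0 (0 + (-1) * t))) \<le> e * x"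
    using right_average_AE[OF G0'] by blast
  \<comment> \<open>Left averages of \<open>G0\<close> are right averages of its reflection; the
    exceptional set has to be reflected back, which preserves negligibility since negation is
    Lipschitz.\<close>
  have "negligible (uminus ` N2)" 
  proof (rule negligible_locally_Lipschitz_image[OF _ N2(1)])
    fix x :: real
    have "norm (- y - (- x)) \<le> 1 * norm (y - x)" for y by (simp add: abs_minus_commute)
    then show "\<exists>T B. open T \<and> x \<in> T \<and> (\<forall>y\<in>N2 \<inter> T. norm (- y - - x) \<le> B * norm (y - x))"
      by (intro exI[of _ UNIV] exI[of _ 1]) auto
  qed simp
  then have "AE t in lborel. t \<notin> N1 \<and> t \<notin> uminus ` N2"
    using AE_lborel_of_negligible[OF N1(1)] AE_lborel_of_negligible by simp
  then show "AE t in lborel. 0 < t \<longrightarrow> t < 2 * pi \<longrightarrow>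
      ((\<lambda>r. integral\<^sup>L circle_m (\<lambda>w. pkernel (of_real r * cis t) w *\<^sub>R g w)) \<longlongrightarrow> g (cis t)) (at_left 1)"
  proof eventually_elim
    case (elim t0)
    show ?case
    proof (intro impI)
      assume t0: "0 < t0" "t0 < 2 * pi"
      have Gt0: "G0 t0 = G t0" using t0 by (simp add: G0_def)
      have near: "(LINT s:{0..x}|lborel. (G0 (t0 + c * s) - G0 t0)) = (LINT s:{0..x}|lborel. (G (t0 + c * s) - G t0))"
        if x: "x < min t0 (2*pi - t0)" and c: "c = 1 \<or> c = -1" for x c
        using x c t0 by (intro set_lebesgue_integral_cong) (auto simp: G0_def)
      have lim0: "((\<lambda>r. (LINT t:{0..2*pi}|lborel. ((1 - r\<^sup>2) / (1 - 2 * r * cos (t - t0) + r\<^sup>2)) *\<^sub>R (G t - G t0))) \<longlongrightarrow> 0) (at_left 1)"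
      proof (rule poisson_point_limit[OF Gint _ t0])
        fix e :: real assume e: "0 < e"
        obtain d where d: "0 < d" "\<And>x. 0 \<le> x \<Longrightarrow> x < d \<Longrightarrow> cmod (LINT s:{0..x}|lborel. (G0 (t0 + s) - G0 t0)) \<le> e * x"
          using N1(2)[OF _ e, of t0] elim by blast
        show "\<exists>d>0. \<forall>x. 0 \<le> x \<and> x < d \<longrightarrow> cmod (LINT s:{0..x}|lborel. (G (t0 + s) - G t0)) \<le> e * x"
        proof (intro exI[of _ "min d (min t0 (2*pi - t0))"] conjI allI impI)
          fix x assume "0 \<le> x \<and> x < min d (min t0 (2*pi - t0))"
          then show "cmod (LINT s:{0..x}|lborel. (G (t0 + s) - G t0)) \<le> e * x"
            using d(2)[of x] near[of x 1] by simp
        qed (use d t0 in auto)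
        have "- t0 \<notin> N2" using elim by force
        then obtain d where d: "0 < d" "\<And>x. 0 \<le> x \<Longrightarrow> x < d \<Longrightarrow> cmod (LINT s:{0..x}|lborel. (G0 (t0 - s) - G0 t0)) \<le> e * x"
          using N2(2)[OF _ e, of "- t0"] by auto
        show "\<exists>d>0. \<forall>x. 0 \<le> x \<and> x < d \<longrightarrow> cmod (LINT s:{0..x}|lborel. (G (t0 - s) - G t0)) \<le> e * x"
        proof (intro exI[of _ "min d (min t0 (2*pi - t0))"] conjI allI impI)
          fix x assume "0 \<le> x \<and> x < min d (min t0 (2*pi - t0))"
          then show "cmod (LINT s:{0..x}|lborel. (G (t0 - s) - G t0)) \<le> e * x"
            using d(2)[of x] near[of x "-1"] by simp
        qed (use d t0 in auto)
      qed simp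
      have "((\<lambda>r. G t0 + (1/(2*pi)) *\<^sub>R (LINT t:{0..2*pi}|lborel. ((1 - r\<^sup>2) / (1 - 2 * r * cos (t - t0) + r\<^sup>2)) *\<^sub>R (G t - G t0))) \<longlongrightarrow> G t0 + (1/(2*pi)) *\<^sub>R 0) (at_left 1)"
        by (intro tendsto_intros lim0)
      moreover have "eventually (\<lambda>r. G t0 + (1/(2*pi)) *\<^sub>R (LINT t:{0..2*pi}|lborel. ((1 - r\<^sup>2) / (1 - 2 * r * cos (t - t0) + r\<^sup>2)) *\<^sub>R (G t - G t0))
          = integral\<^sup>L circle_m (\<lambda>w. pkernel (of_real r * cis t0) w *\<^sub>R g w)) (at_left 1)"
      proof (rule eventually_at_leftI[of 0])
        fix r :: real assume r: "r \<in> {0<..<1}"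
        define z where "z = of_real r * cis t0"
        have z: "cmod z < 1" using r by (simp add: z_def norm_mult)
        have pm [measurable]: "pkernel z \<in> borel_measurable circle_m" by (intro borel_measurable_circle_mI) measurable
        have i1: "integrable circle_m (\<lambda>w. pkernel z w *\<^sub>R g w)"
        proof (rule Bochner_Integration.integrable_bound)
          show "integrable circle_m (\<lambda>w. (2 / (1 - cmod z)) *\<^sub>R g w)" using g by (rule integrable_scaleR_right)
          show "AE w in circle_m. cmod (pkernel z w *\<^sub>R g w) \<le> cmod ((2 / (1 - cmod z)) *\<^sub>R g w)"
          proof (intro AE_I2)
            fix w assume "w \<in> space circle_m"
            then have "\<bar>pkernel z w\<bar> \<le> \<bar>2 / (1 - cmod z)\<bar>"
              using pkernel_le[OF z, of w] pkernel_nonneg[of z w] z by auto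
            then show "cmod (pkernel z w *\<^sub>R g w) \<le> cmod ((2 / (1 - cmod z)) *\<^sub>R g w)"
              unfolding norm_scaleR by (rule mult_right_mono) simp
          qed
        qed measurable
        have i2: "integrable circle_m (\<lambda>w. pkernel z w *\<^sub>R G t0)"
          using pkernel_integral(1)[OF z] by (intro integrable_scaleR_left)
        have "integral\<^sup>L circle_m (\<lambda>w. pkernel z w *\<^sub>R g w) - G t0
            = integral\<^sup>L circle_m (\<lambda>w. pkernel z w *\<^sub>R g w) - integral\<^sup>L circle_m (\<lambda>w. pkernel z w *\<^sub>R G t0)"
          using pkernel_integral[OF z] by simp
        also have "\<dots> = integral\<^sup>L circle_m (\<lambda>w. pkernel z w *\<^sub>R (g w - G t0))"
          using i1 i2 by (simp add: scaleR_diff_right)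
        also have "\<dots> = (1/(2*pi)) *\<^sub>R (LINT t:{0..2*pi}|lborel. pkernel z (cis t) *\<^sub>R (g (cis t) - G t0))"
          by (rule integral_circle_m) measurable
        also have "\<dots> = (1/(2*pi)) *\<^sub>R (LINT t:{0..2*pi}|lborel. ((1 - r\<^sup>2) / (1 - 2 * r * cos (t - t0) + r\<^sup>2)) *\<^sub>R (G t - G t0))"
          by (simp add: z_def pkernel_polar G_def)
        finally show "G t0 + (1/(2*pi)) *\<^sub>R (LINT t:{0..2*pi}|lborel. ((1 - r\<^sup>2) / (1 - 2 * r * cos (t - t0) + r\<^sup>2)) *\<^sub>R (G t - G t0))
          = integral\<^sup>L circle_m (\<lambda>w. pkernel (of_real r * cis t0) w *\<^sub>R g w)"
          unfolding z_def by (metis add.commute diff_add_cancel)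
      qed simp
      ultimately show "((\<lambda>r. integral\<^sup>L circle_m (\<lambda>w. pkernel (of_real r * cis t0) w *\<^sub>R g w)) \<longlongrightarrow> g (cis t0)) (at_left 1)"
        by (simp add: G_def Lim_transform_eventually)
    qed
  qed
qed

section \<open>Fatou's theorem\<close>

lemma circle_m_mean_value:
  assumes "F holomorphic_on ball 0 R" "1 < R"
  shows "integral\<^sup>L circle_m F = F 0"
proof -
  have "integral\<^sup>L circle_m F = integral\<^sup>L circle_m (\<lambda>\<zeta>. F \<zeta> * (\<zeta> / (\<zeta> - 0)))"
    by (intro Bochner_Integration.integral_cong) auto
  then show ?thesis using Cauchy_circle_m[OF assms, of 0] by simp
qed

lemma circle_m_orthonormal:
  "integral\<^sup>L circle_m (\<lambda>\<zeta>. \<zeta> ^ n * cnj (\<zeta> ^ m)) = (if n = m then 1 else 0)"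
proof -
  have pw: "integral\<^sup>L circle_m (\<lambda>\<zeta>. \<zeta> ^ k) = (if k = 0 then 1 else 0)" for k
  proof -
    have "(\<lambda>\<zeta>::complex. \<zeta> ^ k) holomorphic_on ball 0 2" by (intro holomorphic_intros)
    from circle_m_mean_value[OF this] show ?thesis by (simp add: power_0_left)
  qed
  have unit: "\<zeta> ^ k * cnj (\<zeta> ^ k) = 1" if "cmod \<zeta> = 1" for \<zeta> k
    using complex_norm_square[of "\<zeta> ^ k"] that by (simp add: norm_power)
  show ?thesis
  proof (cases "m \<le> n")
    case True
    have "integral\<^sup>L circle_m (\<lambda>\<zeta>. \<zeta> ^ n * cnj (\<zeta> ^ m)) = integral\<^sup>L circle_m (\<lambda>\<zeta>. \<zeta> ^ (n - m))"
    proof (intro Bochner_Integration.integral_cong refl)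
      fix \<zeta> assume "\<zeta> \<in> space circle_m"
      then have "\<zeta> ^ m * cnj (\<zeta> ^ m) = 1" by (intro unit) simp
      moreover have "\<zeta> ^ n = \<zeta> ^ (n - m) * \<zeta> ^ m" using True by (simp flip: power_add)
      ultimately show "\<zeta> ^ n * cnj (\<zeta> ^ m) = \<zeta> ^ (n - m)" by (metis mult.assoc mult.right_neutral)
    qed
    then show ?thesis using True by (auto simp: pw)
  next
    case False
    have "integral\<^sup>L circle_m (\<lambda>\<zeta>. \<zeta> ^ n * cnj (\<zeta> ^ m)) = integral\<^sup>L circle_m (\<lambda>\<zeta>. cnj (\<zeta> ^ (m - n)))"
    proof (intro Bochner_Integration.integral_cong refl)
      fix \<zeta> assume "\<zeta> \<in> space circle_m"
      then have "\<zeta> ^ n * cnj (\<zeta> ^ n) = 1" by (intro unit) simp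
      moreover have "cnj (\<zeta> ^ m) = cnj (\<zeta> ^ n) * cnj (\<zeta> ^ (m - n))"
        using False by (simp flip: power_add)
      ultimately show "\<zeta> ^ n * cnj (\<zeta> ^ m) = cnj (\<zeta> ^ (m - n))" by (metis mult.assoc mult_1)
    qed
    also have "\<dots> = cnj (integral\<^sup>L circle_m (\<lambda>\<zeta>. \<zeta> ^ (m - n)))" by (rule Bochner_Integration.integral_cnj)
    also have "\<dots> = 0" using False by (simp add: pw)
    finally show ?thesis using False by simp
  qed
qed

lemma power_circle_measurable [measurable]: "(\<lambda>\<zeta>::complex. \<zeta> ^ n) \<in> borel_measurable circle_m"
  by (intro borel_measurable_circle_mI borel_measurable_continuous_onI continuous_intros)

lemma cnj_circle_measurable [measurable]: "g \<in> borel_measurable M \<Longrightarrow> (\<lambda>x. cnj (g x)) \<in> borel_measurable M"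
  by (rule measurable_compose[of g M borel cnj]) (auto intro!: borel_measurable_continuous_onI continuous_intros)

text \<open>Absolute summability justifies both exchanges of sum and integral. It is available in
  the application, where the coefficients carry powers of radii below 1.\<close>

lemma parseval:
  fixes a :: "nat \<Rightarrow> complex"
  assumes a: "summable (\<lambda>n. cmod (a n))"
  shows "(\<lambda>n. (cmod (a n))\<^sup>2) sums integral\<^sup>L circle_m (\<lambda>\<zeta>. (cmod (\<Sum>n. a n * \<zeta> ^ n))\<^sup>2)"
proof -
  define F where "F \<zeta> = (\<Sum>n. a n * \<zeta> ^ n)" for \<zeta>
  have nt: "cmod (a n * \<zeta> ^ n) = cmod (a n)" if "cmod \<zeta> = 1" for \<zeta> n
    using that by (simp add: norm_mult norm_power)
  have F: "summable (\<lambda>n. a n * \<zeta> ^ n)" "cmod (F \<zeta>) \<le> (\<Sum>n. cmod (a n))" if "cmod \<zeta> = 1" for \<zeta>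
  proof -
    have s: "summable (\<lambda>n. cmod (a n * \<zeta> ^ n))" using a by (simp add: nt[OF that])
    then show "summable (\<lambda>n. a n * \<zeta> ^ n)" by (rule summable_norm_cancel)
    show "cmod (F \<zeta>) \<le> (\<Sum>n. cmod (a n))" using summable_norm[OF s] by (simp add: F_def nt[OF that])
  qed
  have Fm [measurable]: "F \<in> borel_measurable circle_m" unfolding F_def[abs_def] by measurable
  have bint: "integrable circle_m g" if "g \<in> borel_measurable circle_m" "\<And>\<zeta>. cmod \<zeta> = 1 \<Longrightarrow> cmod (g \<zeta>) \<le> K" for g :: "complex \<Rightarrow> complex" and K
    using that by (intro circle_m.integrable_const_bound[of _ K] AE_I2) auto
  have coeff: "integral\<^sup>L circle_m (\<lambda>\<zeta>. F \<zeta> * cnj (\<zeta> ^ m)) = a m" for m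
  proof -
    have "integral\<^sup>L circle_m (\<lambda>\<zeta>. \<Sum>n. a n * \<zeta> ^ n * cnj (\<zeta> ^ m)) = (\<Sum>n. integral\<^sup>L circle_m (\<lambda>\<zeta>. a n * \<zeta> ^ n * cnj (\<zeta> ^ m)))"
    proof (rule integral_suminf)
      show "integrable circle_m (\<lambda>\<zeta>. a n * \<zeta> ^ n * cnj (\<zeta> ^ m))" for n
      proof (rule bint[of _ "cmod (a n)"])
        show "(\<lambda>\<zeta>. a n * \<zeta> ^ n * cnj (\<zeta> ^ m)) \<in> borel_measurable circle_m" by measurable
      qed (auto simp: norm_mult norm_power)
      show "AE \<zeta> in circle_m. summable (\<lambda>n. cmod (a n * \<zeta> ^ n * cnj (\<zeta> ^ m)))"
        using a by (intro AE_I2) (simp add: norm_mult norm_power)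
      have "(\<lambda>n. LINT \<zeta>|circle_m. cmod (a n * \<zeta> ^ n * cnj (\<zeta> ^ m))) = (\<lambda>n. LINT \<zeta>|circle_m. cmod (a n))"
        by (intro ext Bochner_Integration.integral_cong refl) (simp add: norm_mult norm_power)
      then show "summable (\<lambda>n. LINT \<zeta>|circle_m. cmod (a n * \<zeta> ^ n * cnj (\<zeta> ^ m)))"
        using a by (simp add: measure_def emeasure_circle_m_space)
    qed
    also have "\<dots> = (\<Sum>n. if n = m then a n else 0)"
    proof (intro suminf_cong)
      fix n
      have "(\<lambda>\<zeta>. a n * \<zeta> ^ n * cnj (\<zeta> ^ m)) = (\<lambda>\<zeta>. a n * (\<zeta> ^ n * cnj (\<zeta> ^ m)))" by (simp add: mult.assoc)
      then have "integral\<^sup>L circle_m (\<lambda>\<zeta>. a n * \<zeta> ^ n * cnj (\<zeta> ^ m)) = a n * integral\<^sup>L circle_m (\<lambda>\<zeta>. \<zeta> ^ n * cnj (\<zeta> ^ m))"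
        by (simp only: integral_mult_right_zero)
      then show "integral\<^sup>L circle_m (\<lambda>\<zeta>. a n * \<zeta> ^ n * cnj (\<zeta> ^ m)) = (if n = m then a n else 0)"
        by (simp only: circle_m_orthonormal) simp
    qed
    also have "\<dots> = a m"
      using suminf_finite[of "{m}" "\<lambda>n. if n = m then a n else 0"] by simp
    finally have 1: "integral\<^sup>L circle_m (\<lambda>\<zeta>. \<Sum>n. a n * \<zeta> ^ n * cnj (\<zeta> ^ m)) = a m" .
    have "integral\<^sup>L circle_m (\<lambda>\<zeta>. F \<zeta> * cnj (\<zeta> ^ m)) = integral\<^sup>L circle_m (\<lambda>\<zeta>. \<Sum>n. a n * \<zeta> ^ n * cnj (\<zeta> ^ m))"
      using F(1) unfolding F_def by (intro Bochner_Integration.integral_cong refl suminf_mult2) auto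
    then show ?thesis using 1 by simp
  qed
  have "(\<lambda>m. integral\<^sup>L circle_m (\<lambda>\<zeta>. cnj (a m) * (F \<zeta> * cnj (\<zeta> ^ m)))) sums
      integral\<^sup>L circle_m (\<lambda>\<zeta>. \<Sum>m. cnj (a m) * (F \<zeta> * cnj (\<zeta> ^ m)))"
  proof (rule sums_integral)
    define K where "K = (\<Sum>n. cmod (a n))"
    have bd: "cmod (cnj (a m) * (F \<zeta> * cnj (\<zeta> ^ m))) \<le> cmod (a m) * K" if "cmod \<zeta> = 1" for \<zeta> m
      using F(2)[OF that] that by (simp add: norm_mult norm_power mult_left_mono K_def)
    show i: "integrable circle_m (\<lambda>\<zeta>. cnj (a m) * (F \<zeta> * cnj (\<zeta> ^ m)))" for m
    proof (rule bint[OF _ bd])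
      show "(\<lambda>\<zeta>. cnj (a m) * (F \<zeta> * cnj (\<zeta> ^ m))) \<in> borel_measurable circle_m" by measurable
    qed
    show "AE \<zeta> in circle_m. summable (\<lambda>m. cmod (cnj (a m) * (F \<zeta> * cnj (\<zeta> ^ m))))"
      using bd a by (intro AE_I2) (auto intro!: summable_comparison_test'[of "\<lambda>m. cmod (a m) * K" 0] summable_mult2)
    show "summable (\<lambda>m. LINT \<zeta>|circle_m. cmod (cnj (a m) * (F \<zeta> * cnj (\<zeta> ^ m))))"
    proof (rule summable_comparison_test'[of "\<lambda>m. cmod (a m) * K" 0])
      show "summable (\<lambda>m. cmod (a m) * K)" using a by (rule summable_mult2)
      fix m
      have "norm (LINT \<zeta>|circle_m. cmod (cnj (a m) * (F \<zeta> * cnj (\<zeta> ^ m)))) \<le> (LINT \<zeta>|circle_m. cmod (a m) * K)"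
        using bd by (intro norm_integral_le) auto
      then show "norm (LINT \<zeta>|circle_m. cmod (cnj (a m) * (F \<zeta> * cnj (\<zeta> ^ m)))) \<le> cmod (a m) * K"
        by (simp add: measure_def emeasure_circle_m_space)
    qed
  qed
  also have "(\<lambda>m. integral\<^sup>L circle_m (\<lambda>\<zeta>. cnj (a m) * (F \<zeta> * cnj (\<zeta> ^ m)))) = (\<lambda>m. of_real ((cmod (a m))\<^sup>2))"
    unfolding complex_norm_square by (simp only: integral_mult_right_zero coeff mult.commute)
  also have "integral\<^sup>L circle_m (\<lambda>\<zeta>. \<Sum>m. cnj (a m) * (F \<zeta> * cnj (\<zeta> ^ m))) = integral\<^sup>L circle_m (\<lambda>\<zeta>. of_real ((cmod (F \<zeta>))\<^sup>2))"
  proof (intro Bochner_Integration.integral_cong refl)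
    fix \<zeta> assume "\<zeta> \<in> space circle_m"
    then have z: "cmod \<zeta> = 1" by simp
    have "(\<lambda>m. cnj (a m * \<zeta> ^ m)) sums cnj (F \<zeta>)"
      using F(1)[OF z] unfolding F_def sums_cnj by (rule summable_sums)
    then have "(\<lambda>m. F \<zeta> * cnj (a m * \<zeta> ^ m)) sums (F \<zeta> * cnj (F \<zeta>))" by (rule sums_mult)
    then have "(\<lambda>m. cnj (a m) * (F \<zeta> * cnj (\<zeta> ^ m))) sums (F \<zeta> * cnj (F \<zeta>))" by (simp add: mult_ac)
    then show "(\<Sum>m. cnj (a m) * (F \<zeta> * cnj (\<zeta> ^ m))) = of_real ((cmod (F \<zeta>))\<^sup>2)"
      unfolding complex_norm_square by (rule sums_unique[symmetric])
  qed
  also have "\<dots> = of_real (integral\<^sup>L circle_m (\<lambda>\<zeta>. (cmod (F \<zeta>))\<^sup>2))"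
    by (rule integral_complex_of_real)
  finally show ?thesis unfolding sums_of_real_iff F_def .
qed

text \<open>By Parseval the squared distance of two dilates is the sum of
  \<open>|c n|^2 (r^n - s^n)^2\<close>, at most that of \<open>|c n|^2 (1 - \<rho>^n)^2\<close>. The
  latter tends to 0 as \<open>\<rho>\<close> tends to 1 by dominated convergence for series,
  provided the coefficients are square summable.\<close>

lemma radial_L2_Cauchy:
  assumes hol: "f holomorphic_on ball 0 1" and f1: "\<And>z. cmod z < 1 \<Longrightarrow> cmod (f z) \<le> 1" and e: "0 < e"
  obtains \<rho> where "\<rho> < 1" "0 < \<rho>"
    "\<And>r s. \<rho> \<le> r \<Longrightarrow> r < 1 \<Longrightarrow> \<rho> \<le> s \<Longrightarrow> s < 1 \<Longrightarrow>
       integral\<^sup>L circle_m (\<lambda>\<zeta>. (cmod (f (of_real r * \<zeta>) - f (of_real s * \<zeta>)))\<^sup>2) \<le> e"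
proof -
  define c where "c n = (deriv ^^ n) f 0 / fact n" for n
  have ps: "(\<lambda>n. c n * w ^ n) sums f w" if "cmod w < 1" for w
    using holomorphic_power_series[OF hol, of w] that by (simp add: c_def)
  have abs: "summable (\<lambda>n. cmod (c n * of_real r ^ n))" if "0 \<le> r" "r < 1" for r :: real
  proof (rule powser_insidea)
    show "summable (\<lambda>n. c n * of_real ((1 + r) / 2) ^ n)"
      using that by (intro sums_summable[OF ps]) (auto simp del: of_real_add of_real_divide)
    show "cmod (of_real r) < cmod (of_real ((1 + r) / 2))" using that by (simp del: of_real_add of_real_divide)
  qed
  have one: "(\<lambda>n. (cmod (c n))\<^sup>2 * r ^ (2 * n)) sums integral\<^sup>L circle_m (\<lambda>\<zeta>. (cmod (f (of_real r * \<zeta>)))\<^sup>2)"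
    if r: "0 \<le> r" "r < 1" for r :: real
  proof -
    have "(\<lambda>n. (cmod (c n * of_real r ^ n))\<^sup>2) sums integral\<^sup>L circle_m (\<lambda>\<zeta>. (cmod (\<Sum>n. c n * of_real r ^ n * \<zeta> ^ n))\<^sup>2)"
      by (rule parseval[OF abs[OF r]])
    also have "integral\<^sup>L circle_m (\<lambda>\<zeta>. (cmod (\<Sum>n. c n * of_real r ^ n * \<zeta> ^ n))\<^sup>2) = integral\<^sup>L circle_m (\<lambda>\<zeta>. (cmod (f (of_real r * \<zeta>)))\<^sup>2)"
    proof (intro Bochner_Integration.integral_cong refl)
      fix \<zeta> assume "\<zeta> \<in> space circle_m"
      then have "cmod (of_real r * \<zeta>) < 1" using r by (simp add: norm_mult)
      from sums_unique[OF ps[OF this]] show "(cmod (\<Sum>n. c n * of_real r ^ n * \<zeta> ^ n))\<^sup>2 = (cmod (f (of_real r * \<zeta>)))\<^sup>2"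
        by (simp add: power_mult_distrib mult.assoc)
    qed
    finally show ?thesis using r by (simp add: norm_mult norm_power power_mult_distrib power_mult[symmetric] mult.commute)
  qed
  \<comment> \<open>Every partial sum with weights \<open>r ^ (2 * n)\<close> is at most the mean of
    \<open>|f|^2\<close> at radius \<open>r\<close>, hence at most 1; only then does
    \<open>r\<close> tend to 1.\<close>
  have cs: "summable (\<lambda>n. (cmod (c n))\<^sup>2)"
  proof (rule bounded_imp_summable)
    fix N
    have "(\<lambda>r. \<Sum>n\<le>N. (cmod (c n))\<^sup>2 * r ^ (2 * n)) \<midarrow>1\<rightarrow> (\<Sum>n\<le>N. (cmod (c n))\<^sup>2 * 1 ^ (2 * n))"
      by (intro tendsto_intros)
    then have "((\<lambda>r::real. \<Sum>n\<le>N. (cmod (c n))\<^sup>2 * r ^ (2 * n)) \<longlongrightarrow> (\<Sum>n\<le>N. (cmod (c n))\<^sup>2)) (at_left 1)"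
      by (simp add: filterlim_at_split)
    moreover have "eventually (\<lambda>r::real. (\<Sum>n\<le>N. (cmod (c n))\<^sup>2 * r ^ (2 * n)) \<le> 1) (at_left 1)"
    proof (rule eventually_at_leftI[of 0])
      fix r :: real assume r: "r \<in> {0<..<1}"
      then have r': "0 \<le> r" "r < 1" by auto
      have "(\<Sum>n\<le>N. (cmod (c n))\<^sup>2 * r ^ (2 * n)) \<le> (\<Sum>n. (cmod (c n))\<^sup>2 * r ^ (2 * n))"
        using one[OF r'] r' by (intro sum_le_suminf) (auto simp: sums_iff)
      also have "\<dots> = integral\<^sup>L circle_m (\<lambda>\<zeta>. (cmod (f (of_real r * \<zeta>)))\<^sup>2)"
        using one[OF r'] by (simp add: sums_iff)
      also have "\<dots> \<le> norm (integral\<^sup>L circle_m (\<lambda>\<zeta>. (cmod (f (of_real r * \<zeta>)))\<^sup>2))" by simp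
      also have "\<dots> \<le> integral\<^sup>L circle_m (\<lambda>\<zeta>. 1)"
        using f1 r' by (intro norm_integral_le) (auto simp: norm_mult power_le_one)
      also have "\<dots> = 1" by (simp add: measure_def emeasure_circle_m_space)
      finally show "(\<Sum>n\<le>N. (cmod (c n))\<^sup>2 * r ^ (2 * n)) \<le> 1" .
    qed simp
    ultimately show "(\<Sum>n\<le>N. (cmod (c n))\<^sup>2) \<le> 1"
      by (rule tendsto_upperbound) simp
  qed auto
  have "((\<lambda>r. \<Sum>n. (cmod (c n))\<^sup>2 * (1 - r ^ n)\<^sup>2) \<longlongrightarrow> (\<Sum>n. (cmod (c n))\<^sup>2 * (1 - 1 ^ n)\<^sup>2)) (at_left (1::real))"
  proof (rule tannerys_theorem[THEN conjunct2, THEN conjunct2])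
    show "((\<lambda>r. (cmod (c n))\<^sup>2 * (1 - r ^ n)\<^sup>2) \<longlongrightarrow> (cmod (c n))\<^sup>2 * (1 - 1 ^ n)\<^sup>2) (at_left (1::real))" for n
      by (intro tendsto_intros)
    show "eventually (\<lambda>(n, r). norm ((cmod (c n))\<^sup>2 * (1 - r ^ n)\<^sup>2) \<le> (cmod (c n))\<^sup>2) (at_top \<times>\<^sub>F at_left (1::real))"
    proof -
      have "eventually (\<lambda>r. r \<in> {0<..<1}) (at_left (1::real))" by (intro eventually_at_leftI[of 0]) auto
      then have "eventually (\<lambda>x. True \<and> snd x \<in> {0<..<1}) (at_top \<times>\<^sub>F at_left (1::real) :: (nat \<times> real) filter)"
        by (intro eventually_prodI) auto
      then show ?thesis
        by eventually_elim (auto simp: abs_mult power_le_one mult_left_le)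
    qed
    show "summable (\<lambda>n. (cmod (c n))\<^sup>2)" by (rule cs)
  qed simp
  then have "((\<lambda>r. \<Sum>n. (cmod (c n))\<^sup>2 * (1 - r ^ n)\<^sup>2) \<longlongrightarrow> 0) (at_left (1::real))" by simp
  from order_tendstoD(2)[OF this e]
  have "eventually (\<lambda>r. (\<Sum>n. (cmod (c n))\<^sup>2 * (1 - r ^ n)\<^sup>2) < e \<and> r \<in> {0<..<1}) (at_left (1::real))"
    by (intro eventually_conj) (auto intro: eventually_at_leftI[of 0])
  then obtain \<rho> :: real where \<rho>: "(\<Sum>n. (cmod (c n))\<^sup>2 * (1 - \<rho> ^ n)\<^sup>2) < e" "0 < \<rho>" "\<rho> < 1"
    using eventually_happens'[OF trivial_limit_at_left_real] by fastforce
  show ?thesis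
  proof (rule that[OF \<rho>(3,2)])
    fix r s :: real assume rs: "\<rho> \<le> r" "r < 1" "\<rho> \<le> s" "s < 1"
    have r0: "0 \<le> r" "0 \<le> s" using rs \<rho> by auto
    have sm: "summable (\<lambda>n. cmod (c n * (of_real r ^ n - of_real s ^ n)))"
    proof (rule summable_comparison_test')
      show "summable (\<lambda>n. cmod (c n * of_real r ^ n) + cmod (c n * of_real s ^ n))"
        using abs r0 rs by (intro summable_add) auto
      show "norm (cmod (c n * (of_real r ^ n - of_real s ^ n))) \<le> cmod (c n * of_real r ^ n) + cmod (c n * of_real s ^ n)" if "n \<ge> 0" for n
        using norm_triangle_ineq4[of "c n * of_real r ^ n" "c n * of_real s ^ n"] by (simp add: right_diff_distrib)
    qed
    have "integral\<^sup>L circle_m (\<lambda>\<zeta>. (cmod (f (of_real r * \<zeta>) - f (of_real s * \<zeta>)))\<^sup>2)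
       = integral\<^sup>L circle_m (\<lambda>\<zeta>. (cmod (\<Sum>n. c n * (of_real r ^ n - of_real s ^ n) * \<zeta> ^ n))\<^sup>2)"
    proof (intro Bochner_Integration.integral_cong refl)
      fix \<zeta> assume "\<zeta> \<in> space circle_m"
      then have "cmod (of_real r * \<zeta>) < 1" "cmod (of_real s * \<zeta>) < 1" using r0 rs by (auto simp: norm_mult)
      then have "(\<lambda>n. c n * (of_real r * \<zeta>) ^ n - c n * (of_real s * \<zeta>) ^ n) sums (f (of_real r * \<zeta>) - f (of_real s * \<zeta>))"
        by (intro sums_diff ps)
      moreover have "c n * (of_real r * \<zeta>) ^ n - c n * (of_real s * \<zeta>) ^ n = c n * (of_real r ^ n - of_real s ^ n) * \<zeta> ^ n" for n
        by (simp add: power_mult_distrib algebra_simps)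
      ultimately show "(cmod (f (of_real r * \<zeta>) - f (of_real s * \<zeta>)))\<^sup>2 = (cmod (\<Sum>n. c n * (of_real r ^ n - of_real s ^ n) * \<zeta> ^ n))\<^sup>2"
        by (simp add: sums_iff)
    qed
    also have "\<dots> = (\<Sum>n. (cmod (c n * (of_real r ^ n - of_real s ^ n)))\<^sup>2)"
      using parseval[OF sm] by (simp add: sums_iff)
    also have "\<dots> \<le> (\<Sum>n. (cmod (c n))\<^sup>2 * (1 - \<rho> ^ n)\<^sup>2)"
    proof (rule suminf_le)
      show "summable (\<lambda>n. (cmod (c n * (of_real r ^ n - of_real s ^ n)))\<^sup>2)"
        using parseval[OF sm] by (simp add: sums_iff)
      show "summable (\<lambda>n. (cmod (c n))\<^sup>2 * (1 - \<rho> ^ n)\<^sup>2)"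
        using \<rho> by (intro summable_comparison_test'[OF cs, of 0]) (auto simp: abs_mult power_le_one mult_left_le)
      fix n
      have "\<rho> ^ n \<le> r ^ n" "\<rho> ^ n \<le> s ^ n" "r ^ n \<le> 1" "s ^ n \<le> 1"
        using rs \<rho> r0 by (auto intro!: power_mono power_le_one)
      then have "\<bar>r ^ n - s ^ n\<bar> \<le> 1 - \<rho> ^ n" by (simp add: abs_le_iff)
      then have "(r ^ n - s ^ n)\<^sup>2 \<le> (1 - \<rho> ^ n)\<^sup>2"
        by (metis abs_ge_zero power2_abs power_mono)
      moreover have "cmod (of_real r ^ n - of_real s ^ n) = \<bar>r ^ n - s ^ n\<bar>"
        by (metis norm_of_real of_real_diff of_real_power)
      ultimately show "(cmod (c n * (of_real r ^ n - of_real s ^ n)))\<^sup>2 \<le> (cmod (c n))\<^sup>2 * (1 - \<rho> ^ n)\<^sup>2"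
        by (simp add: norm_mult power_mult_distrib mult_left_mono)
    qed
    also have "\<dots> \<le> e" using \<rho> by simp
    finally show "integral\<^sup>L circle_m (\<lambda>\<zeta>. (cmod (f (of_real r * \<zeta>) - f (of_real s * \<zeta>)))\<^sup>2) \<le> e" .
  qed
qed

text \<open>The square mean estimate yields a boundary function \<open>g\<close>, but only along a
  fast sequence of radii. Since \<open>f\<close> turns out to be the Poisson integral of
  \<open>g\<close>, the limit over all radii follows from the theorem on Poisson integrals.\<close>

theorem Fatou_radial_limit:
  assumes hol: "f holomorphic_on ball 0 1" and f1: "\<And>z. cmod z < 1 \<Longrightarrow> cmod (f z) \<le> 1"
  shows "AE \<zeta> in circle_m. \<exists>l. ((\<lambda>r. f (of_real r * \<zeta>)) \<longlongrightarrow> l) (at_left 1)"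
proof -
  have "\<exists>\<rho>. \<rho> < 1 \<and> 0 < \<rho> \<and> (\<forall>r s. \<rho> \<le> r \<longrightarrow> r < 1 \<longrightarrow> \<rho> \<le> s \<longrightarrow> s < 1 \<longrightarrow>
       integral\<^sup>L circle_m (\<lambda>\<zeta>. (cmod (f (of_real r * \<zeta>) - f (of_real s * \<zeta>)))\<^sup>2) \<le> (1/4)^k)" for k :: nat
  proof -
    have pos: "0 < (1/4::real)^k" by simp
    show ?thesis
    proof (rule radial_L2_Cauchy[OF hol _ pos])
      show "cmod (f z) \<le> 1" if "cmod z < 1" for z by (rule f1[OF that])
      fix \<rho> assume 1: "\<rho> < 1" "0 < \<rho>" and 2: "\<And>r s. \<rho> \<le> r \<Longrightarrow> r < 1 \<Longrightarrow> \<rho> \<le> s \<Longrightarrow> s < 1 \<Longrightarrow>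
        integral\<^sup>L circle_m (\<lambda>\<zeta>. (cmod (f (of_real r * \<zeta>) - f (of_real s * \<zeta>)))\<^sup>2) \<le> (1/4)^k"
      show ?thesis by (intro exI[of _ \<rho>] conjI allI impI 1 2)
    qed
  qed
  then have "\<forall>k. \<exists>\<rho>. \<rho> < 1 \<and> 0 < \<rho> \<and> (\<forall>r s. \<rho> \<le> r \<longrightarrow> r < 1 \<longrightarrow> \<rho> \<le> s \<longrightarrow> s < 1 \<longrightarrow>
       integral\<^sup>L circle_m (\<lambda>\<zeta>. (cmod (f (of_real r * \<zeta>) - f (of_real s * \<zeta>)))\<^sup>2) \<le> (1/4)^k)" by blast
  from choice[OF this] obtain \<rho> :: "nat \<Rightarrow> real" where \<rho>': "\<forall>k. \<rho> k < 1 \<and> 0 < \<rho> k \<and> (\<forall>r s. \<rho> k \<le> r \<longrightarrow> r < 1 \<longrightarrow> \<rho> k \<le> s \<longrightarrow> s < 1 \<longrightarrow>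
       integral\<^sup>L circle_m (\<lambda>\<zeta>. (cmod (f (of_real r * \<zeta>) - f (of_real s * \<zeta>)))\<^sup>2) \<le> (1/4)^k)" by blast
  have \<rho>: "\<rho> k < 1" "0 < \<rho> k"
    "\<rho> k \<le> r \<Longrightarrow> r < 1 \<Longrightarrow> \<rho> k \<le> s \<Longrightarrow> s < 1 \<Longrightarrow>
       integral\<^sup>L circle_m (\<lambda>\<zeta>. (cmod (f (of_real r * \<zeta>) - f (of_real s * \<zeta>)))\<^sup>2) \<le> (1/4)^k" for k r s
    using \<rho>' by auto
  \<comment> \<open>The maximum over \<open>j \<le> k\<close> makes both \<open>r k\<close> and
    \<open>r (Suc k)\<close> exceed the threshold \<open>\<rho> k\<close>; the second entry forces
    \<open>r\<close> to tend to 1.\<close>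
  define r where "r k = Max ((\<lambda>j. max (\<rho> j) (1 - 1 / real (j + 2))) ` {..k})" for k
  have r1: "r k < 1" for k unfolding r_def using \<rho>(1) by (subst Max_less_iff) auto
  have rge: "max (\<rho> j) (1 - 1 / real (j + 2)) \<le> r k" if "j \<le> k" for j k
    unfolding r_def using that by (intro Max_ge) auto
  have r0: "0 < r k" for k using rge[of k k] \<rho>(2)[of k] by simp
  have rlim: "r \<longlonglongrightarrow> 1"
  proof (rule tendsto_sandwich)
    show "eventually (\<lambda>k. 1 - 1 / real (k + 2) \<le> r k) sequentially" using rge by simp
    show "eventually (\<lambda>k. r k \<le> 1) sequentially" using r1 by (simp add: less_imp_le)
    show "(\<lambda>k. 1 - 1 / real (k + 2)) \<longlonglongrightarrow> 1"
      using tendsto_diff[OF tendsto_const LIMSEQ_ignore_initial_segment[OF lim_1_over_n, of 2], of 1] by simp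
  qed auto
  have disc: "cmod (of_real s * \<zeta>) < 1" if "cmod \<zeta> \<le> 1" "0 \<le> s" "s < 1" for s :: real and \<zeta>
    using that mult_left_le[of "cmod \<zeta>" s] by (simp add: norm_mult)
  have meas [measurable]: "(\<lambda>\<zeta>. f (of_real (r k) * \<zeta>)) \<in> borel_measurable circle_m" for k
  proof -
    have "continuous_on (sphere 0 1) (\<lambda>\<zeta>. f (of_real (r k) * \<zeta>))"
      using disc r0[of k] r1[of k]
      by (intro continuous_on_compose2[OF holomorphic_on_imp_continuous_on[OF hol]] continuous_intros) auto
    then show ?thesis
      unfolding measurable_cong_sets[OF sets_circle_m refl] by (rule borel_measurable_continuous_on_restrict)
  qed
  define u where "u k \<zeta> = f (of_real (r (Suc k)) * \<zeta>) - f (of_real (r k) * \<zeta>)" for k \<zeta>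
  have um [measurable]: "u k \<in> borel_measurable circle_m" for k unfolding u_def by measurable
  have u2: "cmod (u k \<zeta>) \<le> 2" if "cmod \<zeta> = 1" for k \<zeta>
  proof -
    have "cmod (u k \<zeta>) \<le> cmod (f (of_real (r (Suc k)) * \<zeta>)) + cmod (f (of_real (r k) * \<zeta>))"
      unfolding u_def by (rule norm_triangle_ineq4)
    also have "\<dots> \<le> 1 + 1" using that r0 r1 by (intro add_mono f1 disc) (auto simp: less_imp_le)
    finally show ?thesis by simp
  qed
  have ui: "integrable circle_m (u k)" for k
    using u2 by (intro circle_m.integrable_const_bound[of _ 2] AE_I2) auto
  have ui2: "integrable circle_m (\<lambda>\<zeta>. (cmod (u k \<zeta>))\<^sup>2)" for k
  proof (rule circle_m.integrable_const_bound[of _ "2\<^sup>2"])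
    show "AE \<zeta> in circle_m. norm ((cmod (u k \<zeta>))\<^sup>2) \<le> 2\<^sup>2"
    proof (rule AE_I2)
      fix \<zeta> assume "\<zeta> \<in> space circle_m"
      then have "(cmod (u k \<zeta>))\<^sup>2 \<le> 2\<^sup>2" using u2[of \<zeta> k] by (intro power_mono) auto
      then show "norm ((cmod (u k \<zeta>))\<^sup>2) \<le> 2\<^sup>2" by simp
    qed
  qed measurable
  have uL1: "integral\<^sup>L circle_m (\<lambda>\<zeta>. cmod (u k \<zeta>)) \<le> (1/2)^k" for k
  proof -
    have "integral\<^sup>L circle_m (\<lambda>\<zeta>. (cmod (u k \<zeta>))\<^sup>2) \<le> (1/4)^k"
      unfolding u_def using rge[of k k] rge[of k "Suc k"] r1 by (intro \<rho>(3)) auto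
    then have "2^k * integral\<^sup>L circle_m (\<lambda>\<zeta>. (cmod (u k \<zeta>))\<^sup>2) \<le> 2^k * (1/4)^k"
      by (intro mult_left_mono) auto
    also have "\<dots> = (1/2::real)^k" by (simp flip: power_mult_distrib)
    finally have sq: "2^k * integral\<^sup>L circle_m (\<lambda>\<zeta>. (cmod (u k \<zeta>))\<^sup>2) \<le> (1/2)^k" .
    \<comment> \<open>The weighted inequality \<open>x \<le> (2^k x^2 + 2^-k) / 2\<close> turns the
      bound \<open>4^-k\<close> for the square means into the summable bound \<open>2^-k\<close> for
      the means.\<close>
    have "integral\<^sup>L circle_m (\<lambda>\<zeta>. cmod (u k \<zeta>)) \<le> integral\<^sup>L circle_m (\<lambda>\<zeta>. (2^k * (cmod (u k \<zeta>))\<^sup>2 + (1/2)^k) / 2)"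
    proof (rule integral_mono)
      show "integrable circle_m (\<lambda>\<zeta>. cmod (u k \<zeta>))" using ui by auto
      show "integrable circle_m (\<lambda>\<zeta>. (2^k * (cmod (u k \<zeta>))\<^sup>2 + (1/2)^k) / 2)" using ui2 by auto
      fix \<zeta>
      define x where "x = cmod (u k \<zeta>)"
      have "0 \<le> 2^k * (x - (1/2)^k)\<^sup>2" by simp
      also have "\<dots> = 2^k * x\<^sup>2 + (2^k * (1/2)^k) * (1/2)^k - 2 * (2^k * (1/2)^k) * x"
        by (simp add: power2_eq_square algebra_simps)
      also have "2^k * (1/2)^k = (1::real)" by (simp flip: power_mult_distrib)
      finally show "x \<le> (2^k * x\<^sup>2 + (1/2)^k) / 2" by simp
    qed
    also have "\<dots> = (2^k * integral\<^sup>L circle_m (\<lambda>\<zeta>. (cmod (u k \<zeta>))\<^sup>2) + (1/2)^k) / 2"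
      using ui2 by (simp add: measure_def emeasure_circle_m_space)
    also have "\<dots> \<le> (1/2)^k" using sq by simp
    finally show ?thesis .
  qed
  have "AE \<zeta> in circle_m. (\<Sum>k. ennreal (cmod (u k \<zeta>))) \<noteq> \<infinity>"
  proof (rule nn_integral_PInf_AE)
    have "(\<integral>\<^sup>+\<zeta>. (\<Sum>k. ennreal (cmod (u k \<zeta>))) \<partial>circle_m) = (\<Sum>k. \<integral>\<^sup>+\<zeta>. ennreal (cmod (u k \<zeta>)) \<partial>circle_m)"
      by (rule nn_integral_suminf) measurable
    also have "\<dots> = (\<Sum>k. ennreal (integral\<^sup>L circle_m (\<lambda>\<zeta>. cmod (u k \<zeta>))))"
      using ui by (intro suminf_cong nn_integral_eq_integral) auto
    also have "\<dots> \<le> (\<Sum>k. ennreal ((1/2)^k))"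
      by (intro suminf_le ennreal_leI uL1 summableI)
    also have "\<dots> = ennreal (\<Sum>k. (1/2)^k)"
    proof (rule suminf_ennreal2)
      show "summable (\<lambda>k. (1/2::real)^k)" by (rule summable_geometric) simp
    qed simp
    finally show "(\<integral>\<^sup>+\<zeta>. (\<Sum>k. ennreal (cmod (u k \<zeta>))) \<partial>circle_m) \<noteq> \<infinity>"
      by (auto simp: top_unique)
  qed measurable
  then have conv: "AE \<zeta> in circle_m. convergent (\<lambda>k. f (of_real (r k) * \<zeta>))"
  proof eventually_elim
    case (elim \<zeta>)
    then have "summable (\<lambda>k. cmod (u k \<zeta>))" by (intro summable_suminf_not_top) auto
    then have "summable (\<lambda>k. u k \<zeta>)" by (rule summable_norm_cancel)
    then have "convergent (\<lambda>n. \<Sum>k<n. u k \<zeta>)" by (simp add: summable_iff_convergent)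
    then have "convergent (\<lambda>n. (f (of_real (r n) * \<zeta>) - f (of_real (r 0) * \<zeta>)) + f (of_real (r 0) * \<zeta>))"
      unfolding u_def sum_lessThan_telescope[of "\<lambda>k. f (of_real (r k) * \<zeta>)"]
      by (intro convergent_add convergent_const)
    then show ?case by simp
  qed
  define g where "g \<zeta> = lim (\<lambda>k. f (of_real (r k) * \<zeta>))" for \<zeta>
  have gm [measurable]: "g \<in> borel_measurable circle_m" unfolding g_def[abs_def] by measurable
  have glim: "AE \<zeta> in circle_m. (\<lambda>k. f (of_real (r k) * \<zeta>)) \<longlonglongrightarrow> g \<zeta>"
    using conv by eventually_elim (simp add: g_def convergent_LIMSEQ_iff)
  have fb: "cmod (f (of_real (r k) * \<zeta>)) \<le> 1" if "cmod \<zeta> = 1" for k \<zeta>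
    using that r0 r1 by (intro f1 disc) (auto simp: less_imp_le)
  have gi: "integrable circle_m g"
  proof (rule integrable_dominated_convergence[where w = "\<lambda>_. 1"])
    show "AE \<zeta> in circle_m. (\<lambda>k. f (of_real (r k) * \<zeta>)) \<longlonglongrightarrow> g \<zeta>" by (rule glim)
    show "AE \<zeta> in circle_m. cmod (f (of_real (r k) * \<zeta>)) \<le> 1" for k using fb by (intro AE_I2) auto
  qed auto
  \<comment> \<open>The dilates of \<open>f\<close> are holomorphic across the circle, so the
    Poisson formula holds for them; boundedness allows passage to the limit under the
    integral.\<close>
  have rep: "f z = integral\<^sup>L circle_m (\<lambda>\<zeta>. pkernel z \<zeta> *\<^sub>R g \<zeta>)" if z: "cmod z < 1" for z
  proof -
    have pm [measurable]: "pkernel z \<in> borel_measurable circle_m" by (intro borel_measurable_circle_mI) measurable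
    have "(\<lambda>k. integral\<^sup>L circle_m (\<lambda>\<zeta>. pkernel z \<zeta> *\<^sub>R f (of_real (r k) * \<zeta>))) \<longlonglongrightarrow> integral\<^sup>L circle_m (\<lambda>\<zeta>. pkernel z \<zeta> *\<^sub>R g \<zeta>)"
    proof (rule integral_dominated_convergence[where w = "pkernel z"])
      show "integrable circle_m (pkernel z)" by (rule pkernel_integral[OF z])
      show "AE \<zeta> in circle_m. (\<lambda>k. pkernel z \<zeta> *\<^sub>R f (of_real (r k) * \<zeta>)) \<longlonglongrightarrow> pkernel z \<zeta> *\<^sub>R g \<zeta>"
        using glim by eventually_elim (intro tendsto_intros)
      show "AE \<zeta> in circle_m. cmod (pkernel z \<zeta> *\<^sub>R f (of_real (r k) * \<zeta>)) \<le> pkernel z \<zeta>" for k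
        using fb pkernel_nonneg[of z] z by (intro AE_I2) (auto intro!: mult_left_le)
    qed measurable
    moreover have "integral\<^sup>L circle_m (\<lambda>\<zeta>. pkernel z \<zeta> *\<^sub>R f (of_real (r k) * \<zeta>)) = f (of_real (r k) * z)" for k
    proof -
      have "integral\<^sup>L circle_m (\<lambda>\<zeta>. of_real (pkernel z \<zeta>) * f (of_real (r k) * \<zeta>)) = f (of_real (r k) * z)"
      proof (rule Poisson_formula[OF _ _ z])
        show "(\<lambda>\<zeta>. f (of_real (r k) * \<zeta>)) holomorphic_on ball 0 (1 / r k)"
          using r0[of k] by (intro holomorphic_on_compose_gen[OF _ hol, unfolded o_def] holomorphic_intros)
            (auto simp: norm_mult field_simps)
        show "1 < 1 / r k" using r0[of k] r1[of k] by simp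
      qed
      then show ?thesis by (simp add: scaleR_conv_of_real)
    qed
    moreover have "(\<lambda>k. f (of_real (r k) * z)) \<longlonglongrightarrow> f (of_real 1 * z)"
    proof (rule continuous_on_tendsto_compose[OF holomorphic_on_imp_continuous_on[OF hol]])
      show "(\<lambda>k. of_real (r k) * z) \<longlonglongrightarrow> of_real 1 * z" by (intro tendsto_intros rlim)
      show "eventually (\<lambda>k. of_real (r k) * z \<in> ball 0 1) sequentially"
        using disc[of z] z r0 r1 by (auto simp: less_imp_le)
    qed (use z in auto)
    ultimately show ?thesis by (simp add: LIMSEQ_unique)
  qed
  show ?thesis
    using poisson_integral_radial_limit[OF gi] AE_space
  proof eventually_elim
    case (elim \<zeta>)
    have "eventually (\<lambda>s. integral\<^sup>L circle_m (\<lambda>w. pkernel (of_real s * \<zeta>) w *\<^sub>R g w) = f (of_real s * \<zeta>)) (at_left 1)"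
      using elim(2) disc by (intro eventually_at_leftI[of 0]) (auto intro!: rep[symmetric])
    with elim(1) have "((\<lambda>s. f (of_real s * \<zeta>)) \<longlongrightarrow> g \<zeta>) (at_left 1)"
      by (rule Lim_transform_eventually)
    then show ?case by blast
  qed
qed

section \<open>The singular part has no boundary values\<close>

text \<open>The denominator is unchanged when the radius is moved from \<open>w\<close> to
  \<open>b\<close>; only the numerators differ. A mean over \<open>w\<close> thus becomes the total
  mass of the kernel based at \<open>r b\<close>.\<close>

lemma pkernel_symmetric:
  assumes r: "0 \<le> r" "r < 1" and b: "cmod b \<le> 1" and w: "cmod w = 1"
  shows "pkernel (of_real r * w) b = (1 - r\<^sup>2) / (1 - r\<^sup>2 * (cmod b)\<^sup>2) * pkernel (of_real r * b) w"
proof -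
  have "cmod (1 - cnj b * (of_real r * w)) = cmod (cnj (1 - cnj w * (of_real r * b)))"
    by (simp add: mult_ac)
  then have e: "cmod (1 - cnj b * (of_real r * w)) = cmod (1 - cnj w * (of_real r * b))"
    by (simp only: complex_mod_cnj)
  have "r\<^sup>2 * (cmod b)\<^sup>2 \<le> r\<^sup>2 * 1" using b by (intro mult_left_mono) (auto simp: power_le_one)
  moreover have "r\<^sup>2 < 1" using r by (simp add: abs_square_less_1)
  ultimately have "1 - r\<^sup>2 * (cmod b)\<^sup>2 \<noteq> 0" by auto
  then show ?thesis unfolding pkernel_def e using r w by (simp add: norm_mult power_mult_distrib)
qed

lemma measurable_pkernel_circle [measurable]: "(\<lambda>\<zeta>. pkernel (of_real s * \<zeta>) w) \<in> borel_measurable circle_m"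
proof (rule borel_measurable_circle_mI)
  have "(\<lambda>\<zeta>::complex. of_real s * \<zeta>) \<in> borel_measurable borel" by measurable
  from measurable_compose[OF this pkernel_measurable(2)]
  show "(\<lambda>\<zeta>. pkernel (of_real s * \<zeta>) w) \<in> borel_measurable borel" .
qed

lemma nn_integral_pkernel_circle:
  assumes r: "0 \<le> r" "r < 1" and b: "cmod b \<le> 1"
  shows "(\<integral>\<^sup>+\<zeta>. ennreal (pkernel (of_real r * \<zeta>) b) \<partial>circle_m) = ennreal ((1 - r\<^sup>2) / (1 - r\<^sup>2 * (cmod b)\<^sup>2))"
proof -
  define q where "q = (1 - r\<^sup>2) / (1 - r\<^sup>2 * (cmod b)\<^sup>2)"
  have "r\<^sup>2 * (cmod b)\<^sup>2 \<le> r\<^sup>2 * 1" using b by (intro mult_left_mono) (auto simp: power_le_one)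
  moreover have "r\<^sup>2 < 1" using r by (simp add: abs_square_less_1)
  ultimately have q: "0 \<le> q" by (auto simp: q_def)
  have z: "cmod (of_real r * b) < 1" using r b mult_left_le[of "cmod b" r] by (simp add: norm_mult)
  have "(\<integral>\<^sup>+\<zeta>. ennreal (pkernel (of_real r * \<zeta>) b) \<partial>circle_m) = (\<integral>\<^sup>+\<zeta>. ennreal (q * pkernel (of_real r * b) \<zeta>) \<partial>circle_m)"
    unfolding q_def using r b by (intro nn_integral_cong) (simp add: pkernel_symmetric)
  also have "\<dots> = ennreal (integral\<^sup>L circle_m (\<lambda>\<zeta>. q * pkernel (of_real r * b) \<zeta>))"
    using pkernel_integral[OF z] pkernel_nonneg[of "of_real r * b"] z q
    by (intro nn_integral_eq_integral) auto
  also have "\<dots> = ennreal q" using pkernel_integral[OF z] by simp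
  finally show ?thesis by (simp add: q_def)
qed

lemma pos_singular_measureD:
  assumes "pos_singular_measure \<nu>"
  shows "sets \<nu> = sets (restrict_space borel (sphere 0 1))" "space \<nu> = sphere 0 1" "finite_measure \<nu>"
proof -
  show s: "sets \<nu> = sets (restrict_space borel (sphere 0 1))" using assms by (simp add: pos_singular_measure_def)
  show sp: "space \<nu> = sphere 0 1" using sets_eq_imp_space_eq[OF s] by (simp add: space_restrict_space)
  show "finite_measure \<nu>" using assms by (intro finite_measureI) (auto simp: pos_singular_measure_def sp)
qed

lemma poisson_pair_measurable:
  assumes s: "sets \<nu> = sets (restrict_space borel (sphere (0::complex) 1))"
  shows "(\<lambda>p. ennreal (pkernel (of_real r * fst p) (snd p))) \<in> borel_measurable (circle_m \<Otimes>\<^sub>M \<nu>)"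
proof -
  have i: "(\<lambda>x. x) \<in> borel_measurable M" if "sets M = sets (restrict_space borel (sphere (0::complex) 1))" for M
    using measurable_restrict_space1[of "\<lambda>x. x" borel borel "sphere (0::complex) 1"]
    by (simp add: measurable_cong_sets[OF that refl])
  have [measurable]: "fst \<in> borel_measurable (circle_m \<Otimes>\<^sub>M \<nu>)" "snd \<in> borel_measurable (circle_m \<Otimes>\<^sub>M \<nu>)"
    using measurable_compose[OF measurable_fst i[OF sets_circle_m]] measurable_compose[OF measurable_snd i[OF s]] by auto
  show ?thesis unfolding pkernel_def by measurable
qed

lemma poisson_measure_measurable:
  assumes \<nu>: "sets \<nu> = sets (restrict_space borel (sphere (0::complex) 1))" "finite_measure \<nu>"
  shows "(\<lambda>\<zeta>. \<integral>\<^sup>+w. ennreal (pkernel (of_real s * \<zeta>) w) \<partial>\<nu>) \<in> borel_measurable circle_m"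
proof -
  interpret \<nu>: finite_measure \<nu> by (rule \<nu>)
  show ?thesis
  proof (rule \<nu>.borel_measurable_nn_integral)
    show "(\<lambda>(\<zeta>, w). ennreal (pkernel (of_real s * \<zeta>) w)) \<in> borel_measurable (circle_m \<Otimes>\<^sub>M \<nu>)"
      using poisson_pair_measurable[OF \<nu>(1)] by (simp add: case_prod_unfold)
  qed
qed

text \<open>The circle mean of the kernel of a zero, times its weight, tends to 0 with a summable
  majorant, so the zeros need no restriction to \<open>F\<close>. For a point of the circle the mean
  is 1 at every radius; here \<open>F\<close> matters, since the kernel of a point off
  \<open>F\<close> tends to 0 uniformly on \<open>F\<close>, and \<open>\<nu>\<close> does not
  charge \<open>F\<close>.\<close>

lemma singular_mass_off_support:
  assumes b: "\<And>n. cmod (b n) \<le> 1" and sb: "summable (\<lambda>n. 1 - cmod (b n))"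
    and \<nu>: "pos_singular_measure \<nu>" and F: "compact F" "F \<subseteq> sphere 0 1" and \<nu>F: "emeasure \<nu> F = 0"
    and r_def: "\<And>k. r k = 1 - 1 / real (k + 2)"
  shows "(\<lambda>k. \<integral>\<^sup>+\<zeta>. ((\<Sum>n. ennreal ((1 - (cmod (b n))\<^sup>2) * pkernel (of_real (r k) * \<zeta>) (b n)))
           + (\<integral>\<^sup>+w. ennreal (pkernel (of_real (r k) * \<zeta>) w) \<partial>\<nu>)) * indicator F \<zeta> \<partial>circle_m) \<longlonglongrightarrow> 0"
proof -
  note \<nu>D = pos_singular_measureD[OF \<nu>]
  have [measurable_cong]: "sets \<nu> = sets (restrict_space borel (sphere 0 1))" by (rule \<nu>D)
  interpret \<nu>: finite_measure \<nu> by (rule \<nu>D)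
  interpret P: pair_sigma_finite circle_m \<nu> ..
  have r: "0 \<le> r k" "r k < 1" for k by (auto simp: r_def)
  have r2: "(r k)\<^sup>2 < 1" for k using r by (simp add: abs_square_less_1)
  have rlim: "r \<longlonglongrightarrow> 1"
    unfolding r_def using tendsto_diff[OF tendsto_const LIMSEQ_ignore_initial_segment[OF lim_1_over_n, of 2], of 1] by simp
  have Fs: "F \<in> sets circle_m"
    unfolding sets_circle_m using F by (auto simp: sets_restrict_space intro!: image_eqI[of _ _ F] borel_compact)
  then have [measurable]: "F \<in> sets (restrict_space borel (sphere 0 1))" by (simp add: sets_circle_m)
  note pm = poisson_pair_measurable[OF \<nu>D(1)]
  have nm [measurable]: "(\<lambda>\<zeta>. \<integral>\<^sup>+w. ennreal (pkernel (of_real s * \<zeta>) w) \<partial>\<nu>) \<in> borel_measurable circle_m" for s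
    by (rule poisson_measure_measurable[OF \<nu>D(1,3)])
  define S1 where "S1 k = (\<integral>\<^sup>+\<zeta>. (\<Sum>n. ennreal ((1 - (cmod (b n))\<^sup>2) * pkernel (of_real (r k) * \<zeta>) (b n))) \<partial>circle_m)" for k
  define S2 where "S2 k = (\<integral>\<^sup>+\<zeta>. (\<integral>\<^sup>+w. ennreal (pkernel (of_real (r k) * \<zeta>) w) \<partial>\<nu>) * indicator F \<zeta> \<partial>circle_m)" for k
  have lim1: "S1 \<longlonglongrightarrow> 0"
  proof -
    define q where "q n k = (1 - (cmod (b n))\<^sup>2) * ((1 - (r k)\<^sup>2) / (1 - (r k)\<^sup>2 * (cmod (b n))\<^sup>2))" for n k
    have b2: "0 \<le> 1 - (cmod (b n))\<^sup>2" for n using b by (simp add: power_le_one)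
    have den: "1 - (r k)\<^sup>2 \<le> 1 - (r k)\<^sup>2 * (cmod (b n))\<^sup>2" for k n
      using b by (simp add: mult_left_le power_le_one)
    have q0: "0 \<le> q n k" for n k
      unfolding q_def using b2 den[of k n] r2[of k] by (intro mult_nonneg_nonneg divide_nonneg_nonneg) auto
    have qle: "q n k \<le> 2 * (1 - cmod (b n))" for n k
    proof -
      have "(1 - (r k)\<^sup>2) / (1 - (r k)\<^sup>2 * (cmod (b n))\<^sup>2) \<le> 1"
        using den[of k n] r2[of k] by (subst divide_le_eq_1_pos) auto
      then have "q n k \<le> 1 - (cmod (b n))\<^sup>2" unfolding q_def using b2 by (intro mult_left_le) auto
      also have "\<dots> \<le> 2 * (1 - cmod (b n))" using one_minus_square_le b by simp
      finally show ?thesis .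
    qed
    have qs: "summable (\<lambda>n. q n k)" for k
    proof (rule summable_comparison_test'[of "\<lambda>n. 2 * (1 - cmod (b n))" 0])
      show "norm (q n k) \<le> 2 * (1 - cmod (b n))" for n using q0[of n k] qle[of n k] by simp
    qed (intro summable_mult sb)
    have S1q: "S1 k = ennreal (\<Sum>n. q n k)" for k
    proof -
      have "S1 k = (\<Sum>n. \<integral>\<^sup>+\<zeta>. ennreal ((1 - (cmod (b n))\<^sup>2) * pkernel (of_real (r k) * \<zeta>) (b n)) \<partial>circle_m)"
        unfolding S1_def by (rule nn_integral_suminf) measurable
      also have "\<dots> = (\<Sum>n. ennreal (q n k))"
      proof (intro suminf_cong)
        fix n
        have "(\<integral>\<^sup>+\<zeta>. ennreal ((1 - (cmod (b n))\<^sup>2) * pkernel (of_real (r k) * \<zeta>) (b n)) \<partial>circle_m)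
            = (\<integral>\<^sup>+\<zeta>. ennreal (1 - (cmod (b n))\<^sup>2) * ennreal (pkernel (of_real (r k) * \<zeta>) (b n)) \<partial>circle_m)"
          using b2 by (intro nn_integral_cong) (simp add: ennreal_mult')
        also have "\<dots> = ennreal (1 - (cmod (b n))\<^sup>2) * (\<integral>\<^sup>+\<zeta>. ennreal (pkernel (of_real (r k) * \<zeta>) (b n)) \<partial>circle_m)"
          by (rule nn_integral_cmult) measurable
        also have "\<dots> = ennreal (q n k)"
          unfolding nn_integral_pkernel_circle[OF r b] q_def by (rule ennreal_mult'[OF b2, symmetric])
        finally show "(\<integral>\<^sup>+\<zeta>. ennreal ((1 - (cmod (b n))\<^sup>2) * pkernel (of_real (r k) * \<zeta>) (b n)) \<partial>circle_m) = ennreal (q n k)" .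
      qed
      also have "\<dots> = ennreal (\<Sum>n. q n k)" using q0 qs by (rule suminf_ennreal2)
      finally show ?thesis .
    qed
    have "(\<lambda>k. \<Sum>n. q n k) \<longlonglongrightarrow> (\<Sum>n. 0)"
    proof (rule tannerys_theorem[THEN conjunct2, THEN conjunct2])
      show "(\<lambda>k. q n k) \<longlonglongrightarrow> 0" for n
      proof (cases "cmod (b n) = 1")
        case True
        then show ?thesis by (simp add: q_def)
      next
        case False
        then have "(cmod (b n))\<^sup>2 < 1" using b[of n] by (simp add: abs_square_less_1)
        then have "(\<lambda>k. q n k) \<longlonglongrightarrow> (1 - (cmod (b n))\<^sup>2) * ((1 - 1\<^sup>2) / (1 - 1\<^sup>2 * (cmod (b n))\<^sup>2))"
          unfolding q_def by (intro tendsto_intros rlim) auto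
        then show ?thesis by simp
      qed
      show "eventually (\<lambda>(n, k). norm (q n k) \<le> 2 * (1 - cmod (b n))) (at_top \<times>\<^sub>F sequentially)"
        using q0 qle by (intro always_eventually) (auto simp: abs_of_nonneg)
      show "summable (\<lambda>n. 2 * (1 - cmod (b n)))" by (intro summable_mult sb)
    qed simp
    then have "(\<lambda>k. ennreal (\<Sum>n. q n k)) \<longlonglongrightarrow> ennreal (\<Sum>n::nat. 0)" by (rule tendsto_ennrealI)
    moreover have "S1 = (\<lambda>k. ennreal (\<Sum>n. q n k))" by (intro ext S1q)
    ultimately show ?thesis by simp
  qed
  have lim2: "S2 \<longlonglongrightarrow> 0"
  proof -
    define J where "J k w = (\<integral>\<^sup>+\<zeta>. ennreal (pkernel (of_real (r k) * \<zeta>) w) * indicator F \<zeta> \<partial>circle_m)" for k w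
    have pm2: "(\<lambda>p. ennreal (pkernel (of_real (r k) * fst p) (snd p)) * indicator F (fst p)) \<in> borel_measurable (circle_m \<Otimes>\<^sub>M \<nu>)" for k
      using pm Fs by measurable
    have J_meas [measurable]: "J k \<in> borel_measurable \<nu>" for k
    proof -
      have "(\<lambda>(w, \<zeta>). ennreal (pkernel (of_real (r k) * \<zeta>) w) * indicator F \<zeta>) \<in> borel_measurable (\<nu> \<Otimes>\<^sub>M circle_m)"
        using measurable_compose[OF measurable_pair_swap' pm2[of k]] by (simp add: case_prod_unfold)
      then show ?thesis unfolding J_def[abs_def] by (rule circle_m.borel_measurable_nn_integral)
    qed
    have S2J: "S2 k = (\<integral>\<^sup>+w. J k w \<partial>\<nu>)" for k
    proof -
      have "S2 k = (\<integral>\<^sup>+\<zeta>. (\<integral>\<^sup>+w. ennreal (pkernel (of_real (r k) * \<zeta>) w) * indicator F \<zeta> \<partial>\<nu>) \<partial>circle_m)"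
        unfolding S2_def
      proof (intro nn_integral_cong nn_integral_multc[symmetric])
        fix \<zeta> assume "\<zeta> \<in> space circle_m"
        show "(\<lambda>w. ennreal (pkernel (of_real (r k) * \<zeta>) w)) \<in> borel_measurable \<nu>"
          by (simp add: measurable_cong_sets[OF \<nu>D(1) refl] measurable_restrict_space1)
      qed
      also have "\<dots> = (\<integral>\<^sup>+w. J k w \<partial>\<nu>)"
        unfolding J_def using P.Fubini'[of "\<lambda>\<zeta> w. ennreal (pkernel (of_real (r k) * \<zeta>) w) * indicator F \<zeta>"] pm2[of k]
        by (simp add: case_prod_unfold)
      finally show ?thesis .
    qed
    have Jle: "J k w \<le> 1" if "cmod w = 1" for k w
    proof -
      have "J k w \<le> (\<integral>\<^sup>+\<zeta>. ennreal (pkernel (of_real (r k) * \<zeta>) w) \<partial>circle_m)"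
        unfolding J_def by (intro nn_integral_mono) (auto simp: indicator_def)
      also have "\<dots> = 1" using nn_integral_pkernel_circle[OF r, of w k] that r2[of k] by simp
      finally show ?thesis .
    qed
    have Jlim: "(\<lambda>k. J k w) \<longlonglongrightarrow> 0" if w: "cmod w = 1" "w \<notin> F" for w
    proof -
      have "closed F" using F compact_imp_closed by blast
      then obtain d where d: "0 < d" "\<And>\<zeta>. \<zeta> \<in> F \<Longrightarrow> d \<le> dist w \<zeta>"
        using separate_point_closed[of F w] w by blast
      define B where "B k = (1 - (r k)\<^sup>2) / (d/2)\<^sup>2" for k
      have "eventually (\<lambda>k. 1 - d/2 < r k) sequentially"
        using d by (intro order_tendstoD(1)[OF rlim]) auto
      then have "eventually (\<lambda>k. J k w \<le> ennreal (B k)) sequentially"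
      proof eventually_elim
        case (elim k)
        have "J k w \<le> (\<integral>\<^sup>+\<zeta>. ennreal (B k) \<partial>circle_m)"
          unfolding J_def
        proof (rule nn_integral_mono)
          fix \<zeta> assume "\<zeta> \<in> space circle_m"
          then have z: "cmod \<zeta> = 1" by simp
          show "ennreal (pkernel (of_real (r k) * \<zeta>) w) * indicator F \<zeta> \<le> ennreal (B k)"
          proof (cases "\<zeta> \<in> F")
            case True
            have "cmod (w - \<zeta>) \<le> cmod (w - of_real (r k) * \<zeta>) + cmod (of_real (r k) * \<zeta> - \<zeta>)"
              by (metis add_diff_eq diff_add_cancel norm_triangle_ineq)
            moreover have "cmod (of_real (r k) * \<zeta> - \<zeta>) = 1 - r k"
            proof -
              have "of_real (r k) * \<zeta> - \<zeta> = of_real (r k - 1) * \<zeta>" by (simp add: algebra_simps)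
              then have "cmod (of_real (r k) * \<zeta> - \<zeta>) = \<bar>r k - 1\<bar> * cmod \<zeta>" by (simp only: norm_mult norm_of_real)
              then show ?thesis using z r[of k] by simp
            qed
            moreover have "d \<le> cmod (w - \<zeta>)" using d(2)[OF True] by (simp add: dist_norm)
            ultimately have "d/2 \<le> cmod (w - of_real (r k) * \<zeta>)" using elim by simp
            also have "\<dots> = cmod (1 - cnj w * (of_real (r k) * \<zeta>))"
            proof -
              have "w * cnj w = 1" using complex_norm_square[of w] w by simp
              then have "w * (1 - cnj w * (of_real (r k) * \<zeta>)) = w - of_real (r k) * \<zeta>"
                by (simp add: right_diff_distrib mult.assoc[symmetric])
              then show ?thesis using w by (metis mult_1 norm_mult)
            qed
            finally have "(d/2)\<^sup>2 \<le> (cmod (1 - cnj w * (of_real (r k) * \<zeta>)))\<^sup>2" using d by (intro power_mono) auto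
            moreover have "1 - (cmod (of_real (r k) * \<zeta>))\<^sup>2 = 1 - (r k)\<^sup>2" using z by (simp add: norm_mult)
            moreover have "0 < (d/2)\<^sup>2" using d by simp
            ultimately have "pkernel (of_real (r k) * \<zeta>) w \<le> B k"
              unfolding pkernel_def B_def using r2[of k] by (intro frac_le) auto
            then show ?thesis using True by (simp add: ennreal_leI)
          qed simp
        qed
        also have "\<dots> = ennreal (B k)" by (simp add: emeasure_circle_m_space)
        finally show ?case .
      qed
      moreover have "(\<lambda>k. ennreal (B k)) \<longlonglongrightarrow> 0"
      proof -
        have "B \<longlonglongrightarrow> (1 - 1\<^sup>2) / (d/2)\<^sup>2" unfolding B_def using d by (intro tendsto_intros rlim) auto
        then show ?thesis using tendsto_ennrealI[of B 0] by simp
      qed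
      ultimately show ?thesis
        by (intro tendsto_sandwich[of "\<lambda>_. 0" "\<lambda>k. J k w" sequentially "\<lambda>k. ennreal (B k)"]) auto
    qed
    have "(\<lambda>k. \<integral>\<^sup>+w. J k w \<partial>\<nu>) \<longlonglongrightarrow> (\<integral>\<^sup>+w. 0 \<partial>\<nu>)"
    proof (rule nn_integral_dominated_convergence[where w = "\<lambda>_. 1"])
      show "AE w in \<nu>. J k w \<le> 1" for k using Jle \<nu>D(2) by (intro AE_I2) auto
      show "(\<integral>\<^sup>+w. 1 \<partial>\<nu>) < \<infinity>" using \<nu>.emeasure_finite[of "space \<nu>"] by (simp add: less_top[symmetric])
      have "F \<in> null_sets \<nu>" using \<nu>F by (simp add: null_sets_def)
      then show "AE w in \<nu>. (\<lambda>k. J k w) \<longlonglongrightarrow> 0"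
        using AE_not_in[of F \<nu>] AE_space[of \<nu>]
        by (auto elim!: eventually_elim2 intro: Jlim simp: \<nu>D(2))
    qed auto
    then show ?thesis by (simp add: S2J[abs_def])
  qed
  have le: "(\<integral>\<^sup>+\<zeta>. ((\<Sum>n. ennreal ((1 - (cmod (b n))\<^sup>2) * pkernel (of_real (r k) * \<zeta>) (b n)))
           + (\<integral>\<^sup>+w. ennreal (pkernel (of_real (r k) * \<zeta>) w) \<partial>\<nu>)) * indicator F \<zeta> \<partial>circle_m) \<le> S1 k + S2 k" for k
  proof -
    have "(\<integral>\<^sup>+\<zeta>. ((\<Sum>n. ennreal ((1 - (cmod (b n))\<^sup>2) * pkernel (of_real (r k) * \<zeta>) (b n)))
           + (\<integral>\<^sup>+w. ennreal (pkernel (of_real (r k) * \<zeta>) w) \<partial>\<nu>)) * indicator F \<zeta> \<partial>circle_m)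
        \<le> (\<integral>\<^sup>+\<zeta>. (\<Sum>n. ennreal ((1 - (cmod (b n))\<^sup>2) * pkernel (of_real (r k) * \<zeta>) (b n)))
           + (\<integral>\<^sup>+w. ennreal (pkernel (of_real (r k) * \<zeta>) w) \<partial>\<nu>) * indicator F \<zeta> \<partial>circle_m)"
      by (intro nn_integral_mono) (auto simp: indicator_def)
    also have "\<dots> = S1 k + S2 k"
      unfolding S1_def S2_def using Fs by (intro nn_integral_add) measurable
    finally show ?thesis .
  qed
  have "(\<lambda>k. S1 k + S2 k) \<longlonglongrightarrow> 0" using tendsto_add[OF lim1 lim2] by simp
  show ?thesis
    by (rule tendsto_sandwich[OF always_eventually always_eventually tendsto_const \<open>(\<lambda>k. S1 k + S2 k) \<longlonglongrightarrow> 0\<close>])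
      (intro allI zero_le, intro allI le)
qed

text \<open>A set of positive measure with nonzero lower limit would, off the carrier
  \<open>N\<close> of \<open>\<nu>\<close>, contain a compact set \<open>K\<close> of positive
  measure. The integrals over \<open>K\<close> tend to 0, so Fatou's lemma makes the lower limit
  vanish almost everywhere on \<open>K\<close>. Convergence of integrals alone yields no pointwise
  limit, hence the lower limit.\<close>

lemma singular_part_liminf:
  assumes b: "\<And>n. cmod (b n) \<le> 1" and sb: "summable (\<lambda>n. 1 - cmod (b n))"
    and \<nu>: "pos_singular_measure \<nu>" and r_def: "\<And>k. r k = 1 - 1 / real (k + 2)"
  shows "AE \<zeta> in circle_m. liminf (\<lambda>k. (\<Sum>n. ennreal ((1 - (cmod (b n))\<^sup>2) * pkernel (of_real (r k) * \<zeta>) (b n)))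
           + (\<integral>\<^sup>+w. ennreal (pkernel (of_real (r k) * \<zeta>) w) \<partial>\<nu>)) = 0"
proof -
  define W where "W k \<zeta> = (\<Sum>n. ennreal ((1 - (cmod (b n))\<^sup>2) * pkernel (of_real (r k) * \<zeta>) (b n)))
           + (\<integral>\<^sup>+w. ennreal (pkernel (of_real (r k) * \<zeta>) w) \<partial>\<nu>)" for k \<zeta>
  note \<nu>D = pos_singular_measureD[OF \<nu>]
  have [measurable_cong]: "sets \<nu> = sets (restrict_space borel (sphere 0 1))" by (rule \<nu>D)
  interpret \<nu>: finite_measure \<nu> by (rule \<nu>D)
  obtain N where N: "N \<in> sets \<nu>" "emeasure circle_m N = 0" "emeasure \<nu> (sphere 0 1 - N) = 0"
    using \<nu> by (auto simp: pos_singular_measure_def)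
  have nm [measurable]: "(\<lambda>\<zeta>. \<integral>\<^sup>+w. ennreal (pkernel (of_real s * \<zeta>) w) \<partial>\<nu>) \<in> borel_measurable circle_m" for s
    by (rule poisson_measure_measurable[OF \<nu>D(1,3)])
  have Wm [measurable]: "W k \<in> borel_measurable circle_m" for k unfolding W_def by measurable
  define Z where "Z = {\<zeta> \<in> space circle_m. liminf (\<lambda>k. W k \<zeta>) \<noteq> 0}"
  have Zs: "Z \<in> sets circle_m" unfolding Z_def by measurable
  have Ns: "N \<in> sets circle_m" using N(1) by (simp add: \<nu>D(1) sets_circle_m)
  \<comment> \<open>Inner regularity concerns Borel measures on the whole plane, so
    \<open>circle_m\<close> is pushed forward from the circle.\<close>
  define M where "M = distr circle_m borel (\<lambda>x. x)"
  have idm: "(\<lambda>x. x) \<in> measurable circle_m borel" by (rule borel_measurable_circle_mI) simp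
  have sub: "A \<inter> space circle_m \<in> sets circle_m" if "A \<in> sets borel" for A
    using that unfolding sets_circle_m by (auto simp: sets_restrict_space)
  have bor: "A \<in> sets borel" if "A \<in> sets circle_m" for A
    using that unfolding sets_circle_m by (auto simp: sets_restrict_space)
  have eM: "emeasure M A = emeasure circle_m A" if "A \<in> sets circle_m" for A
    using emeasure_distr[OF idm bor[OF that]] sets.sets_into_space[OF that] by (simp add: M_def Int_absorb2)
  have "emeasure circle_m (Z - N) = 0"
  proof (rule ccontr)
    assume "emeasure circle_m (Z - N) \<noteq> 0"
    then have "0 < emeasure M (Z - N)" using eM[of "Z - N"] Zs Ns by (simp add: zero_less_iff_neq_zero)
    also have "emeasure M (Z - N) = (SUP K\<in>{K. K \<subseteq> Z - N \<and> compact K}. emeasure M K)"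
    proof (rule inner_regular)
      show "emeasure M (space M) \<noteq> \<infinity>"
        using emeasure_distr[OF idm, of UNIV] by (simp add: M_def emeasure_circle_m_space)
      show "Z - N \<in> sets borel" using Zs Ns by (intro bor) auto
    qed (simp add: M_def)
    finally obtain K where K: "K \<subseteq> Z - N" "compact K" "0 < emeasure M K"
      by (auto simp: less_SUP_iff)
    have Ksub: "K \<subseteq> sphere 0 1" using K(1) by (auto simp: Z_def)
    have Ks: "K \<in> sets circle_m" using sub[of K] K(2) Ksub by (simp add: borel_compact Int_absorb2)
    then have [measurable]: "K \<in> sets (restrict_space borel (sphere 0 1))" by (simp add: sets_circle_m)
    have \<nu>K: "emeasure \<nu> K = 0"
    proof -
      have "sphere 0 1 - N \<in> sets \<nu>" using N(1) \<nu>D(2) by (metis sets.compl_sets)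
      then have "emeasure \<nu> K \<le> emeasure \<nu> (sphere 0 1 - N)" using K(1) Ksub by (intro emeasure_mono) auto
      then show ?thesis using N(3) by simp
    qed
    have "(\<lambda>k. \<integral>\<^sup>+\<zeta>. W k \<zeta> * indicator K \<zeta> \<partial>circle_m) \<longlonglongrightarrow> 0"
      unfolding W_def by (rule singular_mass_off_support[OF b sb \<nu> K(2) Ksub \<nu>K r_def])
    then have lim: "liminf (\<lambda>k. \<integral>\<^sup>+\<zeta>. W k \<zeta> * indicator K \<zeta> \<partial>circle_m) = 0"
      by (intro lim_imp_Liminf) auto
    have "(\<integral>\<^sup>+\<zeta>. liminf (\<lambda>k. W k \<zeta> * indicator K \<zeta>) \<partial>circle_m) \<le> liminf (\<lambda>k. \<integral>\<^sup>+\<zeta>. W k \<zeta> * indicator K \<zeta> \<partial>circle_m)"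
      using Ks by (intro nn_integral_liminf) measurable
    then have "(\<integral>\<^sup>+\<zeta>. liminf (\<lambda>k. W k \<zeta> * indicator K \<zeta>) \<partial>circle_m) = 0" using lim by simp
    then have "AE \<zeta> in circle_m. liminf (\<lambda>k. W k \<zeta> * indicator K \<zeta>) = 0"
      using Ks by (subst (asm) nn_integral_0_iff_AE) measurable
    then have "AE \<zeta> in circle_m. \<zeta> \<notin> K"
    proof eventually_elim
      case (elim \<zeta>)
      then show ?case using K(1) by (cases "\<zeta> \<in> K") (auto simp: Z_def)
    qed
    then have "K \<in> null_sets circle_m" using AE_iff_null_sets[OF Ks] by simp
    then have "emeasure circle_m K = 0" by auto
    then show False using K(3) eM[OF Ks] by simp
  qed
  then have "Z - N \<in> null_sets circle_m" using Zs Ns by (simp add: null_sets_def)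
  moreover have "N \<in> null_sets circle_m" using N(2) Ns by (simp add: null_sets_def)
  ultimately have "(Z - N) \<union> N \<in> null_sets circle_m" by (rule null_sets.Un)
  then have "AE \<zeta> in circle_m. liminf (\<lambda>k. W k \<zeta>) = 0"
    by (rule AE_I') (auto simp: Z_def)
  then show ?thesis by (simp add: W_def)
qed

section \<open>Blaschke products and their zeros\<close>

lemma prod_one_minus_upper:
  fixes x :: "nat \<Rightarrow> real"
  assumes x: "\<And>n. 0 \<le> x n" "\<And>n. x n \<le> 1" "summable x" and lim: "(\<lambda>N. \<Prod>n<N. 1 - x n) \<longlonglongrightarrow> p"
  shows "p \<le> exp (- suminf x)"
proof (rule LIMSEQ_le[OF lim])
  show "(\<lambda>N. exp (- (\<Sum>n<N. x n))) \<longlonglongrightarrow> exp (- suminf x)"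
    using x(3) by (intro tendsto_intros summable_LIMSEQ)
  have "(\<Prod>n<N. 1 - x n) \<le> exp (- (\<Sum>n<N. x n))" for N
  proof -
    have "(\<Prod>n<N. 1 - x n) \<le> (\<Prod>n<N. exp (- x n))"
    proof (rule prod_mono)
      show "0 \<le> 1 - x n \<and> 1 - x n \<le> exp (- x n)" for n
        using x(2)[of n] exp_ge_add_one_self[of "- x n"] by simp
    qed
    then show ?thesis by (simp add: exp_sum[symmetric] sum_negf)
  qed
  then show "\<exists>N. \<forall>n\<ge>N. (\<Prod>n<n. 1 - x n) \<le> exp (- (\<Sum>n<n. x n))" by blast
qed

text \<open>Rests on \<open>1 / (1 - y) = 1 + y / (1 - y) \<le> 1 + y / \<sigma> \<le> exp (y /
  \<sigma>)\<close>, where the floor \<open>\<sigma>\<close> for the factors is essential.\<close>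

lemma prod_one_minus_lower:
  fixes x :: "nat \<Rightarrow> real"
  assumes x: "\<And>n. 0 \<le> x n" "\<And>n. x n \<le> 1 - \<sigma>" "summable x" and \<sigma>: "0 < \<sigma>"
    and lim: "(\<lambda>N. \<Prod>n<N. 1 - x n) \<longlonglongrightarrow> p"
  shows "exp (- (suminf x / \<sigma>)) \<le> p"
proof (rule LIMSEQ_le[OF _ lim])
  show "(\<lambda>N. exp (- ((\<Sum>n<N. x n) / \<sigma>))) \<longlonglongrightarrow> exp (- (suminf x / \<sigma>))"
    using x(3) \<sigma> by (intro tendsto_intros summable_LIMSEQ) auto
  have one: "exp (- (y / \<sigma>)) \<le> 1 - y" if "0 \<le> y" "y \<le> 1 - \<sigma>" for y
  proof -
    have "1 / (1 - y) = 1 + y / (1 - y)" using that \<sigma> by (simp add: field_simps)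
    also have "\<dots> \<le> 1 + y / \<sigma>" using that \<sigma> by (intro add_left_mono divide_left_mono) auto
    also have "\<dots> \<le> exp (y / \<sigma>)" by (rule exp_ge_add_one_self)
    finally have "1 \<le> exp (y / \<sigma>) * (1 - y)" using that \<sigma> by (simp add: divide_le_eq)
    then have "exp (- (y / \<sigma>)) * 1 \<le> exp (- (y / \<sigma>)) * (exp (y / \<sigma>) * (1 - y))"
      by (intro mult_left_mono) auto
    then show ?thesis by (simp add: exp_minus field_simps)
  qed
  have "exp (- ((\<Sum>n<N. x n) / \<sigma>)) \<le> (\<Prod>n<N. 1 - x n)" for N
  proof -
    have "(\<Prod>n<N. exp (- (x n / \<sigma>))) \<le> (\<Prod>n<N. 1 - x n)"
      using one x by (intro prod_mono) auto
    then show ?thesis by (simp add: exp_sum[symmetric] sum_negf sum_divide_distrib)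
  qed
  then show "\<exists>N. \<forall>n\<ge>N. exp (- ((\<Sum>n<n. x n) / \<sigma>)) \<le> (\<Prod>n<n. 1 - x n)" by blast
qed

text \<open>Passes from a set of zeros weighted by multiplicity to a sequence with repetitions.
  Entries outside \<open>Z\<close>, such as filler, must contribute 0.\<close>

lemma infsum_fibers_eq_suminf:
  fixes b :: "nat \<Rightarrow> 'a" and G :: "'a \<Rightarrow> ennreal"
  assumes fin: "\<And>a. a \<in> Z \<Longrightarrow> finite {n. b n = a}" and G0: "\<And>n. b n \<notin> Z \<Longrightarrow> G (b n) = 0"
  shows "infsum (\<lambda>a. of_nat (card {n. b n = a}) * G a) Z = (\<Sum>n. G (b n))"
proof -
  have fib: "(\<Sum>a\<in>F. of_nat (card {n. b n = a}) * G a) = (\<Sum>n\<in>b -` F. G (b n)) \<and> finite (b -` F)"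
    if F: "finite F" "F \<subseteq> Z" for F
  proof
    have U: "b -` F = (\<Union>a\<in>F. {n. b n = a})" by auto
    show "finite (b -` F)" unfolding U using F fin by auto
    have "(\<Sum>n\<in>b -` F. G (b n)) = (\<Sum>a\<in>F. \<Sum>n\<in>{n. b n = a}. G (b n))"
      unfolding U using F fin by (intro sum.UNION_disjoint) auto
    also have "\<dots> = (\<Sum>a\<in>F. of_nat (card {n. b n = a}) * G a)"
      by (intro sum.cong refl) simp
    finally show "(\<Sum>a\<in>F. of_nat (card {n. b n = a}) * G a) = (\<Sum>n\<in>b -` F. G (b n))" by simp
  qed
  have "infsum (\<lambda>a. of_nat (card {n. b n = a}) * G a) Z = (SUP F\<in>{F. finite F \<and> F \<subseteq> Z}. \<Sum>a\<in>F. of_nat (card {n. b n = a}) * G a)"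
    by (rule nonneg_infsum_complete) simp
  also have "\<dots> = (\<Sum>n. G (b n))"
  proof (rule antisym)
    show "(SUP F\<in>{F. finite F \<and> F \<subseteq> Z}. \<Sum>a\<in>F. of_nat (card {n. b n = a}) * G a) \<le> (\<Sum>n. G (b n))"
      using fib by (intro SUP_least) (auto intro!: sum_le_suminf)
    have "(\<Sum>n<N. G (b n)) \<le> (SUP F\<in>{F. finite F \<and> F \<subseteq> Z}. \<Sum>a\<in>F. of_nat (card {n. b n = a}) * G a)" for N
    proof -
      define F where "F = b ` {..<N} \<inter> Z"
      have F: "finite F" "F \<subseteq> Z" by (auto simp: F_def)
      have "(\<Sum>n<N. G (b n)) = (\<Sum>n\<in>{n\<in>{..<N}. b n \<in> Z}. G (b n))"
        using G0 by (intro sum.mono_neutral_right) auto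
      also have "\<dots> \<le> (\<Sum>n\<in>b -` F. G (b n))"
        using fib[OF F] by (intro sum_mono2) (auto simp: F_def)
      also have "\<dots> = (\<Sum>a\<in>F. of_nat (card {n. b n = a}) * G a)" using fib[OF F] by simp
      also have "\<dots> \<le> (SUP F\<in>{F. finite F \<and> F \<subseteq> Z}. \<Sum>a\<in>F. of_nat (card {n. b n = a}) * G a)"
        using F by (intro SUP_upper) auto
      finally show ?thesis .
    qed
    then show "(\<Sum>n. G (b n)) \<le> (SUP F\<in>{F. finite F \<and> F \<subseteq> Z}. \<Sum>a\<in>F. of_nat (card {n. b n = a}) * G a)"
      by (intro suminf_le_const) auto
  qed
  finally show ?thesis .
qed

text \<open>The numerator of the difference is \<open>- (1 - |a|) (a + |a| z)\<close>, so the
  smallness of \<open>1 - |a|\<close> can be factored out; this gives convergence of the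
  product.\<close>

lemma blaschke_factor_near_one:
  assumes a: "a \<noteq> 0" "cmod a < 1" and z: "cmod z < 1"
  shows "cmod (blaschke_factor a z - 1) \<le> (1 - cmod a) * (2 / (1 - cmod z))"
proof -
  have d: "1 - cnj a * z \<noteq> 0" using norm_one_minus_cnj_mult_pos[of a z] a z by auto
  have "blaschke_factor a z - 1 = - ((1 - of_real (cmod a)) * (a + of_real (cmod a) * z)) / (a * (1 - cnj a * z))"
  proof -
    have "of_real (cmod a) * (a - z) - a * (1 - cnj a * z) = - ((1 - of_real (cmod a)) * (a + of_real (cmod a) * z))"
    proof -
      have "a * cnj a = of_real (cmod a) * of_real (cmod a)" using complex_norm_square[of a] by (simp add: power2_eq_square)
      then show ?thesis by (simp add: algebra_simps)
    qed
    moreover have "blaschke_factor a z - 1 = (of_real (cmod a) * (a - z) - a * (1 - cnj a * z)) / (a * (1 - cnj a * z))"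
      unfolding blaschke_factor_def using a d by (simp add: diff_divide_distrib)
    ultimately show ?thesis by simp
  qed
  then have "cmod (blaschke_factor a z - 1) = cmod (1 - of_real (cmod a)) * cmod (a + of_real (cmod a) * z) / (cmod a * cmod (1 - cnj a * z))"
    by (simp add: norm_divide norm_mult)
  also have "cmod (1 - of_real (cmod a)) = 1 - cmod a"
  proof -
    have "1 - complex_of_real (cmod a) = of_real (1 - cmod a)" by simp
    then have "cmod (1 - of_real (cmod a)) = \<bar>1 - cmod a\<bar>" by (simp only: norm_of_real)
    then show ?thesis using a by simp
  qed
  also have "(1 - cmod a) * cmod (a + of_real (cmod a) * z) / (cmod a * cmod (1 - cnj a * z))
      \<le> (1 - cmod a) * (cmod a * 2) / (cmod a * (1 - cmod z))"
  proof (intro frac_le mult_left_mono)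
    have "cmod (a + of_real (cmod a) * z) \<le> cmod a + cmod a * cmod z"
      using norm_triangle_ineq[of a "of_real (cmod a) * z"] by (simp add: norm_mult)
    also have "\<dots> \<le> cmod a * 2" using z mult_left_mono[of "cmod z" 1 "cmod a"] by simp
    finally show "cmod (a + of_real (cmod a) * z) \<le> cmod a * 2" .
    show "1 - cmod z \<le> cmod (1 - cnj a * z)" using a by (intro norm_one_minus_cnj_mult_ge) auto
  qed (use a z in auto)
  also have "\<dots> = (1 - cmod a) * (2 / (1 - cmod z))" using a by simp
  finally show ?thesis .
qed

text \<open>Missing indices are filled with the boundary point 1, whose weight \<open>1 - |b n|\<^sup>2\<close> is 0.\<close>

lemma is_blaschke_zero_sequence:
  assumes "is_blaschke B"
  obtains b :: "nat \<Rightarrow> complex" where "\<And>n. cmod (b n) \<le> 1" "summable (\<lambda>n. 1 - cmod (b n))"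
    "\<And>z. cmod z < 1 \<Longrightarrow> (\<lambda>N. \<Prod>n<N. 1 - (1 - (cmod (b n))\<^sup>2) * pkernel z (b n)) \<longlonglongrightarrow> (cmod (B z))\<^sup>2"
proof -
  obtain k a I where I: "\<And>n. n \<in> I \<Longrightarrow> a n \<noteq> 0 \<and> cmod (a n) < 1"
    and sa: "summable (\<lambda>n. if n \<in> I then 1 - cmod (a n) else 0)"
    and B: "\<And>z. cmod z < 1 \<Longrightarrow> B z = z ^ k * (\<Prod>n. if n \<in> I then blaschke_factor (a n) z else 1)"
  proof -
    obtain k a I where H: "\<forall>n\<in>I. a n \<in> ball 0 1 - {0}" "summable (\<lambda>n. if n \<in> I then 1 - cmod (a n) else 0)"
      "\<forall>z\<in>ball 0 1. B z = z ^ k * (\<Prod>n. if n \<in> I then blaschke_factor (a n) z else 1)"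
      using assms unfolding is_blaschke_def by blast
    show ?thesis by (rule that[of I a k]) (use H in auto)
  qed
  \<comment> \<open>The first \<open>k\<close> entries encode the factor \<open>z ^ k\<close>, so
    the Blaschke factors proper start at index \<open>k\<close>.\<close>
  define b where "b n = (if n < k then 0 else if n - k \<in> I then a (n - k) else 1)" for n
  have b1: "cmod (b n) \<le> 1" for n using I[of "n - k"] by (auto simp: b_def)
  have "(\<lambda>n. 1 - cmod (b (n + k))) = (\<lambda>n. if n \<in> I then 1 - cmod (a n) else 0)"
    by (auto simp: b_def fun_eq_iff)
  then have "summable (\<lambda>n. 1 - cmod (b (n + k)))" using sa by simp
  then have sb: "summable (\<lambda>n. 1 - cmod (b n))" by (rule summable_iff_shift[THEN iffD1])
  show ?thesis
  proof (rule that[OF b1 sb])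
    fix z :: complex assume z: "cmod z < 1"
    define g where "g n = (if n \<in> I then blaschke_factor (a n) z else 1)" for n
    have "summable (\<lambda>n. norm (g n - 1))"
    proof (rule summable_comparison_test'[of "\<lambda>n. (if n \<in> I then 1 - cmod (a n) else 0) * (2 / (1 - cmod z))" 0])
      show "summable (\<lambda>n. (if n \<in> I then 1 - cmod (a n) else 0) * (2 / (1 - cmod z)))" by (rule summable_mult2[OF sa])
      show "norm (norm (g n - 1)) \<le> (if n \<in> I then 1 - cmod (a n) else 0) * (2 / (1 - cmod z))" for n
        using blaschke_factor_near_one[of "a n" z] I[of n] z by (auto simp: g_def)
    qed
    then have "convergent_prod g"
      by (intro abs_convergent_prod_imp_convergent_prod) (simp add: abs_convergent_prod_conv_summable)
    then have "(\<lambda>N. \<Prod>n<N. g n) \<longlonglongrightarrow> prodinf g"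
      using convergent_prod_LIMSEQ[of g] by (simp add: LIMSEQ_lessThan_iff_atMost)
    then have "(\<lambda>N. (cmod (z ^ k * (\<Prod>n<N. g n)))\<^sup>2) \<longlonglongrightarrow> (cmod (z ^ k * prodinf g))\<^sup>2"
      by (intro tendsto_intros)
    moreover have "prodinf g = (\<Prod>n. if n \<in> I then blaschke_factor (a n) z else 1)" by (simp add: g_def[abs_def])
    ultimately have lim: "(\<lambda>N. (cmod (z ^ k * (\<Prod>n<N. g n)))\<^sup>2) \<longlonglongrightarrow> (cmod (B z))\<^sup>2"
      using B[OF z] by simp
    have fac: "1 - (1 - (cmod (b n))\<^sup>2) * pkernel z (b n) = (if n < k then (cmod z)\<^sup>2 else (cmod (g (n - k)))\<^sup>2)" for n
    proof -
      consider "n < k" | "\<not> n < k" "n - k \<in> I" | "\<not> n < k" "n - k \<notin> I" by blast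
      then show ?thesis
      proof cases
        case 1
        then show ?thesis by (simp add: b_def pkernel_def)
      next
        case 2
        then show ?thesis
          using pkernel_zero_factor[of "a (n - k)" z] I[of "n - k"] z
          by (simp add: b_def g_def blaschke_factor_def norm_divide norm_mult power_divide)
      next
        case 3
        then show ?thesis by (simp add: b_def g_def)
      qed
    qed
    have "(\<Prod>n<N + k. 1 - (1 - (cmod (b n))\<^sup>2) * pkernel z (b n)) = (cmod (z ^ k * (\<Prod>n<N. g n)))\<^sup>2" for N
    proof (induction N)
      case 0
      have "(\<Prod>n<k. 1 - (1 - (cmod (b n))\<^sup>2) * pkernel z (b n)) = (\<Prod>n<k. (cmod z)\<^sup>2)"
        by (intro prod.cong refl) (simp add: fac)
      then show ?case by (simp add: norm_power power_mult[symmetric] mult.commute)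
    next
      case (Suc N)
      then show ?case using fac[of "N + k"] by (simp add: norm_mult power_mult_distrib)
    qed
    then have "(\<lambda>N. \<Prod>n<N + k. 1 - (1 - (cmod (b n))\<^sup>2) * pkernel z (b n)) \<longlonglongrightarrow> (cmod (B z))\<^sup>2"
      using lim by simp
    then show "(\<lambda>N. \<Prod>n<N. 1 - (1 - (cmod (b n))\<^sup>2) * pkernel z (b n)) \<longlonglongrightarrow> (cmod (B z))\<^sup>2"
      by (rule LIMSEQ_offset)
  qed
qed

section \<open>Orders of zeros read off from the modulus\<close>

lemma power_bound_exponent_le:
  fixes c K \<delta> :: real
  assumes "0 < c" "0 < \<delta>" and bd: "\<And>x. 0 < x \<Longrightarrow> x < \<delta> \<Longrightarrow> c * x ^ m \<le> K * x ^ n"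
  shows "n \<le> m"
proof (rule ccontr)
  assume "\<not> n \<le> m"
  then obtain j where n: "n = m + Suc j" using less_imp_Suc_add[of m n] by auto
  define x where "x = min (\<delta>/2) (min (1/2) (c / (2 * (\<bar>K\<bar> + 1))))"
  have x: "x \<le> 1/2" "x \<le> c / (2 * (\<bar>K\<bar> + 1))" "0 < x" "x \<le> \<delta>/2"
  proof -
    show "x \<le> 1/2" unfolding x_def by (rule min.coboundedI2[OF min.cobounded1])
    show "x \<le> c / (2 * (\<bar>K\<bar> + 1))" unfolding x_def by (rule min.coboundedI2[OF min.cobounded2])
    show "x \<le> \<delta>/2" unfolding x_def by (rule min.cobounded1)
    have "0 < c / (2 * (\<bar>K\<bar> + 1))" using assms by (intro divide_pos_pos) auto
    then show "0 < x" unfolding x_def using assms by (simp add: min_less_iff_conj)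
  qed
  have x\<delta>: "x < \<delta>" using x assms by simp
  have "c * x ^ m \<le> (K * x ^ Suc j) * x ^ m" using bd[OF x(3) x\<delta>] by (simp add: n power_add mult_ac)
  then have "c \<le> K * x ^ Suc j" using x(3) by simp
  also have "\<dots> \<le> \<bar>K\<bar> * x"
  proof -
    have "K * x ^ Suc j \<le> \<bar>K\<bar> * x ^ Suc j" using x by (intro mult_right_mono) auto
    also have "\<dots> \<le> \<bar>K\<bar> * x" using x by (intro mult_left_mono) (auto simp: mult_left_le power_le_one)
    finally show ?thesis .
  qed
  also have "\<dots> \<le> (\<bar>K\<bar> + 1) * (c / (2 * (\<bar>K\<bar> + 1)))" using x by (intro mult_mono) auto
  also have "\<dots> = c / 2" by (simp add: field_simps)
  finally show False using assms by simp
qed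

text \<open>Only moduli are recorded. The condition \<open>modulus\<close> is the formula for
  \<open>|B|^2\<close> as a product over zeros, with \<open>|B|^2\<close> expressed through
  \<open>|f|^2\<close> and the moduli of the other two factors, so \<open>E\<close>,
  \<open>B\<close> and the singular function no longer appear.\<close>

locale factored_map =
  fixes f :: "complex \<Rightarrow> complex" and b :: "nat \<Rightarrow> complex" and \<nu> :: "complex measure"
    and h :: "complex \<Rightarrow> real"
  assumes holf: "f holomorphic_on ball 0 1"
    and f_disc: "\<And>z. cmod z < 1 \<Longrightarrow> cmod (f z) < 1"
    and b_le: "\<And>n. cmod (b n) \<le> 1" and b_summable: "summable (\<lambda>n. 1 - cmod (b n))"
    and \<nu>: "pos_singular_measure \<nu>" and h: "integrable circle_m h"
    and modulus: "\<And>z. cmod z < 1 \<Longrightarrow>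
      (\<lambda>N. \<Prod>n<N. 1 - (1 - (cmod (b n))\<^sup>2) * pkernel z (b n)) \<longlonglongrightarrow>
        (cmod (f z))\<^sup>2 * exp (2 * integral\<^sup>L \<nu> (pkernel z) - 2 * integral\<^sup>L circle_m (\<lambda>\<zeta>. pkernel z \<zeta> * h \<zeta>))"
begin

text \<open>The amount by which the squared modulus of the \<open>n\<close>-th Blaschke factor at
  \<open>z\<close> falls short of 1; 0 for filler entries.\<close>

definition t :: "complex \<Rightarrow> nat \<Rightarrow> real" where "t z n = (1 - (cmod (b n))\<^sup>2) * pkernel z (b n)"
definition V :: "complex \<Rightarrow> real" where "V z = integral\<^sup>L \<nu> (pkernel z)"
definition H :: "complex \<Rightarrow> real" where "H z = integral\<^sup>L circle_m (\<lambda>\<zeta>. pkernel z \<zeta> * h \<zeta>)"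

lemma prod_limit:
  "cmod z < 1 \<Longrightarrow> (\<lambda>N. \<Prod>n<N. 1 - t z n) \<longlonglongrightarrow> (cmod (f z))\<^sup>2 * exp (2 * V z - 2 * H z)"
  using modulus by (simp add: t_def V_def H_def)

lemma one_minus_b_sq: "0 \<le> 1 - (cmod (b n))\<^sup>2" "1 - (cmod (b n))\<^sup>2 \<le> 2 * (1 - cmod (b n))"
  using b_le[of n] one_minus_square_le[of "cmod (b n)"] by (auto simp: power_le_one)

lemma t_eq: "cmod z < 1 \<Longrightarrow> 1 - t z n = (cmod (b n - z))\<^sup>2 / (cmod (1 - cnj (b n) * z))\<^sup>2"
  unfolding t_def by (rule pkernel_zero_factor[OF b_le])

lemma t_nonneg: "cmod z < 1 \<Longrightarrow> 0 \<le> t z n"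
  unfolding t_def using one_minus_b_sq pkernel_nonneg[of z "b n"] by simp

lemma t_le_one:
  assumes z: "cmod z < 1"
  shows "t z n \<le> 1"
proof -
  have "0 \<le> (cmod (b n - z))\<^sup>2 / (cmod (1 - cnj (b n) * z))\<^sup>2" by simp
  then show ?thesis using t_eq[OF z, of n] by linarith
qed

lemma t_le: 
  assumes z: "cmod z < 1"
  shows "t z n \<le> 4 / (1 - cmod z) * (1 - cmod (b n))"
proof -
  have "t z n \<le> (2 * (1 - cmod (b n))) * (2 / (1 - cmod z))"
    unfolding t_def using one_minus_b_sq[of n] pkernel_le[OF z b_le] pkernel_nonneg[of z] z b_le[of n]
    by (intro mult_mono) auto
  then show ?thesis by (simp add: mult_ac)
qed

lemma t_summable:
  assumes z: "cmod z < 1"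
  shows "summable (t z)"
proof (rule summable_comparison_test'[of "\<lambda>n. 4 / (1 - cmod z) * (1 - cmod (b n))" 0])
  show "norm (t z n) \<le> 4 / (1 - cmod z) * (1 - cmod (b n))" for n
    using t_nonneg[OF z, of n] t_le[OF z, of n] by simp
qed (intro summable_mult b_summable)

lemma zero_at_b:
  assumes "cmod (b n) < 1"
  shows "f (b n) = 0"
proof -
  have "t (b n) n = 1" using t_eq[OF assms, of n] by simp
  then have "(\<Prod>m<N. 1 - t (b n) m) = 0" if "N > n" for N using that by (intro prod_zero) auto
  then have "eventually (\<lambda>N. (\<Prod>m<N. 1 - t (b n) m) = 0) sequentially"
    by (auto simp: eventually_sequentially intro: exI[of _ "Suc n"])
  from tendsto_eventually[OF this] prod_limit[OF assms]
  have "(cmod (f (b n)))\<^sup>2 * exp (2 * V (b n) - 2 * H (b n)) = 0" using LIMSEQ_unique by blast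
  then show ?thesis by simp
qed

lemma \<nu>_pkernel:
  assumes z: "cmod z < 1"
  shows "integrable \<nu> (pkernel z)" "0 \<le> V z" "V z \<le> 2 / (1 - cmod z) * measure \<nu> (sphere 0 1)"
    "(\<integral>\<^sup>+\<zeta>. ennreal (pkernel z \<zeta>) \<partial>\<nu>) = ennreal (V z)"
proof -
  note \<nu>D = pos_singular_measureD[OF \<nu>]
  interpret \<nu>: finite_measure \<nu> by (rule \<nu>D)
  have pm: "pkernel z \<in> borel_measurable \<nu>"
    by (simp add: measurable_cong_sets[OF \<nu>D(1) refl] measurable_restrict_space1)
  show i: "integrable \<nu> (pkernel z)"
    using pkernel_le[OF z] pkernel_nonneg[of z] z pm \<nu>D(2)
    by (intro \<nu>.integrable_const_bound[of _ "2 / (1 - cmod z)"] AE_I2) auto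
  show "0 \<le> V z" unfolding V_def using pkernel_nonneg[of z] z by (intro Bochner_Integration.integral_nonneg) auto
  have "V z \<le> integral\<^sup>L \<nu> (\<lambda>_. 2 / (1 - cmod z))"
    unfolding V_def using i pkernel_le[OF z] \<nu>D(2) by (intro integral_mono) auto
  then show "V z \<le> 2 / (1 - cmod z) * measure \<nu> (sphere 0 1)" by (simp add: \<nu>D(2) mult.commute)
  show "(\<integral>\<^sup>+\<zeta>. ennreal (pkernel z \<zeta>) \<partial>\<nu>) = ennreal (V z)"
    unfolding V_def using i pkernel_nonneg[of z] z by (intro nn_integral_eq_integral) auto
qed

lemma h_pkernel:
  assumes z: "cmod z < 1"
  shows "integrable circle_m (\<lambda>\<zeta>. pkernel z \<zeta> * h \<zeta>)" "\<bar>H z\<bar> \<le> 2 / (1 - cmod z) * integral\<^sup>L circle_m (\<lambda>\<zeta>. \<bar>h \<zeta>\<bar>)"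
proof -
  have pm [measurable]: "pkernel z \<in> borel_measurable circle_m" by (intro borel_measurable_circle_mI) simp
  have [measurable]: "h \<in> borel_measurable circle_m" using h by auto
  have i: "integrable circle_m (\<lambda>\<zeta>. 2 / (1 - cmod z) * \<bar>h \<zeta>\<bar>)" using h by auto
  have le: "norm (pkernel z \<zeta> * h \<zeta>) \<le> 2 / (1 - cmod z) * \<bar>h \<zeta>\<bar>" if "\<zeta> \<in> space circle_m" for \<zeta>
  proof -
    have "\<bar>pkernel z \<zeta>\<bar> \<le> 2 / (1 - cmod z)"
      using pkernel_le[OF z, of \<zeta>] pkernel_nonneg[of z \<zeta>] z that by simp
    then show ?thesis unfolding real_norm_def abs_mult by (rule mult_right_mono) simp
  qed
  have le': "norm (pkernel z \<zeta> * h \<zeta>) \<le> norm (2 / (1 - cmod z) * \<bar>h \<zeta>\<bar>)" if "\<zeta> \<in> space circle_m" for \<zeta>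
    using le[OF that] z by (simp only: real_norm_def)
  show "integrable circle_m (\<lambda>\<zeta>. pkernel z \<zeta> * h \<zeta>)"
    by (rule Bochner_Integration.integrable_bound[OF i]) (measurable, rule AE_I2, rule le')
  have "norm (H z) \<le> integral\<^sup>L circle_m (\<lambda>\<zeta>. 2 / (1 - cmod z) * \<bar>h \<zeta>\<bar>)"
    unfolding H_def by (rule norm_integral_le[OF i le])
  then show "\<bar>H z\<bar> \<le> 2 / (1 - cmod z) * integral\<^sup>L circle_m (\<lambda>\<zeta>. \<bar>h \<zeta>\<bar>)" by simp
qed

lemma finite_b_le:
  assumes "\<rho> < 1"
  shows "finite {n. cmod (b n) \<le> \<rho>}"
proof -
  have "eventually (\<lambda>n. 1 - cmod (b n) < 1 - \<rho>) sequentially"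
    using assms by (intro order_tendstoD(2)[OF summable_LIMSEQ_zero[OF b_summable]]) auto
  then obtain N where N: "\<And>n. n \<ge> N \<Longrightarrow> \<rho> < cmod (b n)" by (auto simp: eventually_sequentially)
  have "{n. cmod (b n) \<le> \<rho>} \<subseteq> {..<N}"
  proof
    fix n assume "n \<in> {n. cmod (b n) \<le> \<rho>}"
    then have "\<not> N \<le> n" using N[of n] by auto
    then show "n \<in> {..<N}" by simp
  qed
  then show ?thesis by (rule finite_subset) simp
qed

lemma finite_fiber: "cmod a < 1 \<Longrightarrow> finite {n. b n = a}"
  by (rule finite_subset[OF _ finite_b_le[of "cmod a"]]) auto

text \<open>Only finitely many entries have modulus at most \<open>\<rho> = (1 + |a|) / 2\<close>,
  and all others are at distance at least \<open>(1 - |a|) / 2\<close> from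
  \<open>a\<close>.\<close>

lemma separated_fiber:
  assumes a: "cmod a < 1"
  obtains \<epsilon> where "0 < \<epsilon>" "\<epsilon> \<le> (1 - cmod a) / 2" "\<And>n. b n \<noteq> a \<Longrightarrow> \<epsilon> \<le> cmod (b n - a)"
proof -
  define \<rho> where "\<rho> = (1 + cmod a) / 2"
  have \<rho>: "\<rho> < 1" using a by (simp add: \<rho>_def)
  define T where "T = {n. cmod (b n) \<le> \<rho>} - {n. b n = a}"
  have T: "finite T" unfolding T_def using finite_b_le[OF \<rho>] by simp
  define \<epsilon> where "\<epsilon> = Min (insert ((1 - cmod a) / 2) ((\<lambda>n. cmod (b n - a)) ` T))"
  show ?thesis
  proof (rule that[of \<epsilon>])
    show "0 < \<epsilon>" unfolding \<epsilon>_def using T a by (subst Min_gr_iff) (auto simp: T_def)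
    show "\<epsilon> \<le> (1 - cmod a) / 2" unfolding \<epsilon>_def using T by (intro Min_le) auto
    show "\<epsilon> \<le> cmod (b n - a)" if "b n \<noteq> a" for n
    proof (cases "cmod (b n) \<le> \<rho>")
      case True
      then have "n \<in> T" using that by (simp add: T_def)
      then show ?thesis unfolding \<epsilon>_def using T by (intro Min_le) auto
    next
      case False
      have "cmod (b n) - cmod a \<le> cmod (b n - a)" by (rule norm_triangle_ineq2)
      moreover have "(1 - cmod a) / 2 = \<rho> - cmod a" by (simp add: \<rho>_def field_simps)
      moreover have "\<epsilon> \<le> (1 - cmod a) / 2" unfolding \<epsilon>_def using T by (intro Min_le) auto
      ultimately show ?thesis using False by linarith
    qed
  qed
qed

text \<open>The order of a zero is read off from the growth of the modulus, so that no holomorphy of the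
  individual factors is needed.\<close>

lemma modulus_near_zero:
  assumes a: "cmod a < 1"
  obtains c1 c2 \<delta> where "0 < c1" "0 < c2" "0 < \<delta>" "\<delta> \<le> 1 - cmod a"
    "\<And>z. z \<noteq> a \<Longrightarrow> cmod (z - a) < \<delta> \<Longrightarrow>
       c1 * cmod (z - a) ^ (2 * card {n. b n = a}) \<le> (cmod (f z))\<^sup>2 \<and>
       (cmod (f z))\<^sup>2 \<le> c2 * cmod (z - a) ^ (2 * card {n. b n = a})"
proof -
  obtain \<epsilon> where \<epsilon>: "0 < \<epsilon>" "\<epsilon> \<le> (1 - cmod a) / 2" "\<And>n. b n \<noteq> a \<Longrightarrow> \<epsilon> \<le> cmod (b n - a)"
    using separated_fiber[OF a] by blast
  define S where "S = {n. b n = a}"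
  have S: "finite S" unfolding S_def by (rule finite_fiber[OF a])
  define m where "m = card S"
  define \<eta> where "\<eta> = (1 - cmod a) / 2"
  have \<eta>: "0 < \<eta>" "\<eta> \<le> 1/2" using a by (auto simp: \<eta>_def)
  define \<delta> where "\<delta> = \<epsilon> / 2"
  have \<delta>: "0 < \<delta>" "\<delta> \<le> \<eta>" "\<delta> \<le> 1 - cmod a" using \<epsilon> a by (auto simp: \<delta>_def \<eta>_def)
  \<comment> \<open>For \<open>z\<close> within \<open>\<epsilon>/2\<close> of \<open>a\<close>, a
    factor not vanishing at \<open>a\<close> has numerator at least \<open>\<epsilon>/2\<close> and
    denominator at most 2; this is the square of the quotient.\<close>
  define \<sigma> where "\<sigma> = \<epsilon>\<^sup>2 / 16"
  have \<sigma>: "0 < \<sigma>" "\<sigma> \<le> 1"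
  proof -
    show "0 < \<sigma>" using \<epsilon> by (simp add: \<sigma>_def)
    have "\<epsilon> \<le> 1" using \<epsilon>(2) norm_ge_zero[of a] by argo
    then have "\<epsilon>\<^sup>2 \<le> 1" using \<epsilon>(1) by (intro power_le_one) auto
    then show "\<sigma> \<le> 1" by (simp add: \<sigma>_def)
  qed
  define X where "X = 4 / \<eta> * (\<Sum>n. 1 - cmod (b n))"
  \<comment> \<open>Bounds \<open>2 * V z - 2 * H z\<close> in absolute value for all
    \<open>z\<close> with \<open>\<eta> \<le> 1 - cmod z\<close>.\<close>
  define K where "K = 2 * (2 / \<eta> * measure \<nu> (sphere 0 1)) + 2 * (2 / \<eta> * integral\<^sup>L circle_m (\<lambda>\<zeta>. \<bar>h \<zeta>\<bar>))"
  show ?thesis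
  proof (rule that[of "exp (- (X / \<sigma>)) * exp (- K) * (1/4) ^ m" "exp K * (1 / \<eta>\<^sup>2) ^ m" \<delta>])
    fix z assume za: "z \<noteq> a" and z\<delta>: "cmod (z - a) < \<delta>"
    have "cmod z \<le> cmod a + cmod (z - a)" using norm_triangle_ineq[of a "z - a"] by simp
    then have z\<eta>: "\<eta> \<le> 1 - cmod z" using z\<delta> \<delta> by (simp add: \<eta>_def)
    then have z: "cmod z < 1" using \<eta> by simp
    \<comment> \<open>The \<open>m\<close> factors vanishing at \<open>a\<close> are split off as
      \<open>y ^ m\<close>; the remaining product lies between \<open>exp (- (X / \<sigma>))\<close>
      and 1.\<close>
    define x where "x n = (if n \<in> S then 0 else t z n)" for n
    have x0: "0 \<le> x n" for n using t_nonneg[OF z] by (simp add: x_def)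
    have x\<sigma>: "x n \<le> 1 - \<sigma>" for n
    proof (cases "n \<in> S")
      case True
      then show ?thesis using \<sigma> by (simp add: x_def)
    next
      case False
      then have "\<epsilon> \<le> cmod (b n - a)" using \<epsilon>(3) by (simp add: S_def)
      then have "\<epsilon> / 2 \<le> cmod (b n - z)"
        using norm_triangle_ineq[of "b n - z" "z - a"] z\<delta> by (simp add: \<delta>_def)
      moreover have "cmod (1 - cnj (b n) * z) \<le> 2"
      proof -
        have "cmod (b n) * cmod z \<le> 1" using b_le[of n] z by (intro mult_le_one) auto
        then show ?thesis using norm_triangle_ineq4[of 1 "cnj (b n) * z"] by (simp add: norm_mult)
      qed
      ultimately have "(\<epsilon> / 2)\<^sup>2 / 2\<^sup>2 \<le> (cmod (b n - z))\<^sup>2 / (cmod (1 - cnj (b n) * z))\<^sup>2"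
        using \<epsilon> norm_one_minus_cnj_mult_pos[OF b_le z, of n] by (intro frac_le power_mono) auto
      moreover have "\<sigma> = (\<epsilon> / 2)\<^sup>2 / 2\<^sup>2" by (simp add: \<sigma>_def power_divide)
      ultimately have "\<sigma> \<le> 1 - t z n" unfolding t_eq[OF z] by (simp only:)
      then show ?thesis using False by (simp add: x_def)
    qed
    have xle: "x n \<le> 4 / \<eta> * (1 - cmod (b n))" for n
    proof (cases "n \<in> S")
      case True
      then show ?thesis using \<eta> b_le[of n] by (simp add: x_def)
    next
      case False
      have "4 / (1 - cmod z) * (1 - cmod (b n)) \<le> 4 / \<eta> * (1 - cmod (b n))"
        using z\<eta> \<eta> b_le[of n] by (intro mult_right_mono divide_left_mono) auto
      then show ?thesis using t_le[OF z, of n] False by (simp add: x_def)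
    qed
    have xs: "summable x"
    proof (rule summable_comparison_test'[of "\<lambda>n. 4 / \<eta> * (1 - cmod (b n))" 0])
      show "norm (x n) \<le> 4 / \<eta> * (1 - cmod (b n))" for n using x0[of n] xle[of n] by simp
    qed (intro summable_mult b_summable)
    have xX: "suminf x \<le> X"
    proof -
      have "suminf x \<le> (\<Sum>n. 4 / \<eta> * (1 - cmod (b n)))"
        by (intro suminf_le xle xs summable_mult b_summable)
      also have "\<dots> = X" unfolding X_def by (rule suminf_mult[OF b_summable])
      finally show ?thesis .
    qed
    define y where "y = (cmod (a - z))\<^sup>2 / (cmod (1 - cnj a * z))\<^sup>2"
    have dpos: "0 < cmod (1 - cnj a * z)" using a z by (intro norm_one_minus_cnj_mult_pos) auto
    have y0: "0 < y" using za dpos by (simp add: y_def)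
    have ty: "1 - t z n = y" if "n \<in> S" for n using t_eq[OF z, of n] that by (simp add: S_def y_def)
    define F where "F = (cmod (f z))\<^sup>2 * exp (2 * V z - 2 * H z)"
    obtain N0 where N0: "S \<subseteq> {..<N0}" using S finite_nat_iff_bounded by blast
    have "(\<Prod>n<N. 1 - x n) = (\<Prod>n<N. 1 - t z n) / y ^ m" if "N0 \<le> N" for N
    proof -
      have SN: "S \<subseteq> {..<N}" using N0 that by auto
      have "(\<Prod>n<N. 1 - t z n) = (\<Prod>n\<in>{..<N} - S. 1 - t z n) * (\<Prod>n\<in>S. 1 - t z n)"
        using SN by (intro prod.subset_diff) auto
      also have "(\<Prod>n\<in>S. 1 - t z n) = y ^ m" using ty by (simp add: m_def)
      also have "(\<Prod>n\<in>{..<N} - S. 1 - t z n) = (\<Prod>n<N. 1 - x n)"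
      proof -
        have "(\<Prod>n\<in>{..<N} - S. 1 - t z n) = (\<Prod>n\<in>{..<N} - S. 1 - x n)" by (intro prod.cong) (auto simp: x_def)
        also have "\<dots> = (\<Prod>n<N. 1 - x n)" by (intro prod.mono_neutral_left) (auto simp: x_def)
        finally show ?thesis .
      qed
      finally show ?thesis using y0 by simp
    qed
    then have "eventually (\<lambda>N. (\<Prod>n<N. 1 - t z n) / y ^ m = (\<Prod>n<N. 1 - x n)) sequentially"
      by (auto simp: eventually_sequentially intro!: exI[of _ N0])
    moreover have "(\<lambda>N. (\<Prod>n<N. 1 - t z n) / y ^ m) \<longlonglongrightarrow> F / y ^ m"
      unfolding F_def using y0 by (intro tendsto_intros prod_limit z) auto
    ultimately have lim: "(\<lambda>N. \<Prod>n<N. 1 - x n) \<longlonglongrightarrow> F / y ^ m"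
      by (rule Lim_transform_eventually[rotated])
    have x1: "x n \<le> 1" for n using x\<sigma>[of n] \<sigma> by simp
    have "exp (- (suminf x / \<sigma>)) \<le> F / y ^ m" by (rule prod_one_minus_lower[OF x0 x\<sigma> xs \<sigma>(1) lim])
    moreover have "exp (- (X / \<sigma>)) \<le> exp (- (suminf x / \<sigma>))" using xX \<sigma> by (simp add: divide_right_mono)
    ultimately have "exp (- (X / \<sigma>)) \<le> F / y ^ m" by linarith
    then have lo: "exp (- (X / \<sigma>)) * y ^ m \<le> F" using y0 by (simp add: pos_le_divide_eq)
    have "F / y ^ m \<le> exp (- suminf x)" by (rule prod_one_minus_upper[OF x0 x1 xs lim])
    also have "\<dots> \<le> 1" using suminf_nonneg[OF xs x0] by simp
    finally have up: "F \<le> y ^ m" using y0 by (simp add: divide_le_eq)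
    have KVH: "\<bar>2 * V z - 2 * H z\<bar> \<le> K"
    proof -
      have q: "2 / (1 - cmod z) \<le> 2 / \<eta>" using z\<eta> \<eta> z by (intro divide_left_mono) auto
      have "V z \<le> 2 / \<eta> * measure \<nu> (sphere 0 1)"
        using \<nu>_pkernel(3)[OF z] mult_right_mono[OF q, of "measure \<nu> (sphere 0 1)"] by simp
      moreover have "\<bar>H z\<bar> \<le> 2 / \<eta> * integral\<^sup>L circle_m (\<lambda>\<zeta>. \<bar>h \<zeta>\<bar>)"
        using h_pkernel(2)[OF z] mult_right_mono[OF q, of "integral\<^sup>L circle_m (\<lambda>\<zeta>. \<bar>h \<zeta>\<bar>)"] by simp
      ultimately show ?thesis using \<nu>_pkernel(2)[OF z] unfolding K_def by linarith
    qed
    have fF: "(cmod (f z))\<^sup>2 = F * exp (- (2 * V z - 2 * H z))" by (simp add: F_def mult.assoc exp_add[symmetric])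
    have d2: "cmod (1 - cnj a * z) \<le> 2"
    proof -
      have "cmod a * cmod z \<le> 1" using a z by (intro mult_le_one) auto
      then show ?thesis using norm_triangle_ineq4[of 1 "cnj a * z"] by (simp add: norm_mult)
    qed
    have ylo: "(cmod (z - a))\<^sup>2 * (1/4) \<le> y"
    proof -
      have "(cmod (a - z))\<^sup>2 / 2\<^sup>2 \<le> y" unfolding y_def using d2 dpos by (intro frac_le power_mono) auto
      then show ?thesis by (simp add: norm_minus_commute)
    qed
    have yup: "y \<le> (cmod (z - a))\<^sup>2 * (1 / \<eta>\<^sup>2)"
    proof -
      have "\<eta> \<le> cmod (1 - cnj a * z)" using norm_one_minus_cnj_mult_ge[of a z] a z\<eta> by simp
      then have "y \<le> (cmod (a - z))\<^sup>2 / \<eta>\<^sup>2" unfolding y_def using \<eta> by (intro frac_le power_mono) auto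
      then show ?thesis by (simp add: norm_minus_commute)
    qed
    have pw: "cmod (z - a) ^ (2 * card {n. b n = a}) = ((cmod (z - a))\<^sup>2) ^ m"
      by (simp add: m_def S_def power_mult)
    have lo2: "exp (- (X / \<sigma>)) * exp (- K) * (1/4) ^ m * ((cmod (z - a))\<^sup>2) ^ m \<le> (cmod (f z))\<^sup>2"
    proof -
      have "((cmod (z - a))\<^sup>2 * (1/4)) ^ m \<le> y ^ m" using ylo by (intro power_mono) auto
      then have "exp (- (X / \<sigma>)) * ((cmod (z - a))\<^sup>2 * (1/4)) ^ m \<le> F"
        using lo by (meson exp_ge_zero mult_left_mono order_trans)
      then have "(exp (- (X / \<sigma>)) * ((cmod (z - a))\<^sup>2 * (1/4)) ^ m) * exp (- K) \<le> F * exp (- (2 * V z - 2 * H z))"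
        using KVH y0 lo by (intro mult_mono) (auto simp: F_def)
      then show ?thesis unfolding fF power_mult_distrib by (simp add: mult_ac)
    qed
    have up2: "(cmod (f z))\<^sup>2 \<le> exp K * (1 / \<eta>\<^sup>2) ^ m * ((cmod (z - a))\<^sup>2) ^ m"
    proof -
      have "y ^ m \<le> ((cmod (z - a))\<^sup>2 * (1 / \<eta>\<^sup>2)) ^ m" using yup y0 by (intro power_mono) auto
      then have "F \<le> ((cmod (z - a))\<^sup>2 * (1 / \<eta>\<^sup>2)) ^ m" using up by simp
      then have "F * exp (- (2 * V z - 2 * H z)) \<le> ((cmod (z - a))\<^sup>2 * (1 / \<eta>\<^sup>2)) ^ m * exp K"
        using KVH by (intro mult_mono) (auto simp: F_def)
      then show ?thesis unfolding fF power_mult_distrib by (simp add: mult_ac)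
    qed
    show "exp (- (X / \<sigma>)) * exp (- K) * (1/4) ^ m * cmod (z - a) ^ (2 * card {n. b n = a}) \<le> (cmod (f z))\<^sup>2 \<and>
       (cmod (f z))\<^sup>2 \<le> exp K * (1 / \<eta>\<^sup>2) ^ m * cmod (z - a) ^ (2 * card {n. b n = a})"
      unfolding pw using lo2 up2 by blast
  qed (use \<delta> \<eta> in auto)
qed

text \<open>The local factorization \<open>f w = g w * (w - a) ^ k\<close> with \<open>g\<close>
  nonvanishing and the product over \<open>b\<close> both pin \<open>|f|^2\<close> between multiples
  of a power of the distance to \<open>a\<close>, which forces equal exponents. Points
  \<open>a + s\<close> with real \<open>s > 0\<close> suffice for the comparison.\<close>

lemma zorder_eq_card:
  assumes a: "cmod a < 1"
  shows "zorder f a = int (card {n. b n = a})"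
proof -
  define m where "m = card {n. b n = a}"
  obtain c1 c2 \<delta> where c: "0 < c1" "0 < c2" "0 < \<delta>" "\<delta> \<le> 1 - cmod a"
    and bd: "\<And>z. z \<noteq> a \<Longrightarrow> cmod (z - a) < \<delta> \<Longrightarrow>
       c1 * cmod (z - a) ^ (2 * m) \<le> (cmod (f z))\<^sup>2 \<and> (cmod (f z))\<^sup>2 \<le> c2 * cmod (z - a) ^ (2 * m)"
    unfolding m_def using modulus_near_zero[OF a] by metis
  have pt: "a + of_real s \<noteq> a" "cmod (a + of_real s - a) = s" if "0 < s" for s :: real using that by auto
  have nz: "\<exists>w\<in>ball 0 1. f w \<noteq> 0"
  proof (rule bexI[of _ "a + of_real (\<delta>/2)"])
    have s: "0 < \<delta>/2" "\<delta>/2 < \<delta>" using c by auto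
    have "c1 * (\<delta>/2) ^ (2 * m) \<le> (cmod (f (a + of_real (\<delta>/2))))\<^sup>2"
      using bd[of "a + of_real (\<delta>/2)"] pt[OF s(1)] s by simp
    moreover have "0 < c1 * (\<delta>/2) ^ (2 * m)" using c by simp
    ultimately show "f (a + of_real (\<delta>/2)) \<noteq> 0" by auto
    have "cmod (a + of_real (\<delta>/2)) \<le> cmod a + \<delta>/2"
      using norm_triangle_ineq[of a "of_real (\<delta>/2)"] s by (simp del: of_real_divide)
    then show "a + of_real (\<delta>/2) \<in> ball 0 1" using c by simp
  qed
  have ab: "a \<in> ball 0 1" using a by simp
  define k where "k = nat (zorder f a)"
  obtain r g where r: "0 < r" "cball a r \<subseteq> ball 0 1" "g holomorphic_on cball a r"
    "\<And>w. w \<in> cball a r \<Longrightarrow> f w = g w * (w - a) ^ k \<and> g w \<noteq> 0"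
    and z0: "0 \<le> zorder f a"
    using zorder_exist_zero[OF holf open_ball connected_ball ab nz] unfolding k_def by (metis order.refl order_less_imp_le)
  have cont: "continuous_on (cball a r) (\<lambda>w. (cmod (g w))\<^sup>2)"
    using r(3) by (intro continuous_intros holomorphic_on_imp_continuous_on)
  have ne: "cball a r \<noteq> {}" using r by simp
  obtain w1 where w1: "w1 \<in> cball a r" "\<And>w. w \<in> cball a r \<Longrightarrow> (cmod (g w1))\<^sup>2 \<le> (cmod (g w))\<^sup>2"
    using continuous_attains_inf[OF compact_cball ne cont] by blast
  obtain w2 where w2: "w2 \<in> cball a r" "\<And>w. w \<in> cball a r \<Longrightarrow> (cmod (g w))\<^sup>2 \<le> (cmod (g w2))\<^sup>2"
    using continuous_attains_sup[OF compact_cball ne cont] by blast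
  have fw: "(cmod (f (a + of_real s)))\<^sup>2 = (cmod (g (a + of_real s)))\<^sup>2 * s ^ (2 * k)" and sr: "a + of_real s \<in> cball a r"
    if "0 < s" "s < min \<delta> r" for s :: real
  proof -
    show sr: "a + of_real s \<in> cball a r" using that by (simp add: dist_norm)
    show "(cmod (f (a + of_real s)))\<^sup>2 = (cmod (g (a + of_real s)))\<^sup>2 * s ^ (2 * k)"
      using r(4)[OF sr] that by (simp add: norm_mult norm_power power_mult_distrib power_mult[symmetric] mult.commute)
  qed
  have "2 * k \<le> 2 * m"
  proof (rule power_bound_exponent_le[of c1 "min \<delta> r"])
    fix s :: real assume s: "0 < s" "s < min \<delta> r"
    have "c1 * s ^ (2 * m) \<le> (cmod (f (a + of_real s)))\<^sup>2" using bd[of "a + of_real s"] pt[OF s(1)] s by simp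
    also have "\<dots> \<le> (cmod (g w2))\<^sup>2 * s ^ (2 * k)"
      unfolding fw[OF s] using w2(2)[OF sr[OF s]] s by (intro mult_right_mono) auto
    finally show "c1 * s ^ (2 * m) \<le> (cmod (g w2))\<^sup>2 * s ^ (2 * k)" .
  qed (use c r in auto)
  moreover have "2 * m \<le> 2 * k"
  proof (rule power_bound_exponent_le[of "(cmod (g w1))\<^sup>2" "min \<delta> r"])
    fix s :: real assume s: "0 < s" "s < min \<delta> r"
    have "(cmod (g w1))\<^sup>2 * s ^ (2 * k) \<le> (cmod (f (a + of_real s)))\<^sup>2"
      unfolding fw[OF s] using w1(2)[OF sr[OF s]] s by (intro mult_right_mono) auto
    also have "\<dots> \<le> c2 * s ^ (2 * m)" using bd[of "a + of_real s"] pt[OF s(1)] s by simp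
    finally show "(cmod (g w1))\<^sup>2 * s ^ (2 * k) \<le> c2 * s ^ (2 * m)" .
  qed (use c r w1 in auto)
  ultimately show ?thesis using z0 by (simp add: k_def m_def)
qed

end

section \<open>The factorization and the theorem\<close>

context factored_map
begin

lemma f_mult_le:
  assumes z: "cmod z < 1"
  shows "(cmod (f z))\<^sup>2 \<le> exp (- suminf (t z) - 2 * V z + 2 * H z)"
proof -
  define F where "F = (cmod (f z))\<^sup>2 * exp (2 * V z - 2 * H z)"
  have "F \<le> exp (- suminf (t z))"
    unfolding F_def by (rule prod_one_minus_upper[OF t_nonneg[OF z] t_le_one[OF z] t_summable[OF z] prod_limit[OF z]])
  then have "F * exp (- (2 * V z - 2 * H z)) \<le> exp (- suminf (t z)) * exp (- (2 * V z - 2 * H z))"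
    by (intro mult_right_mono) auto
  moreover have "F * exp (- (2 * V z - 2 * H z)) = (cmod (f z))\<^sup>2"
    by (simp add: F_def mult.assoc exp_add[symmetric])
  moreover have "exp (- suminf (t z)) * exp (- (2 * V z - 2 * H z)) = exp (- suminf (t z) - 2 * V z + 2 * H z)"
    unfolding exp_add[symmetric] by (simp add: algebra_simps)
  ultimately show ?thesis by (simp only:)
qed

text \<open>A sum of nonnegative terms that is at most 1/2 has all terms at most 1/2, so the product
  bound applies with \<open>\<sigma> = 1/2\<close> and doubles the sum. The contributions of
  \<open>\<nu>\<close> and \<open>h\<close> are exact.\<close>

lemma f_mult_ge:
  assumes z: "cmod z < 1" and s: "suminf (t z) \<le> 1/2"
  shows "exp (- 2 * suminf (t z) - 2 * V z + 2 * H z) \<le> (cmod (f z))\<^sup>2"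
proof -
  have half: "t z n \<le> 1 - 1/2" for n
  proof -
    have "t z n = (\<Sum>k\<in>{n}. t z k)" by simp
    also have "\<dots> \<le> suminf (t z)"
      by (rule sum_le_suminf[OF t_summable[OF z]]) (use t_nonneg[OF z] in auto)
    finally show ?thesis using s by simp
  qed
  define F where "F = (cmod (f z))\<^sup>2 * exp (2 * V z - 2 * H z)"
  have "exp (- (suminf (t z) / (1/2))) \<le> F"
    unfolding F_def by (rule prod_one_minus_lower[OF t_nonneg[OF z] half t_summable[OF z] _ prod_limit[OF z]]) simp
  then have "exp (- (suminf (t z) / (1/2))) * exp (- (2 * V z - 2 * H z)) \<le> F * exp (- (2 * V z - 2 * H z))"
    by (intro mult_right_mono) auto
  moreover have "F * exp (- (2 * V z - 2 * H z)) = (cmod (f z))\<^sup>2"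
    by (simp add: F_def mult.assoc exp_add[symmetric])
  moreover have "exp (- (suminf (t z) / (1/2))) * exp (- (2 * V z - 2 * H z)) = exp (- 2 * suminf (t z) - 2 * V z + 2 * H z)"
    unfolding exp_add[symmetric] by (simp add: algebra_simps)
  ultimately show ?thesis by (simp only:)
qed

text \<open>Along the radii \<open>r k\<close> the quantity \<open>Q = |f|^2 exp (- 2 H)\<close>
  converges and is at most 1. It is close to 1 whenever the singular contribution \<open>W\<close>
  is small, which happens infinitely often, so the limit is 1 and
  \<open>|l| = exp (h \<zeta>)\<close>. The sign of \<open>h\<close> then comes from
  \<open>|f| < 1\<close>.\<close>

lemma boundary_modulus: "AE \<zeta> in circle_m. ln (cmod (radial_lim f \<zeta>)) = h \<zeta> \<and> h \<zeta> \<le> 0"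
proof -
  define r where "r k = 1 - 1 / real (k + 2)" for k
  have r: "0 \<le> r k" "r k < 1" for k by (auto simp: r_def)
  have rlim: "r \<longlonglongrightarrow> 1"
    unfolding r_def using tendsto_diff[OF tendsto_const LIMSEQ_ignore_initial_segment[OF lim_1_over_n, of 2], of 1] by simp
  have rleft: "filterlim r (at_left 1) sequentially"
  proof -
    have "eventually (\<lambda>k. r k \<in> {..<1} \<and> r k \<noteq> 1) sequentially"
      using r by (intro always_eventually allI) (auto simp: less_imp_neq)
    then show ?thesis using rlim by (simp add: filterlim_at)
  qed
  have f1: "cmod (f z) \<le> 1" if "cmod z < 1" for z using f_disc[OF that] by simp
  have hc: "integrable circle_m (\<lambda>\<zeta>. complex_of_real (h \<zeta>))" using h by (rule integrable_of_real)
  note S = singular_part_liminf[OF b_le b_summable \<nu> r_def]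
  have Fat: "AE \<zeta> in circle_m. \<exists>l. ((\<lambda>r. f (of_real r * \<zeta>)) \<longlongrightarrow> l) (at_left 1)"
    by (rule Fatou_radial_limit[OF holf]) (rule f1)
  show ?thesis
    using Fat poisson_integral_radial_limit[OF hc] S AE_space[of circle_m]
  proof eventually_elim
    case (elim \<zeta>)
    then have \<zeta>: "cmod \<zeta> = 1" by simp
    obtain l where l: "((\<lambda>r. f (of_real r * \<zeta>)) \<longlongrightarrow> l) (at_left 1)" using elim(1) by blast
    define z where "z k = of_real (r k) * \<zeta>" for k
    have z: "cmod (z k) < 1" for k using r[of k] \<zeta> by (simp add: z_def norm_mult)
    have fl: "(\<lambda>k. f (z k)) \<longlonglongrightarrow> l" unfolding z_def by (rule filterlim_compose[OF l rleft])
    have Hl: "(\<lambda>k. H (z k)) \<longlonglongrightarrow> h \<zeta>"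
    proof -
      have "(\<lambda>k. integral\<^sup>L circle_m (\<lambda>w. pkernel (of_real (r k) * \<zeta>) w *\<^sub>R complex_of_real (h w))) \<longlonglongrightarrow> complex_of_real (h \<zeta>)"
        by (rule filterlim_compose[OF elim(2) rleft])
      moreover have "integral\<^sup>L circle_m (\<lambda>w. pkernel (of_real (r k) * \<zeta>) w *\<^sub>R complex_of_real (h w)) = complex_of_real (H (z k))" for k
        unfolding H_def z_def integral_complex_of_real[symmetric] by (simp add: scaleR_conv_of_real)
      ultimately show ?thesis by (simp only: tendsto_of_real_iff)
    qed
    define Q where "Q k = (cmod (f (z k)))\<^sup>2 * exp (- 2 * H (z k))" for k
    define q where "q = (cmod l)\<^sup>2 * exp (- 2 * h \<zeta>)"
    have Qlim: "Q \<longlonglongrightarrow> q" unfolding Q_def q_def by (intro tendsto_intros fl Hl)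
    define W where "W k = suminf (t (z k)) + V (z k)" for k
    have s0: "0 \<le> suminf (t (z k))" for k by (rule suminf_nonneg[OF t_summable[OF z] t_nonneg[OF z]])
    have W0: "0 \<le> W k" for k using s0 \<nu>_pkernel(2)[OF z] by (simp add: W_def)
    have Wlim: "liminf (\<lambda>k. ennreal (W k)) = 0"
    proof -
      have "(\<Sum>n. ennreal ((1 - (cmod (b n))\<^sup>2) * pkernel (of_real (r k) * \<zeta>) (b n))) + (\<integral>\<^sup>+w. ennreal (pkernel (of_real (r k) * \<zeta>) w) \<partial>\<nu>) = ennreal (W k)" for k
      proof -
        have "(\<Sum>n. ennreal (t (z k) n)) = ennreal (suminf (t (z k)))"
          by (rule suminf_ennreal2[OF t_nonneg[OF z] t_summable[OF z]])
        then show ?thesis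
          using \<nu>_pkernel(2,4)[OF z, of k] s0[of k] by (simp add: W_def t_def z_def)
      qed
      then show ?thesis using elim(3) by simp
    qed
    have Qle: "Q k \<le> 1" for k
    proof -
      have "Q k \<le> exp (- suminf (t (z k)) - 2 * V (z k) + 2 * H (z k)) * exp (- 2 * H (z k))"
        unfolding Q_def by (intro mult_right_mono f_mult_le z) auto
      also have "\<dots> = exp (- suminf (t (z k)) - 2 * V (z k))" by (simp add: exp_add[symmetric])
      also have "\<dots> \<le> 1" using s0[of k] \<nu>_pkernel(2)[OF z, of k] by simp
      finally show ?thesis .
    qed
    have q1: "q \<le> 1" using Qlim Qle by (intro LIMSEQ_le_const2) auto
    have "1 \<le> q + e" if e: "0 < e" for e
    proof (rule ccontr)
      assume "\<not> 1 \<le> q + e"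
      \<comment> \<open>If the limit of \<open>Q\<close> were below \<open>1 - 2 * d\<close>, then
        \<open>W\<close> would eventually be at least \<open>d\<close>, since
        \<open>exp (- 2 * W k) \<le> Q k\<close> as soon as \<open>W k < d \<le> 1/2\<close>; this
        contradicts the vanishing lower limit.\<close>
      define d where "d = min (e/2) (1/2)"
      have d: "0 < d" "2 * d \<le> e" "d \<le> 1/2" using e by (auto simp: d_def)
      have "q < 1 - 2 * d" using d \<open>\<not> 1 \<le> q + e\<close> by simp
      then have "eventually (\<lambda>k. Q k < 1 - 2 * d) sequentially" by (rule order_tendstoD(2)[OF Qlim])
      then have "eventually (\<lambda>k. ennreal d \<le> ennreal (W k)) sequentially"
      proof eventually_elim
        case (elim k)
        show ?case
        proof (rule ccontr)
          assume "\<not> ennreal d \<le> ennreal (W k)"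
          then have Wd: "W k < d" using d W0[of k] by (simp add: not_le ennreal_less_iff)
          then have sd: "suminf (t (z k)) \<le> 1/2" using d \<nu>_pkernel(2)[OF z, of k] by (simp add: W_def)
          have "1 - 2 * d \<le> exp (- 2 * d)" using exp_ge_add_one_self[of "- 2 * d"] by simp
          also have "\<dots> \<le> exp (- 2 * suminf (t (z k)) - 2 * V (z k))" using Wd by (simp add: W_def)
          also have "\<dots> = exp (- 2 * suminf (t (z k)) - 2 * V (z k) + 2 * H (z k)) * exp (- 2 * H (z k))"
            by (simp add: exp_add[symmetric])
          also have "\<dots> \<le> Q k" unfolding Q_def by (intro mult_right_mono f_mult_ge z sd) auto
          finally show False using elim by simp
        qed
      qed
      then have "ennreal d \<le> liminf (\<lambda>k. ennreal (W k))" by (rule Liminf_bounded)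
      then show False using Wlim d by simp
    qed
    then have "1 \<le> q" by (rule field_le_epsilon)
    then have "q = 1" using q1 by simp
    then have "(cmod l)\<^sup>2 * exp (- 2 * h \<zeta>) * exp (2 * h \<zeta>) = exp (2 * h \<zeta>)" by (simp add: q_def)
    then have "(cmod l)\<^sup>2 = exp (2 * h \<zeta>)" by (simp add: mult.assoc exp_add[symmetric])
    also have "\<dots> = (exp (h \<zeta>))\<^sup>2" by (simp add: exp_double)
    finally have le: "cmod l = exp (h \<zeta>)" by (rule power2_eq_imp_eq) auto
    have "radial_lim f \<zeta> = l" unfolding radial_lim_def by (rule tendsto_Lim[OF _ l]) simp
    moreover have "cmod l \<le> 1"
      using f1[OF z] by (intro LIMSEQ_le_const2[OF tendsto_norm[OF fl]]) auto
    ultimately show ?case using le by simp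
  qed
qed

text \<open>Integration against \<open>\<mu>\<close>, with the zeros listed by \<open>b\<close>,
  filler entries having weight 0, and with \<open>- h\<close> in place of the logarithm of the
  radial limits.\<close>

definition L :: "(complex \<Rightarrow> ennreal) \<Rightarrow> ennreal" where
  "L \<phi> = (\<Sum>n. ennreal (1 - (cmod (b n))\<^sup>2) * \<phi> (b n)) + 2 * (\<integral>\<^sup>+\<zeta>. \<phi> \<zeta> \<partial>\<nu>)
    + 2 * (\<integral>\<^sup>+\<zeta>. ennreal (- h \<zeta>) * \<phi> \<zeta> \<partial>circle_m)"

definition P :: "complex \<Rightarrow> real" where "P z = suminf (t z) + 2 * V z - 2 * H z"

lemma H_nonpos: "H z \<le> 0" if "cmod z < 1"
proof -
  have "AE \<zeta> in circle_m. 0 \<le> - (pkernel z \<zeta> * h \<zeta>)"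
    using boundary_modulus by eventually_elim (use pkernel_nonneg[of z] that in \<open>auto intro: mult_nonneg_nonpos\<close>)
  then have "0 \<le> integral\<^sup>L circle_m (\<lambda>\<zeta>. - (pkernel z \<zeta> * h \<zeta>))" by (rule integral_nonneg_AE)
  then show ?thesis by (simp add: H_def)
qed

lemma L_pkernel_eq:
  assumes z: "cmod z < 1"
  shows "L (\<lambda>w. ennreal (pkernel z w)) = ennreal (P z)"
proof -
  have "(\<Sum>n. ennreal (1 - (cmod (b n))\<^sup>2) * ennreal (pkernel z (b n))) = (\<Sum>n. ennreal (t z n))"
    using one_minus_b_sq by (intro suminf_cong) (simp add: t_def ennreal_mult')
  also have "\<dots> = ennreal (suminf (t z))" by (rule suminf_ennreal2[OF t_nonneg[OF z] t_summable[OF z]])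
  finally have 1: "(\<Sum>n. ennreal (1 - (cmod (b n))\<^sup>2) * ennreal (pkernel z (b n))) = ennreal (suminf (t z))" .
  have "(\<integral>\<^sup>+\<zeta>. ennreal (- h \<zeta>) * ennreal (pkernel z \<zeta>) \<partial>circle_m) = (\<integral>\<^sup>+\<zeta>. ennreal (- (pkernel z \<zeta> * h \<zeta>)) \<partial>circle_m)"
  proof (rule nn_integral_cong)
    fix \<zeta>
    have "ennreal (pkernel z \<zeta> * - h \<zeta>) = ennreal (pkernel z \<zeta>) * ennreal (- h \<zeta>)"
      using pkernel_nonneg[of z \<zeta>] z by (intro ennreal_mult') auto
    then show "ennreal (- h \<zeta>) * ennreal (pkernel z \<zeta>) = ennreal (- (pkernel z \<zeta> * h \<zeta>))" by (simp add: mult.commute)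
  qed
  also have "\<dots> = ennreal (integral\<^sup>L circle_m (\<lambda>\<zeta>. - (pkernel z \<zeta> * h \<zeta>)))"
  proof (rule nn_integral_eq_integral)
    show "integrable circle_m (\<lambda>\<zeta>. - (pkernel z \<zeta> * h \<zeta>))" using h_pkernel(1)[OF z] by simp
    show "AE \<zeta> in circle_m. 0 \<le> - (pkernel z \<zeta> * h \<zeta>)"
      using boundary_modulus by eventually_elim (use pkernel_nonneg[of z] z in \<open>auto intro: mult_nonneg_nonpos\<close>)
  qed
  finally have 2: "(\<integral>\<^sup>+\<zeta>. ennreal (- h \<zeta>) * ennreal (pkernel z \<zeta>) \<partial>circle_m) = ennreal (- H z)" by (simp add: H_def)
  have two: "2 * ennreal x = ennreal (2 * x)" if "0 \<le> x" for x using that by (simp add: ennreal_mult)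
  have n: "0 \<le> suminf (t z)" "0 \<le> V z" "0 \<le> - H z"
    using suminf_nonneg[OF t_summable[OF z] t_nonneg[OF z]] \<nu>_pkernel(2)[OF z] H_nonpos[OF z] by auto
  have "L (\<lambda>w. ennreal (pkernel z w)) = ennreal (suminf (t z)) + ennreal (2 * V z) + ennreal (2 * (- H z))"
    unfolding L_def 1 2 \<nu>_pkernel(4)[OF z] using n by (simp only: two)
  also have "\<dots> = ennreal (suminf (t z) + 2 * V z + 2 * (- H z))"
    using n by (simp add: ennreal_plus[symmetric] del: ennreal_plus)
  finally show ?thesis by (simp add: P_def)
qed

sublocale mass_functional f L P
proof
  note \<nu>D = pos_singular_measureD[OF \<nu>]
  have [measurable]: "h \<in> borel_measurable circle_m" using h by auto
  have m\<nu>: "\<phi> \<in> borel_measurable \<nu>" if "\<phi> \<in> borel_measurable borel" for \<phi> :: "complex \<Rightarrow> ennreal"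
    using that by (simp add: measurable_cong_sets[OF \<nu>D(1) refl] measurable_restrict_space1)
  show "f holomorphic_on ball 0 1" by (rule holf)
  show "cmod (f z) < 1" if "cmod z < 1" for z by (rule f_disc[OF that])
  \<comment> \<open>Entries of \<open>b\<close> in the open disc are zeros of \<open>f\<close> by
    \<open>zero_at_b\<close>; every other point evaluated lies on the circle.\<close>
  show "L \<phi> \<le> L \<psi>" if le: "\<And>w. cmod w \<le> 1 \<Longrightarrow> (cmod w < 1 \<Longrightarrow> f w = 0) \<Longrightarrow> \<phi> w \<le> \<psi> w" for \<phi> \<psi>
    unfolding L_def
  proof (intro add_mono mult_left_mono)
    show "(\<Sum>n. ennreal (1 - (cmod (b n))\<^sup>2) * \<phi> (b n)) \<le> (\<Sum>n. ennreal (1 - (cmod (b n))\<^sup>2) * \<psi> (b n))"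
      by (intro suminf_le mult_left_mono le b_le zero_at_b summableI) auto
    show "(\<integral>\<^sup>+\<zeta>. \<phi> \<zeta> \<partial>\<nu>) \<le> (\<integral>\<^sup>+\<zeta>. \<psi> \<zeta> \<partial>\<nu>)"
      using \<nu>D(2) by (intro nn_integral_mono le) auto
    show "(\<integral>\<^sup>+\<zeta>. ennreal (- h \<zeta>) * \<phi> \<zeta> \<partial>circle_m) \<le> (\<integral>\<^sup>+\<zeta>. ennreal (- h \<zeta>) * \<psi> \<zeta> \<partial>circle_m)"
      by (intro nn_integral_mono mult_left_mono le) auto
  qed auto
  show "L (\<lambda>w. \<phi> w + \<psi> w) = L \<phi> + L \<psi>" if m: "\<phi> \<in> borel_measurable borel" "\<psi> \<in> borel_measurable borel" for \<phi> \<psi>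
  proof -
    have [measurable]: "\<phi> \<in> borel_measurable circle_m" "\<psi> \<in> borel_measurable circle_m"
      using m by (auto intro: borel_measurable_circle_mI)
    have 1: "(\<Sum>n. ennreal (1 - (cmod (b n))\<^sup>2) * (\<phi> (b n) + \<psi> (b n)))
        = (\<Sum>n. ennreal (1 - (cmod (b n))\<^sup>2) * \<phi> (b n)) + (\<Sum>n. ennreal (1 - (cmod (b n))\<^sup>2) * \<psi> (b n))"
      unfolding distrib_left by (intro suminf_add[symmetric] summableI)
    have 2: "(\<integral>\<^sup>+\<zeta>. \<phi> \<zeta> + \<psi> \<zeta> \<partial>\<nu>) = (\<integral>\<^sup>+\<zeta>. \<phi> \<zeta> \<partial>\<nu>) + (\<integral>\<^sup>+\<zeta>. \<psi> \<zeta> \<partial>\<nu>)"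
      using m by (intro nn_integral_add m\<nu>)
    have 3: "(\<integral>\<^sup>+\<zeta>. ennreal (- h \<zeta>) * (\<phi> \<zeta> + \<psi> \<zeta>) \<partial>circle_m)
        = (\<integral>\<^sup>+\<zeta>. ennreal (- h \<zeta>) * \<phi> \<zeta> \<partial>circle_m) + (\<integral>\<^sup>+\<zeta>. ennreal (- h \<zeta>) * \<psi> \<zeta> \<partial>circle_m)"
      unfolding distrib_left by (rule nn_integral_add) measurable
    show ?thesis unfolding L_def 1 2 3 by (simp add: distrib_left add_ac)
  qed
  show "L (\<lambda>w. c * \<phi> w) = c * L \<phi>" if m: "\<phi> \<in> borel_measurable borel" for c \<phi>
  proof -
    have [measurable]: "\<phi> \<in> borel_measurable circle_m" using m by (rule borel_measurable_circle_mI)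
    have 1: "(\<Sum>n. ennreal (1 - (cmod (b n))\<^sup>2) * (c * \<phi> (b n))) = c * (\<Sum>n. ennreal (1 - (cmod (b n))\<^sup>2) * \<phi> (b n))"
      unfolding ennreal_suminf_cmult[symmetric] by (simp add: mult.left_commute)
    have 2: "(\<integral>\<^sup>+\<zeta>. c * \<phi> \<zeta> \<partial>\<nu>) = c * (\<integral>\<^sup>+\<zeta>. \<phi> \<zeta> \<partial>\<nu>)"
      using m by (intro nn_integral_cmult m\<nu>)
    have "(\<integral>\<^sup>+\<zeta>. ennreal (- h \<zeta>) * (c * \<phi> \<zeta>) \<partial>circle_m) = (\<integral>\<^sup>+\<zeta>. c * (ennreal (- h \<zeta>) * \<phi> \<zeta>) \<partial>circle_m)"
      by (simp add: mult.left_commute)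
    also have "\<dots> = c * (\<integral>\<^sup>+\<zeta>. ennreal (- h \<zeta>) * \<phi> \<zeta> \<partial>circle_m)"
      by (rule nn_integral_cmult) measurable
    finally have 3: "(\<integral>\<^sup>+\<zeta>. ennreal (- h \<zeta>) * (c * \<phi> \<zeta>) \<partial>circle_m) = c * (\<integral>\<^sup>+\<zeta>. ennreal (- h \<zeta>) * \<phi> \<zeta> \<partial>circle_m)" .
    show ?thesis unfolding L_def 1 2 3 by (simp add: distrib_left mult.left_commute)
  qed
  fix z assume z: "cmod z < 1"
  have n: "0 \<le> suminf (t z)" "0 \<le> V z" "0 \<le> - H z"
    using suminf_nonneg[OF t_summable[OF z] t_nonneg[OF z]] \<nu>_pkernel(2)[OF z] H_nonpos[OF z] by auto
  show "0 \<le> P z" using n by (simp add: P_def)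
  show "L (\<lambda>w. ennreal (pkernel z w)) = ennreal (P z)" by (rule L_pkernel_eq[OF z])
  show "(cmod (f z))\<^sup>2 \<le> exp (- P z)" using f_mult_le[OF z] by (simp add: P_def algebra_simps)
  assume "P z \<le> 1/2"
  then have "suminf (t z) \<le> 1/2" using n by (simp add: P_def)
  then have "exp (- 2 * suminf (t z) - 2 * V z + 2 * H z) \<le> (cmod (f z))\<^sup>2" by (rule f_mult_ge[OF z])
  \<comment> \<open>Only the sum over zeros was doubled; doubling the other two nonnegative
    contributions as well merely weakens the bound.\<close>
  moreover have "exp (- 2 * P z) \<le> exp (- 2 * suminf (t z) - 2 * V z + 2 * H z)"
    using n by (simp add: P_def algebra_simps)
  ultimately show "exp (- 2 * P z) \<le> (cmod (f z))\<^sup>2" by (rule order_trans[rotated])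
qed

text \<open>With \<open>\<phi> = 1\<close> this serves \<open>mu_meas\<close>, with the Poisson
  kernel and \<open>A = UNIV\<close> it serves \<open>poisson_mu\<close>. Multiplicities become
  fiber sizes by \<open>zorder_eq_card\<close>.\<close>

lemma zero_sum_eq:
  assumes \<phi>: "\<And>w. cmod w \<le> 1 \<Longrightarrow> 0 \<le> \<phi> w"
  shows "(\<Sum>\<^sub>\<infinity>a\<in>zeros_in_disc f \<inter> A. ennreal (of_int (zorder f a) * (1 - (cmod a)\<^sup>2) * \<phi> a))
     = (\<Sum>n. ennreal (1 - (cmod (b n))\<^sup>2) * (ennreal (\<phi> (b n)) * indicator A (b n)))"
proof -
  define G where "G a = ennreal (1 - (cmod a)\<^sup>2) * (ennreal (\<phi> a) * indicator A a)" for a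
  have "(\<Sum>\<^sub>\<infinity>a\<in>zeros_in_disc f \<inter> A. ennreal (of_int (zorder f a) * (1 - (cmod a)\<^sup>2) * \<phi> a))
      = (\<Sum>\<^sub>\<infinity>a\<in>zeros_in_disc f \<inter> A. of_nat (card {n. b n = a}) * G a)"
  proof (rule infsum_cong)
    fix a assume "a \<in> zeros_in_disc f \<inter> A"
    then have a: "cmod a < 1" "a \<in> A" by (auto simp: zeros_in_disc_def)
    have "ennreal (real (card {n. b n = a}) * ((1 - (cmod a)\<^sup>2) * \<phi> a)) = ennreal (real (card {n. b n = a})) * (ennreal (1 - (cmod a)\<^sup>2) * ennreal (\<phi> a))"
      using a \<phi>[of a] by (simp add: ennreal_mult' power_le_one)
    then show "ennreal (of_int (zorder f a) * (1 - (cmod a)\<^sup>2) * \<phi> a) = of_nat (card {n. b n = a}) * G a"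
      using a by (simp add: zorder_eq_card G_def ennreal_of_nat_eq_real_of_nat mult.assoc)
  qed
  also have "\<dots> = (\<Sum>n. G (b n))"
  proof (rule infsum_fibers_eq_suminf)
    show "finite {n. b n = a}" if "a \<in> zeros_in_disc f \<inter> A" for a
      using that by (intro finite_fiber) (auto simp: zeros_in_disc_def)
    show "G (b n) = 0" if "b n \<notin> zeros_in_disc f \<inter> A" for n
    proof (cases "b n \<in> A")
      case True
      then have "\<not> cmod (b n) < 1" using that zero_at_b[of n] by (auto simp: zeros_in_disc_def)
      then have "cmod (b n) = 1" using b_le[of n] by simp
      then show ?thesis by (simp add: G_def)
    qed (simp add: G_def)
  qed
  finally show ?thesis by (simp add: G_def)
qed

lemma mu_meas_eq:
  assumes "closed A"
  shows "mu_meas f \<nu> A = L (indicator A)"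
proof -
  note \<nu>D = pos_singular_measureD[OF \<nu>]
  have 1: "(\<Sum>\<^sub>\<infinity>a\<in>zeros_in_disc f \<inter> A. ennreal (of_int (zorder f a) * (1 - (cmod a)\<^sup>2))) = (\<Sum>n. ennreal (1 - (cmod (b n))\<^sup>2) * indicator A (b n))"
    using zero_sum_eq[of "\<lambda>_. 1" A] by simp
  have "A \<in> sets borel" using assms by (rule borel_closed)
  then have "A \<inter> space \<nu> \<in> sets \<nu>" unfolding \<nu>D(1,2) by (auto simp: sets_restrict_space)
  then have 2: "(\<integral>\<^sup>+\<zeta>. indicator A \<zeta> \<partial>\<nu>) = emeasure \<nu> (A \<inter> sphere 0 1)"
    by (subst nn_integral_indicator') (simp_all add: \<nu>D(2))
  have 3: "(\<integral>\<^sup>+\<zeta>. ennreal (- ln (cmod (radial_lim f \<zeta>))) * indicator A \<zeta> \<partial>circle_m) = (\<integral>\<^sup>+\<zeta>. ennreal (- h \<zeta>) * indicator A \<zeta> \<partial>circle_m)"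
    using boundary_modulus by (intro nn_integral_cong_AE) (auto elim: eventually_mono)
  show ?thesis unfolding mu_meas_def L_def 1 2 3 ..
qed

lemma poisson_mu_eq:
  assumes z: "cmod z < 1"
  shows "poisson_mu f \<nu> z = ennreal (P z)"
proof -
  have 1: "(\<Sum>\<^sub>\<infinity>a\<in>zeros_in_disc f. ennreal (of_int (zorder f a) * (1 - (cmod a)\<^sup>2) * pkernel z a)) = (\<Sum>n. ennreal (1 - (cmod (b n))\<^sup>2) * ennreal (pkernel z (b n)))"
    using zero_sum_eq[of "pkernel z" UNIV] pkernel_nonneg[of z] z by simp
  have 3: "(\<integral>\<^sup>+\<zeta>. ennreal (pkernel z \<zeta> * - ln (cmod (radial_lim f \<zeta>))) \<partial>circle_m) = (\<integral>\<^sup>+\<zeta>. ennreal (- h \<zeta>) * ennreal (pkernel z \<zeta>) \<partial>circle_m)"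
  proof (rule nn_integral_cong_AE)
    show "AE \<zeta> in circle_m. ennreal (pkernel z \<zeta> * - ln (cmod (radial_lim f \<zeta>))) = ennreal (- h \<zeta>) * ennreal (pkernel z \<zeta>)"
      using boundary_modulus
    proof eventually_elim
      case (elim \<zeta>)
      have "ennreal (pkernel z \<zeta> * - h \<zeta>) = ennreal (pkernel z \<zeta>) * ennreal (- h \<zeta>)"
        using pkernel_nonneg[of z \<zeta>] z by (intro ennreal_mult') auto
      then show ?case using elim by (simp only: mult.commute)
    qed
  qed
  have "poisson_mu f \<nu> z = L (\<lambda>w. ennreal (pkernel z w))" unfolding poisson_mu_def L_def 1 3 ..
  then show ?thesis by (simp add: L_pkernel_eq[OF z])
qed

end

section \<open>From the stated factorization to the abstract functional\<close>

lemma ennreal_le_divide_iff: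
  assumes "0 \<le> x" "0 < l"
  shows "ennreal x \<le> M / ennreal l \<longleftrightarrow> ennreal (x * l) \<le> M"
proof (cases M)
  case (real m)
  then show ?thesis using assms by (simp add: divide_ennreal pos_le_divide_eq)
next
  case top
  then show ?thesis using assms by (simp add: ennreal_top_divide)
qed

text \<open>The kernel splits as \<open>w / (w - z) + z / (w - z)\<close>, and on the circle the
  second term is the conjugate of the second summand in \<open>pkernel_on_circle\<close>.\<close>

lemma Re_herglotz_kernel:
  assumes z: "cmod z < 1" and w: "cmod w = 1"
  shows "Re ((w + z) / (w - z)) = pkernel z w"
proof -
  have ww: "w * cnj w = 1" using complex_norm_square[of w] w by simp
  have "cnj (cnj z * w / (1 - cnj z * w)) = (w * (z * cnj w)) / (w * (1 - z * cnj w))"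
    using w by (subst mult_divide_mult_cancel_left) auto
  also have "w * (z * cnj w) = z" using ww by (simp add: mult.left_commute)
  also have "w * (1 - z * cnj w) = w - z" using ww by (simp add: right_diff_distrib mult.left_commute)
  finally have c: "Re (z / (w - z)) = Re (cnj z * w / (1 - cnj z * w))" by (metis complex_cnj(1) complex_cnj_cnj cnj.sel(1))
  have "Re ((w + z) / (w - z)) = Re (w / (w - z)) + Re (z / (w - z))" by (simp add: add_divide_distrib)
  also have "\<dots> = Re (w / (w - z) + cnj z * w / (1 - cnj z * w))" by (simp only: c plus_complex.sel)
  also have "\<dots> = pkernel z w" unfolding pkernel_on_circle[OF z w, symmetric] by simp
  finally show ?thesis .
qed

lemma herglotz_kernel_bound:
  assumes z: "cmod z < 1" and w: "cmod w = 1"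
  shows "cmod ((w + z) / (w - z)) \<le> 2 / (1 - cmod z)"
proof -
  have "cmod (w + z) \<le> 2" using norm_triangle_ineq[of w z] z w by simp
  moreover have "1 - cmod z \<le> cmod (w - z)" using norm_triangle_ineq2[of w z] w by simp
  ultimately show ?thesis unfolding norm_divide using z by (intro frac_le) auto
qed

lemma herglotz_kernel_measurable: "(\<lambda>w::complex. (w + z) / (w - z)) \<in> borel_measurable borel"
  by measurable

lemma norm_outer:
  assumes h: "integrable circle_m h" and z: "cmod z < 1"
  shows "cmod (exp (integral\<^sup>L circle_m (\<lambda>\<zeta>. (\<zeta> + z) / (\<zeta> - z) * complex_of_real (h \<zeta>))))
    = exp (integral\<^sup>L circle_m (\<lambda>\<zeta>. pkernel z \<zeta> * h \<zeta>))"
proof -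
  have [measurable]: "h \<in> borel_measurable circle_m" using h by auto
  have km [measurable]: "(\<lambda>w. (w + z) / (w - z)) \<in> borel_measurable circle_m"
    by (rule borel_measurable_circle_mI[OF herglotz_kernel_measurable])
  have i: "integrable circle_m (\<lambda>\<zeta>. (\<zeta> + z) / (\<zeta> - z) * complex_of_real (h \<zeta>))"
  proof (rule Bochner_Integration.integrable_bound)
    show "integrable circle_m (\<lambda>\<zeta>. 2 / (1 - cmod z) * h \<zeta>)" using h by simp
    show "(\<lambda>\<zeta>. (\<zeta> + z) / (\<zeta> - z) * complex_of_real (h \<zeta>)) \<in> borel_measurable circle_m"
      by (intro borel_measurable_times km borel_measurable_of_real) measurable
    show "AE \<zeta> in circle_m. cmod ((\<zeta> + z) / (\<zeta> - z) * complex_of_real (h \<zeta>)) \<le> norm (2 / (1 - cmod z) * h \<zeta>)"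
    proof (rule AE_I2)
      fix \<zeta> assume "\<zeta> \<in> space circle_m"
      then have "cmod ((\<zeta> + z) / (\<zeta> - z)) \<le> \<bar>2 / (1 - cmod z)\<bar>" using herglotz_kernel_bound[OF z, of \<zeta>] z by simp
      then have "cmod ((\<zeta> + z) / (\<zeta> - z)) * \<bar>h \<zeta>\<bar> \<le> \<bar>2 / (1 - cmod z)\<bar> * \<bar>h \<zeta>\<bar>" by (rule mult_right_mono) simp
      then show "cmod ((\<zeta> + z) / (\<zeta> - z) * complex_of_real (h \<zeta>)) \<le> norm (2 / (1 - cmod z) * h \<zeta>)"
        by (simp only: norm_mult norm_of_real real_norm_def abs_mult)
    qed
  qed
  have "Re (integral\<^sup>L circle_m (\<lambda>\<zeta>. (\<zeta> + z) / (\<zeta> - z) * complex_of_real (h \<zeta>)))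
      = integral\<^sup>L circle_m (\<lambda>\<zeta>. Re ((\<zeta> + z) / (\<zeta> - z) * complex_of_real (h \<zeta>)))"
    by (rule integral_Re[OF i, symmetric])
  also have "\<dots> = integral\<^sup>L circle_m (\<lambda>\<zeta>. pkernel z \<zeta> * h \<zeta>)"
  proof (intro Bochner_Integration.integral_cong refl)
    fix \<zeta> assume "\<zeta> \<in> space circle_m"
    then have "Re ((\<zeta> + z) / (\<zeta> - z)) = pkernel z \<zeta>" by (intro Re_herglotz_kernel z) simp
    moreover have "Re (u * complex_of_real x) = Re u * x" for u x by simp
    ultimately show "Re ((\<zeta> + z) / (\<zeta> - z) * complex_of_real (h \<zeta>)) = pkernel z \<zeta> * h \<zeta>" by (simp only:)
  qed
  finally show ?thesis by (simp add: norm_exp_eq_Re)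
qed

lemma norm_singular_inner:
  assumes \<nu>: "pos_singular_measure \<nu>" and z: "cmod z < 1"
  shows "cmod (singular_inner \<nu> z) = exp (- integral\<^sup>L \<nu> (pkernel z))"
proof -
  note \<nu>D = pos_singular_measureD[OF \<nu>]
  interpret \<nu>: finite_measure \<nu> by (rule \<nu>D)
  have i: "integrable \<nu> (\<lambda>\<zeta>. (\<zeta> + z) / (\<zeta> - z))"
  proof (rule \<nu>.integrable_const_bound[of _ "2 / (1 - cmod z)"])
    show "AE \<zeta> in \<nu>. cmod ((\<zeta> + z) / (\<zeta> - z)) \<le> 2 / (1 - cmod z)"
      using \<nu>D(2) by (intro AE_I2 herglotz_kernel_bound z) auto
    show "(\<lambda>\<zeta>. (\<zeta> + z) / (\<zeta> - z)) \<in> borel_measurable \<nu>"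
      unfolding measurable_cong_sets[OF \<nu>D(1) refl] by (rule measurable_restrict_space1[OF herglotz_kernel_measurable])
  qed
  have "Re (integral\<^sup>L \<nu> (\<lambda>\<zeta>. (\<zeta> + z) / (\<zeta> - z))) = integral\<^sup>L \<nu> (\<lambda>\<zeta>. Re ((\<zeta> + z) / (\<zeta> - z)))"
    by (rule integral_Re[OF i, symmetric])
  also have "\<dots> = integral\<^sup>L \<nu> (pkernel z)"
    using \<nu>D(2) by (intro Bochner_Integration.integral_cong refl Re_herglotz_kernel z) simp
  finally show ?thesis by (simp add: singular_inner_def norm_exp_eq_Re)
qed

theorem theorem2:
  fixes f E B :: "complex \<Rightarrow> complex" and \<nu> :: "complex measure"
  assumes "f holomorphic_on ball 0 1"
    and "f ` ball 0 1 \<subseteq> ball 0 1"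
    and "is_outer E" and "is_blaschke B" and "pos_singular_measure \<nu>"
    and "\<forall>z\<in>ball 0 1. f z = E z * B z * singular_inner \<nu> z"
  shows "contractive f \<longleftrightarrow>
    (\<exists>C>0. \<forall>\<theta> l. 0 < l \<and> l \<le> 1 \<and> poisson_mu f \<nu> (zQ \<theta> l) \<le> ennreal C \<longrightarrow>
        mu_meas f \<nu> (closure (carleson_box \<theta> l)) / ennreal l \<ge> ennreal C * poisson_mu f \<nu> (zQ \<theta> l))"
proof -
  obtain h c where h: "integrable circle_m h" and c: "cmod c = 1"
    and E: "\<And>z. cmod z < 1 \<Longrightarrow> E z = c * exp (integral\<^sup>L circle_m (\<lambda>\<zeta>. (\<zeta> + z) / (\<zeta> - z) * complex_of_real (h \<zeta>)))"
    using \<open>is_outer E\<close> unfolding is_outer_def by auto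
  obtain b where b: "\<And>n. cmod (b n) \<le> 1" "summable (\<lambda>n. 1 - cmod (b n))"
    "\<And>z. cmod z < 1 \<Longrightarrow> (\<lambda>N. \<Prod>n<N. 1 - (1 - (cmod (b n))\<^sup>2) * pkernel z (b n)) \<longlonglongrightarrow> (cmod (B z))\<^sup>2"
    using is_blaschke_zero_sequence[OF \<open>is_blaschke B\<close>] by blast
  interpret factored_map f b \<nu> h
  proof
    show "cmod (f z) < 1" if "cmod z < 1" for z using assms(2) that by (auto simp: image_subset_iff)
    fix z assume z: "cmod z < 1"
    define v where "v = integral\<^sup>L \<nu> (pkernel z)"
    define u where "u = integral\<^sup>L circle_m (\<lambda>\<zeta>. pkernel z \<zeta> * h \<zeta>)"
    have "cmod (f z) = exp u * cmod (B z) * exp (- v)"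
    proof -
      have "cmod (E z) = exp u" unfolding E[OF z] norm_mult c norm_outer[OF h z] u_def by simp
      moreover have "cmod (singular_inner \<nu> z) = exp (- v)" unfolding v_def by (rule norm_singular_inner[OF assms(5) z])
      moreover have "f z = E z * B z * singular_inner \<nu> z" using assms(6) z by simp
      ultimately show ?thesis by (simp add: norm_mult)
    qed
    then have "(cmod (f z))\<^sup>2 = (cmod (B z))\<^sup>2 * (exp (2 * u) * exp (2 * (- v)))"
      unfolding exp_double by (simp add: power_mult_distrib mult_ac)
    then have "(cmod (f z))\<^sup>2 = (cmod (B z))\<^sup>2 * exp (2 * u - 2 * v)"
      by (simp add: exp_add[symmetric])
    then have "(cmod (f z))\<^sup>2 * exp (2 * v - 2 * u) = (cmod (B z))\<^sup>2"
      by (simp add: mult.assoc exp_add[symmetric])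
    then show "(\<lambda>N. \<Prod>n<N. 1 - (1 - (cmod (b n))\<^sup>2) * pkernel z (b n)) \<longlonglongrightarrow>
        (cmod (f z))\<^sup>2 * exp (2 * integral\<^sup>L \<nu> (pkernel z) - 2 * integral\<^sup>L circle_m (\<lambda>\<zeta>. pkernel z \<zeta> * h \<zeta>))"
      using b(3)[OF z] by (simp add: u_def v_def)
  qed (use assms h b in auto)
  \<comment> \<open>For \<open>l > 0\<close> the division clears in \<open>ennreal\<close>, and
    \<open>poisson_mu\<close> is finite at points of the disc, so both sides of the criterion
    translate into statements about \<open>P\<close> and \<open>L\<close>.\<close>
  have box: "(poisson_mu f \<nu> (zQ \<theta> l) \<le> ennreal C \<longleftrightarrow> P (zQ \<theta> l) \<le> C) \<and>
      (mu_meas f \<nu> (closure (carleson_box \<theta> l)) / ennreal l \<ge> ennreal C * poisson_mu f \<nu> (zQ \<theta> l) \<longleftrightarrow>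
       ennreal (C * l * P (zQ \<theta> l)) \<le> L (indicator (closure (carleson_box \<theta> l))))"
    if "0 < C" "0 < l" "l \<le> 1" for C \<theta> l
  proof -
    have z: "cmod (zQ \<theta> l) < 1" using that by (intro zQ_in_disc)
    have p0: "0 \<le> P (zQ \<theta> l)" by (rule P_nonneg[OF z])
    have "ennreal C * poisson_mu f \<nu> (zQ \<theta> l) = ennreal (C * P (zQ \<theta> l))"
      using that p0 by (simp add: poisson_mu_eq[OF z] ennreal_mult)
    then show ?thesis
      using that p0 ennreal_le_divide_iff[of "C * P (zQ \<theta> l)" l "L (indicator (closure (carleson_box \<theta> l)))"]
      by (simp add: poisson_mu_eq[OF z] mu_meas_eq mult_ac)
  qed
  show ?thesis
  proof
    assume "contractive f"
    from contractive_imp_mass_bound[OF this] obtain C where C: "0 < C"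
      "\<And>\<theta> l. 0 < l \<Longrightarrow> l \<le> 1 \<Longrightarrow> P (zQ \<theta> l) \<le> C \<Longrightarrow> ennreal (C * l * P (zQ \<theta> l)) \<le> L (indicator (closure (carleson_box \<theta> l)))"
      by blast
    show "\<exists>C>0. \<forall>\<theta> l. 0 < l \<and> l \<le> 1 \<and> poisson_mu f \<nu> (zQ \<theta> l) \<le> ennreal C \<longrightarrow>
        mu_meas f \<nu> (closure (carleson_box \<theta> l)) / ennreal l \<ge> ennreal C * poisson_mu f \<nu> (zQ \<theta> l)"
      by (intro exI[of _ C] conjI allI impI C(1)) (use C box[OF C(1)] in auto)
  next
    assume "\<exists>C>0. \<forall>\<theta> l. 0 < l \<and> l \<le> 1 \<and> poisson_mu f \<nu> (zQ \<theta> l) \<le> ennreal C \<longrightarrow>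
        mu_meas f \<nu> (closure (carleson_box \<theta> l)) / ennreal l \<ge> ennreal C * poisson_mu f \<nu> (zQ \<theta> l)"
    then obtain C where C: "0 < C" "\<And>\<theta> l. 0 < l \<Longrightarrow> l \<le> 1 \<Longrightarrow> poisson_mu f \<nu> (zQ \<theta> l) \<le> ennreal C \<Longrightarrow>
        mu_meas f \<nu> (closure (carleson_box \<theta> l)) / ennreal l \<ge> ennreal C * poisson_mu f \<nu> (zQ \<theta> l)" by blast
    show "contractive f"
    proof (rule mass_bound_imp_contractive[OF C(1)])
      fix \<theta> l :: real assume l: "0 < l" "l \<le> 1" and p: "P (zQ \<theta> l) \<le> C"
      from box[OF C(1) l, of \<theta>] C(2)[OF l, of \<theta>] p
      show "ennreal (C * l * P (zQ \<theta> l)) \<le> L (indicator (closure (carleson_box \<theta> l)))" by blast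
    qed
  qed
qed

end
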